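(* Let $\theta\in(0,1)$ be irrational and let $h:\mathbb{R}\to\mathbb{R}$ be even, smooth and exponentially decaying. Let $H(b)$, $b\in\mathbb{R}$, be the incommensurate coupled chain operators on $\ell^2(\mathbb{Z})\oplus\ell^2(\mathbb{Z})$, with truncations $H_L(b)=1_{\Lambda_L}H(b)1_{\Lambda_L}$, $L>0$ (see context). Suppose that for all $b\in\mathbb{R}$ and $L>0$ the difference $H_L(b)-1_{\Lambda_L}H(b)$ is trace-class and $$\operatorname{tr}\left|H_L(b)-1_{\Lambda_L}H(b)\right|\le\varepsilon(L)\,|\Lambda_L|$$ with $\varepsilon(L)\to0$ as $L\to\infty$. Then for almost all $b\in\mathbb{R}$ with respect to Lebesgue measure and all $g\in C_c(\mathbb{R})$, as $L\to\infty$, $$\frac{1}{|\Lambda_L|}\left(\sum_{x\in\Lambda_L^1}\langle\delta_{1x},g(H_L(b))\delta_{1x}\rangle+\sum_{x\in\Lambda_L^2}\langle\delta_{2x},g(H_L(b))\delta_{2x}\rangle\right)$$ converges to $$\frac{1-\theta}{1+(1-\theta)}\int_{[0,1-\theta)}\langle\delta_{10},g(H(b_2))\delta_{10}\rangle\,\mathrm{d}\mathbb{P}_2(b_2)+\frac{1}{1+(1-\theta)}\int_{[0,1)}\langle\delta_{20},g(H(b_1))\delta_{20}\rangle\,\mathrm{d}\mathbb{P}_1(b_1),$$ where $\mathbb{P}_2$ and $\mathbb{P}_1$ are the normalized Lebesgue measures on $[0,1-\theta)$ and $[0,1)$ respectively. In particular, the measures $\mathrm{d}k_{b,L}$ converge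 weakly to $\mathrm{d}k$ as $L\to\infty$, i.e. $\lim_{L\to\infty}\int g\,\mathrm{d}k_{b,L}=\int g\,\mathrm{d}k$.
   Context: Elements of $\ell^2(\mathbb{Z})\oplus\ell^2(\mathbb{Z})$ are written $\psi=(\psi_1,\psi_2)$, $\psi_i=(\psi_{in})_{n\in\mathbb{Z}}$, with the natural inner product. $(\Delta\phi)_n:=\phi_{n+1}-2\phi_n+\phi_{n-1}$. Exponentially decaying means $|h(\eta)|\le Ce^{-c|\eta|}$ for some $C,c>0$. For $b\in\mathbb{R}$, the incommensurate coupled chain operator is the self-adjoint operator $$(H(b)\psi)_{1n}=-(\Delta\psi_1)_n+\sum_{n'\in\mathbb{Z}}h(n-(1-\theta)n'-b)\psi_{2n'},\qquad (H(b)\psi)_{2n}=-(\Delta\psi_2)_n+\sum_{n'\in\mathbb{Z}}h((1-\theta)n+b-n')\psi_{1n'}.$$ For $b\in\mathbb{R}$ and $L>0$: $\Lambda_L^1:=\mathbb{Z}\cap[-L,L]$, $\Lambda_L^2:=\mathbb{Z}\cap\left[\frac{-L-b}{1-\theta},\frac{L-b}{1-\theta}\right]$, $|\Lambda_L|:=|\Lambda_L^1|+|\Lambda_L^2|$ (cardinalities). The projection $1_{\Lambda_L}$ sets $\psi_{1n}$ to $0$ for $n\notin\Lambda_L^1$ and $\psi_{2n}$ to $0$ for $n\notin\Lambda_L^2$, leaving other entries unchanged. $\delta_{ix}$ is the vector with entry $1$ at site $x$ of layer $i$ and $0$ elsewhere. $C_c(\mathbb{R})$ is the space of continuous compactly supported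 functions. $\mathrm{d}k_{b,L}$ is the unique Radon measure on $\mathbb{R}$ with $\int g\,\mathrm{d}k_{b,L}=\frac{1}{|\Lambda_L|}\big(\sum_{x\in\Lambda_L^1}\langle\delta_{1x},g(H_L(b))\delta_{1x}\rangle+\sum_{x\in\Lambda_L^2}\langle\delta_{2x},g(H_L(b))\delta_{2x}\rangle\big)$ for all $g\in C_c(\mathbb{R})$, and $\mathrm{d}k$ is the unique Radon measure on $\mathbb{R}$ with $\int g\,\mathrm{d}k$ equal to the limiting expression in the claim for all $g\in C_c(\mathbb{R})$. *)

theory Defs
  imports "HOL-Analysis.Analysis" "HOL-Computational_Algebra.Polynomial"
begin

section \<open>The complex Hilbert space of square-summable families\<close>

typedef 'i ell2 = "{f :: 'i \<Rightarrow> complex. (\<lambda>i. (cmod (f i))\<^sup>2) summable_on UNIV}"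
  morphisms coord Abs_ell2
  by (rule exI[of _ "\<lambda>_. 0"]) simp

setup_lifting type_definition_ell2

lemma ell2_summable_add:
  assumes "(\<lambda>i. (cmod (f i))\<^sup>2) summable_on UNIV" "(\<lambda>i. (cmod (g i))\<^sup>2) summable_on UNIV"
  shows "(\<lambda>i. (cmod (f i + g i))\<^sup>2) summable_on UNIV"
proof (rule summable_on_comparison_test)
  show "(\<lambda>i. 2 * (cmod (f i))\<^sup>2 + 2 * (cmod (g i))\<^sup>2) summable_on UNIV"
    using assms by (intro summable_on_add summable_on_cmult_right) auto
next
  fix i
  have "(cmod (f i + g i))\<^sup>2 \<le> (cmod (f i) + cmod (g i))\<^sup>2"
    by (intro power_mono norm_triangle_ineq) auto
  also have "\<dots> \<le> 2 * (cmod (f i))\<^sup>2 + 2 * (cmod (g i))\<^sup>2"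
    using sum_squares_bound[of "cmod (f i)" "cmod (g i)"] by (simp add: power2_sum)
  finally show "(cmod (f i + g i))\<^sup>2 \<le> 2 * (cmod (f i))\<^sup>2 + 2 * (cmod (g i))\<^sup>2" .
qed auto

lemma ell2_summable_scale:
  assumes "(\<lambda>i. (cmod (f i))\<^sup>2) summable_on UNIV"
  shows "(\<lambda>i. (cmod (c * f i))\<^sup>2) summable_on UNIV"
  using assms by (simp add: norm_mult power_mult_distrib summable_on_cmult_right)

lemma ell2_summable_cmod_mult:
  assumes "(\<lambda>i. (cmod (f i))\<^sup>2) summable_on UNIV" "(\<lambda>i. (cmod (g i))\<^sup>2) summable_on UNIV"
  shows "(\<lambda>i. cmod (f i) * cmod (g i)) summable_on UNIV"
proof (rule summable_on_comparison_test)
  show "(\<lambda>i. (cmod (f i))\<^sup>2 + (cmod (g i))\<^sup>2) summable_on UNIV"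
    using assms by (intro summable_on_add)
next
  fix i
  have "0 \<le> cmod (f i) * cmod (g i)" by simp
  then show "cmod (f i) * cmod (g i) \<le> (cmod (f i))\<^sup>2 + (cmod (g i))\<^sup>2"
    using sum_squares_bound[of "cmod (f i)" "cmod (g i)"] by linarith
qed auto

lemma ell2_summable_inner:
  assumes "(\<lambda>i. (cmod (f i))\<^sup>2) summable_on UNIV" "(\<lambda>i. (cmod (g i))\<^sup>2) summable_on UNIV"
  shows "(\<lambda>i. f i \<bullet> g i) summable_on UNIV"
proof (rule abs_summable_summable, rule Infinite_Sum.abs_summable_on_comparison_test)
  show "(\<lambda>i. norm (cmod (f i) * cmod (g i))) summable_on UNIV"
    using ell2_summable_cmod_mult[OF assms] by simp
  show "norm (f i \<bullet> g i) \<le> norm (cmod (f i) * cmod (g i))" for i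
    using Cauchy_Schwarz_ineq2[of "f i" "g i"] by simp
qed

instantiation ell2 :: (type) real_vector
begin

lift_definition zero_ell2 :: "'a ell2" is "\<lambda>_. 0" by simp
lift_definition plus_ell2 :: "'a ell2 \<Rightarrow> 'a ell2 \<Rightarrow> 'a ell2" is "\<lambda>f g i. f i + g i"
  by (rule ell2_summable_add)
lift_definition uminus_ell2 :: "'a ell2 \<Rightarrow> 'a ell2" is "\<lambda>f i. - f i" by simp
lift_definition minus_ell2 :: "'a ell2 \<Rightarrow> 'a ell2 \<Rightarrow> 'a ell2" is "\<lambda>f g i. f i - g i"
  using ell2_summable_add[of _ "\<lambda>i. - _ i"] by simp
lift_definition scaleR_ell2 :: "real \<Rightarrow> 'a ell2 \<Rightarrow> 'a ell2" is "\<lambda>r f i. r *\<^sub>R f i"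
  unfolding scaleR_conv_of_real by (rule ell2_summable_scale)

instance
proof
  fix x y z :: "'a ell2" and a b :: real
  show "x + y + z = x + (y + z)" by transfer (simp add: add.assoc)
  show "x + y = y + x" by transfer (simp add: add.commute)
  show "0 + x = x" by transfer simp
  show "- x + x = 0" by transfer simp
  show "x - y = x + - y" by transfer simp
  show "a *\<^sub>R (x + y) = a *\<^sub>R x + a *\<^sub>R y" by transfer (simp add: scaleR_add_right)
  show "(a + b) *\<^sub>R x = a *\<^sub>R x + b *\<^sub>R x" by transfer (simp add: scaleR_add_left)
  show "a *\<^sub>R b *\<^sub>R x = (a * b) *\<^sub>R x" by transfer simp
  show "1 *\<^sub>R x = x" by transfer simp
qed

end

instantiation ell2 :: (type) real_inner
begin

text \<open>On \<^typ>\<open>complex\<close> the library inner product is \<open>Re (cnj x * y)\<close>, so this is the real part of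
  the sesquilinear inner product \<open>cinner\<close> below and induces the usual norm.\<close>

lift_definition inner_ell2 :: "'a ell2 \<Rightarrow> 'a ell2 \<Rightarrow> real" is "\<lambda>f g. \<Sum>\<^sub>\<infinity>i. f i \<bullet> g i" .

definition norm_ell2 :: "'a ell2 \<Rightarrow> real" where "norm_ell2 f = sqrt (f \<bullet> f)"
definition sgn_ell2 :: "'a ell2 \<Rightarrow> 'a ell2" where "sgn_ell2 f = f /\<^sub>R norm f"
definition dist_ell2 :: "'a ell2 \<Rightarrow> 'a ell2 \<Rightarrow> real" where "dist_ell2 f g = norm (f - g)"
definition uniformity_ell2 :: "('a ell2 \<times> 'a ell2) filter" where
  "uniformity_ell2 = (INF e\<in>{0<..}. principal {(x, y). dist x y < e})"
definition open_ell2 :: "'a ell2 set \<Rightarrow> bool" where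
  "open_ell2 U = (\<forall>x\<in>U. eventually (\<lambda>(x', y). x' = x \<longrightarrow> y \<in> U) uniformity)"

instance
proof
  fix x y z :: "'a ell2" and r :: real
  show "sgn x = x /\<^sub>R norm x" by (rule sgn_ell2_def)
  show "dist x y = norm (x - y)" by (rule dist_ell2_def)
  show "(uniformity :: ('a ell2 \<times> 'a ell2) filter) = (INF e\<in>{0<..}. principal {(x, y). dist x y < e})"
    by (rule uniformity_ell2_def)
  show "open U = (\<forall>x\<in>U. eventually (\<lambda>(x', y). x' = x \<longrightarrow> y \<in> U) uniformity)" for U :: "'a ell2 set"
    by (rule open_ell2_def)
  show "x \<bullet> y = y \<bullet> x" by transfer (simp add: inner_commute)
  show "(x + y) \<bullet> z = x \<bullet> z + y \<bullet> z"
    by transfer (simp add: inner_add_left infsum_add ell2_summable_inner)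
  show "(r *\<^sub>R x) \<bullet> y = r * (x \<bullet> y)"
    by transfer (simp add: infsum_cmult_right ell2_summable_inner)
  show "0 \<le> x \<bullet> x" by transfer (simp add: infsum_nonneg)
  show "(x \<bullet> x = 0) = (x = 0)"
  proof (transfer, rule iffI)
    fix f :: "'a \<Rightarrow> complex"
    assume s: "(\<lambda>i. (cmod (f i))\<^sup>2) summable_on UNIV" and z: "(\<Sum>\<^sub>\<infinity>i. f i \<bullet> f i) = 0"
    have "f i \<bullet> f i = 0" for i
      using nonneg_infsum_le_0D[of "\<lambda>i. f i \<bullet> f i" UNIV i] z ell2_summable_inner[OF s s] by simp
    then show "f = (\<lambda>_. 0)" by auto
  qed simp
  show "norm x = sqrt (x \<bullet> x)" by (rule norm_ell2_def)
qed

end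

text \<open>Antilinear in the first argument, linear in the second.\<close>

lift_definition cinner :: "'i ell2 \<Rightarrow> 'i ell2 \<Rightarrow> complex" is "\<lambda>f g. \<Sum>\<^sub>\<infinity>i. cnj (f i) * g i" .

lift_definition scaleC :: "complex \<Rightarrow> 'i ell2 \<Rightarrow> 'i ell2" is "\<lambda>c f i. c * f i"
  by (rule ell2_summable_scale)

lift_definition restrict_ell2 :: "'i set \<Rightarrow> 'i ell2 \<Rightarrow> 'i ell2"
  is "\<lambda>S f i. if i \<in> S then f i else 0"
  by (erule summable_on_comparison_test) auto

lift_definition delta :: "'i \<Rightarrow> 'i ell2" is "\<lambda>x i. if i = x then 1 else 0"
  by (rule finite_nonzero_values_imp_summable_on) simp

lemma norm_ell2_le:
  assumes "\<And>i. cmod (coord f i) \<le> c * cmod (coord g i)" "0 \<le> c"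
  shows "norm f \<le> norm g * c"
proof -
  have sf: "(\<lambda>i. coord f i \<bullet> coord f i) summable_on UNIV"
   and sg: "(\<lambda>i. coord g i \<bullet> coord g i) summable_on UNIV"
    using coord[of f] coord[of g] by (auto intro: ell2_summable_inner)
  have "f \<bullet> f \<le> (\<Sum>\<^sub>\<infinity>i. c\<^sup>2 * (coord g i \<bullet> coord g i))"
    unfolding inner_ell2.rep_eq
  proof (rule infsum_mono[OF sf summable_on_cmult_right[OF sg]])
    show "coord f i \<bullet> coord f i \<le> c\<^sup>2 * (coord g i \<bullet> coord g i)" for i
      using power_mono[OF assms(1)[of i], of 2] by (simp add: power_mult_distrib dot_square_norm)
  qed
  also have "\<dots> = c\<^sup>2 * (g \<bullet> g)"
    unfolding inner_ell2.rep_eq using infsum_cmult_right[OF sg] by simp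
  finally have "(norm f)\<^sup>2 \<le> (norm g * c)\<^sup>2"
    by (simp add: power_mult_distrib dot_square_norm mult.commute)
  then show ?thesis using assms(2) by (meson mult_nonneg_nonneg norm_ge_zero power2_le_imp_le)
qed


section \<open>Bounded operators\<close>

text \<open>Bounded operators are elements of the library type of bounded real-linear maps, which carries
  the operator norm; every operator to which the notions below are applied is complex linear.\<close>

type_synonym 'i operator = "'i ell2 \<Rightarrow>\<^sub>L 'i ell2"

lift_definition scalar_op :: "complex \<Rightarrow> 'i operator" is scaleC
proof (rule bounded_linear_intro)
  fix c :: complex and f g :: "'i ell2" and r :: real
  show "scaleC c (f + g) = scaleC c f + scaleC c g" by transfer (simp add: distrib_left)
  show "scaleC c (r *\<^sub>R f) = r *\<^sub>R scaleC c f" by transfer simp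
  show "norm (scaleC c f) \<le> norm f * cmod c"
    by (rule norm_ell2_le) (simp_all add: scaleC.rep_eq norm_mult)
qed

lift_definition proj_op :: "'i set \<Rightarrow> 'i operator" is restrict_ell2
proof (rule bounded_linear_intro)
  fix S :: "'i set" and f g :: "'i ell2" and r :: real
  show "restrict_ell2 S (f + g) = restrict_ell2 S f + restrict_ell2 S g" by transfer auto
  show "restrict_ell2 S (r *\<^sub>R f) = r *\<^sub>R restrict_ell2 S f" by transfer auto
  show "norm (restrict_ell2 S f) \<le> norm f * 1"
    by (rule norm_ell2_le) (simp_all add: restrict_ell2.rep_eq)
qed

definition adjoint_op :: "'i operator \<Rightarrow> 'i operator" where
  "adjoint_op T = (THE S. \<forall>f g. cinner (blinfun_apply S f) g = cinner f (blinfun_apply T g))"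

definition op_power :: "'i operator \<Rightarrow> nat \<Rightarrow> 'i operator" where
  "op_power T k = ((\<lambda>S. T o\<^sub>L S) ^^ k) id_blinfun"

definition poly_op :: "complex poly \<Rightarrow> 'i operator \<Rightarrow> 'i operator" where
  "poly_op p T = (\<Sum>k\<le>degree p. scalar_op (coeff p k) o\<^sub>L op_power T k)"

definition spectrum :: "'i operator \<Rightarrow> complex set" where
  "spectrum T = {z. \<not> (\<exists>S. S o\<^sub>L (T - scalar_op z) = id_blinfun \<and> (T - scalar_op z) o\<^sub>L S = id_blinfun)}"

text \<open>Continuous functional calculus of a bounded self-adjoint operator \<open>T\<close>, whose spectrum is real:
  \<open>g(T)\<close> is the operator-norm limit of \<open>p\<^sub>n(T)\<close> for any polynomials \<open>p\<^sub>n\<close> converging to \<open>g\<close> uniformly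
  on the spectrum.\<close>

definition fun_calc :: "(real \<Rightarrow> complex) \<Rightarrow> 'i operator \<Rightarrow> 'i operator" where
  "fun_calc g T = (THE S. \<forall>p :: nat \<Rightarrow> complex poly.
     uniform_limit {x. complex_of_real x \<in> spectrum T} (\<lambda>n x. poly (p n) (complex_of_real x)) g sequentially
     \<longrightarrow> (\<lambda>n. poly_op (p n) T) \<longlonglongrightarrow> S)"

definition op_abs :: "'i operator \<Rightarrow> 'i operator" where
  "op_abs T = fun_calc (\<lambda>x. complex_of_real (sqrt x)) (adjoint_op T o\<^sub>L T)"

text \<open>The trace of the positive operator \<open>|T|\<close> does not depend on the orthonormal basis; the
  canonical one is used.\<close>

definition trace_class :: "'i operator \<Rightarrow> bool" where
  "trace_class T \<longleftrightarrow> (\<lambda>i. Re (cinner (delta i) (blinfun_apply (op_abs T) (delta i)))) summable_on UNIV"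

definition trace_norm :: "'i operator \<Rightarrow> real" where
  "trace_norm T = (\<Sum>\<^sub>\<infinity>i. Re (cinner (delta i) (blinfun_apply (op_abs T) (delta i))))"


section \<open>Function classes and Radon measures on the real line\<close>

definition smooth :: "(real \<Rightarrow> real) \<Rightarrow> bool" where
  "smooth h \<longleftrightarrow> (\<forall>k. (deriv ^^ k) h differentiable_on UNIV)"

definition exp_decaying :: "(real \<Rightarrow> real) \<Rightarrow> bool" where
  "exp_decaying h \<longleftrightarrow> (\<exists>C>0. \<exists>c>0. \<forall>x. \<bar>h x\<bar> \<le> C * exp (- c * \<bar>x\<bar>))"

definition Cc :: "(real \<Rightarrow> complex) set" where
  "Cc = {g. continuous_on UNIV g \<and> compact (closure {x. g x \<noteq> 0})}"

definition radon_measure :: "real measure \<Rightarrow> bool" where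
  "radon_measure \<mu> \<longleftrightarrow> sets \<mu> = sets borel \<and>
     (\<forall>K. compact K \<longrightarrow> emeasure \<mu> K < \<infinity>) \<and>
     (\<forall>B\<in>sets borel. emeasure \<mu> B = (SUP K\<in>{K. K \<subseteq> B \<and> compact K}. emeasure \<mu> K))"


section \<open>The incommensurate coupled chain\<close>

text \<open>The direct sum of two copies of \<open>\<ell>\<^sup>2(\<int>)\<close> is realised as \<open>\<ell>\<^sup>2\<close> of the disjoint union
  \<open>\<int> + \<int>\<close>: \<open>Inl n\<close> is site \<open>n\<close> of layer 1 and \<open>Inr n\<close> is site \<open>n\<close> of layer 2.\<close>

type_synonym chain = "(int + int) ell2"
type_synonym chain_op = "(int + int) operator"

definition H_op :: "real \<Rightarrow> (real \<Rightarrow> real) \<Rightarrow> real \<Rightarrow> chain_op" where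
  "H_op \<theta> h b = (THE T. \<forall>(\<psi> :: chain) (n :: int).
     coord (blinfun_apply T \<psi>) (Inl n) =
       - (coord \<psi> (Inl (n + 1)) - 2 * coord \<psi> (Inl n) + coord \<psi> (Inl (n - 1)))
       + (\<Sum>\<^sub>\<infinity>n'. complex_of_real (h (real_of_int n - (1 - \<theta>) * real_of_int n' - b)) * coord \<psi> (Inr n')) \<and>
     coord (blinfun_apply T \<psi>) (Inr n) =
       - (coord \<psi> (Inr (n + 1)) - 2 * coord \<psi> (Inr n) + coord \<psi> (Inr (n - 1)))
       + (\<Sum>\<^sub>\<infinity>n'. complex_of_real (h ((1 - \<theta>) * real_of_int n + b - real_of_int n')) * coord \<psi> (Inl n')))"

definition Lambda1 :: "real \<Rightarrow> int set" where
  "Lambda1 L = {n. - L \<le> real_of_int n \<and> real_of_int n \<le> L}"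

definition Lambda2 :: "real \<Rightarrow> real \<Rightarrow> real \<Rightarrow> int set" where
  "Lambda2 \<theta> b L = {n. (- L - b) / (1 - \<theta>) \<le> real_of_int n \<and> real_of_int n \<le> (L - b) / (1 - \<theta>)}"

definition card_Lambda :: "real \<Rightarrow> real \<Rightarrow> real \<Rightarrow> nat" where
  "card_Lambda \<theta> b L = card (Lambda1 L) + card (Lambda2 \<theta> b L)"

definition P_Lambda :: "real \<Rightarrow> real \<Rightarrow> real \<Rightarrow> chain_op" where
  "P_Lambda \<theta> b L = proj_op (Inl ` Lambda1 L \<union> Inr ` Lambda2 \<theta> b L)"

definition H_trunc :: "real \<Rightarrow> (real \<Rightarrow> real) \<Rightarrow> real \<Rightarrow> real \<Rightarrow> chain_op" where
  "H_trunc \<theta> h b L = P_Lambda \<theta> b L o\<^sub>L H_op \<theta> h b o\<^sub>L P_Lambda \<theta> b L"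

definition diag :: "chain_op \<Rightarrow> int + int \<Rightarrow> complex" where
  "diag T x = cinner (delta x) (blinfun_apply T (delta x))"

definition dos_average :: "real \<Rightarrow> (real \<Rightarrow> real) \<Rightarrow> real \<Rightarrow> real \<Rightarrow> (real \<Rightarrow> complex) \<Rightarrow> complex" where
  "dos_average \<theta> h b L g =
     1 / of_nat (card_Lambda \<theta> b L) *
       ((\<Sum>x\<in>Lambda1 L. diag (fun_calc g (H_trunc \<theta> h b L)) (Inl x)) +
        (\<Sum>x\<in>Lambda2 \<theta> b L. diag (fun_calc g (H_trunc \<theta> h b L)) (Inr x)))"

definition dos_limit :: "real \<Rightarrow> (real \<Rightarrow> real) \<Rightarrow> (real \<Rightarrow> complex) \<Rightarrow> complex" where
  "dos_limit \<theta> h g =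
     complex_of_real ((1 - \<theta>) / (1 + (1 - \<theta>))) *
       (LINT b2|uniform_measure lborel {0..<1 - \<theta>}. diag (fun_calc g (H_op \<theta> h b2)) (Inl 0)) +
     complex_of_real (1 / (1 + (1 - \<theta>))) *
       (LINT b1|uniform_measure lborel {0..<1}. diag (fun_calc g (H_op \<theta> h b1)) (Inr 0))"

definition dos_measure_trunc :: "real \<Rightarrow> (real \<Rightarrow> real) \<Rightarrow> real \<Rightarrow> real \<Rightarrow> real measure" where
  "dos_measure_trunc \<theta> h b L =
     (THE \<mu>. radon_measure \<mu> \<and> (\<forall>g\<in>Cc. (LINT x|\<mu>. g x) = dos_average \<theta> h b L g))"

definition dos_measure :: "real \<Rightarrow> (real \<Rightarrow> real) \<Rightarrow> real measure" where
  "dos_measure \<theta> h =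
     (THE \<mu>. radon_measure \<mu> \<and> (\<forall>g\<in>Cc. (LINT x|\<mu>. g x) = dos_limit \<theta> h g))"

end

theory Submission
  imports Defs "HOL-Computational_Algebra.Fundamental_Theorem_Algebra" "HOL-Probability.Probability"
    "HOL-Real_Asymp.Real_Asymp"
begin

text \<open>The kernel of \<open>H(b)\<close> decays exponentially in the distance between the positions \<open>n\<close> (layer 1)
  and \<open>(1 - \<theta>) n + b\<close> (layer 2), and \<open>\<Lambda>\<^sub>L\<close> consists of the sites with position in \<open>[-L, L]\<close>.
  Hence \<open>1\<^bsub>\<Lambda>\<^esub> H(b) (1 - 1\<^bsub>\<Lambda>\<^esub>)\<close> is small away from the two boundary points, and telescoping
  \<open>H\<^sub>L(b)\<^sup>k 1\<^bsub>\<Lambda>\<^esub> - 1\<^bsub>\<Lambda>\<^esub> H(b)\<^sup>k\<close> shows that replacing \<open>p(H\<^sub>L(b))\<close> by \<open>p(H(b))\<close> changes the sum of the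
  diagonal entries over \<open>\<Lambda>\<^sub>L\<close> only by \<open>O(1)\<close>, for every polynomial \<open>p\<close> and thus, up to \<open>o(|\<Lambda>\<^sub>L|)\<close>,
  for every continuous function. Shifting the two layers separately conjugates the operators \<open>H(b)\<close>
  into each other, so that the diagonal entries of \<open>g(H(b))\<close> are the values of a continuous periodic
  function along an irrational rotation and equidistribute for every \<open>b\<close>. The measures exist because
  the averages and their limit are states on \<open>C[-M, M]\<close>,
  where \<open>M\<close> bounds the norms of all \<open>H(b)\<close>.\<close>

section \<open>Square-summable families\<close>

text \<open>The functional calculus and the two measures are definite descriptions, so each needs an
  existence and a uniqueness proof before anything can be computed with it. For the calculus both
  rest on one inequality: the norm N of p(T) is at most |p(x)| for some real x in the spectrum.
  Instead of a spectral mapping theorem, the polynomial |p|^2 - N^2 is split into linear factors: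
  one of them must fail to be bounded below, and its root is a real spectral point where |p| = N.
  The limits rest on uniformity. The Schur bound of the kernels does not depend on b, so one
  polynomial approximates g for all operators H(b) and all their truncations; the leakage through
  the two boundary points is bounded uniformly in b and L; and the equidistribution estimate is
  uniform in the starting point, which moves with L. The limit functional then inherits linearity,
  normalization and boundedness from the averages.\<close>

lemma ell2_eqI: "(\<And>i. coord f i = coord g i) \<Longrightarrow> f = g"
  by (simp add: coord_inject[symmetric] fun_eq_iff)

lemma ell2_sq_summable: "(\<lambda>i. (cmod (coord f i))\<^sup>2) summable_on A"
  using coord[of f] by (auto intro: summable_on_subset)

lemma norm_ell2_sq: "(norm f)\<^sup>2 = (\<Sum>\<^sub>\<infinity>i. (cmod (coord f i))\<^sup>2)"
  by (simp add: power2_norm_eq_inner inner_ell2.rep_eq)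

lemma cmod_coord_le: "cmod (coord f i) \<le> norm f"
proof -
  have "(cmod (coord f i))\<^sup>2 = (\<Sum>j\<in>{i}. (cmod (coord f j))\<^sup>2)" by simp
  also have "\<dots> \<le> (norm f)\<^sup>2"
    unfolding norm_ell2_sq by (rule finite_sum_le_infsum) (auto simp: ell2_sq_summable)
  finally show ?thesis by (simp add: power2_le_iff_abs_le)
qed

lemma sum_sq_le_norm: "finite F \<Longrightarrow> (\<Sum>i\<in>F. (cmod (coord f i))\<^sup>2) \<le> (norm f)\<^sup>2"
  unfolding norm_ell2_sq by (rule finite_sum_le_infsum) (auto simp: ell2_sq_summable)

lemma sum_cmod_mult_le_norm:
  assumes "finite F"
  shows "(\<Sum>i\<in>F. cmod (coord f i) * cmod (coord g i)) \<le> norm f * norm g"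
proof -
  have "(\<Sum>i\<in>F. cmod (coord f i) * cmod (coord g i))
      \<le> L2_set (\<lambda>i. cmod (coord f i)) F * L2_set (\<lambda>i. cmod (coord g i)) F"
    using L2_set_mult_ineq[of "\<lambda>i. cmod (coord f i)" "\<lambda>i. cmod (coord g i)" F] by simp
  also have "\<dots> \<le> norm f * norm g"
    unfolding L2_set_def
    by (intro mult_mono real_le_lsqrt) (auto simp: sum_sq_le_norm[OF assms] sum_nonneg)
  finally show ?thesis .
qed

text \<open>The standard way below to produce an element of \<open>ell2\<close>: one estimate on
  finite sums yields both square summability and the norm bound.\<close>

lemma ell2_of_bounded_sums:
  assumes "\<And>F. finite F \<Longrightarrow> (\<Sum>i\<in>F. (cmod (f i))\<^sup>2) \<le> B\<^sup>2" "0 \<le> B"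
  shows "\<exists>g. coord g = f \<and> norm g \<le> B"
proof -
  have s: "(\<lambda>i. (cmod (f i))\<^sup>2) summable_on UNIV"
    by (rule nonneg_bdd_above_summable_on) (auto intro!: bdd_aboveI2 assms(1))
  then have c: "coord (Abs_ell2 f) = f" by (simp add: Abs_ell2_inverse)
  have "(norm (Abs_ell2 f))\<^sup>2 \<le> B\<^sup>2"
    unfolding norm_ell2_sq c by (rule infsum_le_finite_sums[OF s]) (auto intro: assms(1))
  then show ?thesis using c assms(2) by (meson power2_le_imp_le)
qed

lemma coord_add: "coord (f + g) i = coord f i + coord g i" by transfer simp
lemma coord_diff: "coord (f - g) i = coord f i - coord g i" by transfer simp
lemma coord_uminus: "coord (- f) i = - coord f i" by transfer simp
lemma coord_zero: "coord 0 i = 0" by transfer simp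
lemma coord_scaleR: "coord (r *\<^sub>R f) i = of_real r * coord f i"
  by transfer (simp add: scaleR_conv_of_real)
lemma coord_sum: "coord (\<Sum>x\<in>A. F x) i = (\<Sum>x\<in>A. coord (F x) i)"
  by (induct A rule: infinite_finite_induct) (auto simp: coord_add coord_zero)

lemmas coord_simps = coord_add coord_diff coord_uminus coord_zero coord_scaleR scaleC.rep_eq
  restrict_ell2.rep_eq delta.rep_eq

text \<open>Completeness passes on to the space of bounded operators, where Neumann series and the
  polynomials approximating g(T) have to converge.\<close>

instance ell2 :: (type) complete_space
proof
  fix X :: "nat \<Rightarrow> 'a ell2" assume X: "Cauchy X"
  have "Cauchy (\<lambda>n. coord (X n) i)" for i
  proof (rule CauchyI)
    fix e :: real assume "0 < e"
    then obtain N where N: "\<forall>m\<ge>N. \<forall>n\<ge>N. norm (X m - X n) < e"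
      using CauchyD[OF X] by blast
    have "norm (coord (X m) i - coord (X n) i) < e" if "m \<ge> N" "n \<ge> N" for m n
      using N that cmod_coord_le[of "X m - X n" i] by (force simp: coord_diff)
    then show "\<exists>N. \<forall>m\<ge>N. \<forall>n\<ge>N. norm (coord (X m) i - coord (X n) i) < e" by blast
  qed
  then obtain l where l: "\<And>i. (\<lambda>n. coord (X n) i) \<longlonglongrightarrow> l i"
    unfolding Cauchy_convergent_iff convergent_def by metis
  \<comment> \<open>The coordinatewise limit \<open>l\<close> is not yet known to be square
    summable. The difference of \<open>X m\<close> and \<open>l\<close> is handled instead: its
    finite square sums are limits of those of \<open>X m - X n\<close>. The limit vector is
    recovered as \<open>X N1 - g\<close>.\<close>
  have key: "\<exists>g. coord g = (\<lambda>i. coord (X m) i - l i) \<and> norm g \<le> e"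
    if e: "0 \<le> e" "\<And>n. n \<ge> N \<Longrightarrow> norm (X m - X n) \<le> e" for m N e
  proof (rule ell2_of_bounded_sums[OF _ e(1)])
    fix F :: "'a set" assume F: "finite F"
    show "(\<Sum>i\<in>F. (cmod (coord (X m) i - l i))\<^sup>2) \<le> e\<^sup>2"
    proof (rule tendsto_upperbound)
      show "(\<lambda>n. \<Sum>i\<in>F. (cmod (coord (X m) i - coord (X n) i))\<^sup>2)
          \<longlonglongrightarrow> (\<Sum>i\<in>F. (cmod (coord (X m) i - l i))\<^sup>2)"
        by (intro tendsto_intros l)
      show "\<forall>\<^sub>F n in sequentially. (\<Sum>i\<in>F. (cmod (coord (X m) i - coord (X n) i))\<^sup>2) \<le> e\<^sup>2"
        using eventually_ge_at_top[of N]
      proof eventually_elim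
        case (elim n)
        have "(\<Sum>i\<in>F. (cmod (coord (X m - X n) i))\<^sup>2) \<le> (norm (X m - X n))\<^sup>2"
          by (rule sum_sq_le_norm[OF F])
        also have "\<dots> \<le> e\<^sup>2" using e elim by (intro power_mono) auto
        finally show ?case by (simp add: coord_diff)
      qed
    qed simp
  qed
  obtain N1 where N1: "\<And>m n. m \<ge> N1 \<Longrightarrow> n \<ge> N1 \<Longrightarrow> norm (X m - X n) < 1"
    using CauchyD[OF X, of 1] by auto
  obtain g where g: "coord g = (\<lambda>i. coord (X N1) i - l i)"
    using key[of 1 N1 N1] N1 by (auto simp: less_imp_le)
  have cl: "coord (X N1 - g) i = l i" for i using g by (simp add: coord_diff)
  have "X \<longlonglongrightarrow> X N1 - g"
  proof (rule LIMSEQ_I)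
    fix r :: real assume r: "0 < r"
    then obtain N where N: "\<And>m n. m \<ge> N \<Longrightarrow> n \<ge> N \<Longrightarrow> norm (X m - X n) < r / 2"
      using CauchyD[OF X, of "r/2"] by auto
    have "norm (X m - (X N1 - g)) < r" if m: "m \<ge> N" for m
    proof -
      obtain k where k: "coord k = (\<lambda>i. coord (X m) i - l i)" "norm k \<le> r / 2"
        using key[of "r/2" N m] N[OF m] r by (meson less_imp_le half_gt_zero)
      have "X m - (X N1 - g) = k"
        by (rule ell2_eqI) (simp only: coord_diff cl[unfolded coord_diff] k)
      then show ?thesis using k r by simp
    qed
    then show "\<exists>no. \<forall>n\<ge>no. norm (X n - (X N1 - g)) < r" by blast
  qed
  then show "convergent X" by (auto simp: convergent_def)
qed

instance ell2 :: (type) banach ..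

section \<open>The sesquilinear inner product\<close>

lemma cinner_summable: "(\<lambda>i. cnj (coord f i) * coord g i) summable_on UNIV"
  by (rule abs_summable_summable)
     (use ell2_summable_cmod_mult[OF ell2_sq_summable[of f] ell2_sq_summable[of g]] in \<open>simp add: norm_mult\<close>)

lemma cinner_sums: "cinner f g = (\<Sum>\<^sub>\<infinity>i. cnj (coord f i) * coord g i)"
  by (rule cinner.rep_eq)

lemma cinner_add_right: "cinner f (g + h) = cinner f g + cinner f h"
  unfolding cinner_sums coord_simps distrib_left by (rule infsum_add; rule cinner_summable)

lemma cinner_scale_right: "cinner f (scaleC c g) = c * cinner f g"
proof -
  have "(\<Sum>\<^sub>\<infinity>i. c * (cnj (coord f i) * coord g i)) = c * cinner f g"
    unfolding cinner_sums by (rule infsum_cmult_right) (simp add: cinner_summable)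
  then show ?thesis by (simp add: cinner_sums coord_simps mult.left_commute)
qed

lemma cinner_commute: "cinner g f = cnj (cinner f g)"
  by (simp add: cinner_sums flip: infsum_cnj) (simp add: mult.commute)

lemma scaleC_minus_one: "scaleC (-1) f = - f" by (rule ell2_eqI) (simp add: coord_simps)

lemma cinner_diff_right: "cinner f (g - h) = cinner f g - cinner f h"
  using cinner_add_right[of f g "- h"] cinner_scale_right[of f "-1" h] by (simp add: scaleC_minus_one)

lemma cinner_diff_left: "cinner (g - h) f = cinner g f - cinner h f"
  by (subst (1 2 3) cinner_commute) (simp add: cinner_diff_right)

lemma cinner_add_left: "cinner (g + h) f = cinner g f + cinner h f"
  by (subst (1 2 3) cinner_commute) (simp add: cinner_add_right)

lemma cinner_scale_left: "cinner (scaleC c g) f = cnj c * cinner g f"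
  by (subst (1 2) cinner_commute) (simp add: cinner_scale_right)

lemma cinner_self: "cinner f f = complex_of_real ((norm f)\<^sup>2)"
proof -
  have "cinner f f = (\<Sum>\<^sub>\<infinity>i. complex_of_real ((cmod (coord f i))\<^sup>2))"
    unfolding cinner_sums by (simp only: complex_norm_square mult.commute)
  also have "\<dots> = complex_of_real (\<Sum>\<^sub>\<infinity>i. (cmod (coord f i))\<^sup>2)"
    by (rule infsumI[OF has_sum_of_real[OF has_sum_infsum[OF ell2_sq_summable]]])
  finally show ?thesis unfolding norm_ell2_sq .
qed

lemma Re_cinner: "Re (cinner f g) = f \<bullet> g"
proof -
  have "f \<bullet> g = (\<Sum>\<^sub>\<infinity>i. Re (cnj (coord f i) * coord g i))"
    by (simp add: inner_ell2.rep_eq inner_complex_def)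
  then show ?thesis
    by (simp only: cinner_sums infsum_Re[OF cinner_summable])
qed

lemma norm_scaleC: "norm (scaleC c f) = cmod c * norm f"
proof -
  have "complex_of_real ((norm (scaleC c f))\<^sup>2) = c * cnj c * cinner f f"
    by (simp only: cinner_self[symmetric] cinner_scale_left cinner_scale_right mult_ac)
  also have "\<dots> = complex_of_real ((cmod c * norm f)\<^sup>2)"
    by (simp only: complex_norm_square[symmetric] cinner_self of_real_mult[symmetric] power_mult_distrib)
  finally have "(norm (scaleC c f))\<^sup>2 = (cmod c * norm f)\<^sup>2" by (simp only: of_real_eq_iff)
  then show ?thesis by (simp add: power2_eq_iff_nonneg)
qed

lemma cmod_cinner_le: "cmod (cinner f g) \<le> norm f * norm g"
proof (cases "cinner f g = 0")
  case False
  \<comment> \<open>Multiplication of \<open>g\<close> by this unit scalar makes the inner product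
    real and nonnegative, so that it equals the real inner product and the real Cauchy-Schwarz
    inequality applies.\<close>
  define c where "c = cnj (cinner f g) / cmod (cinner f g)"
  have c1: "cmod c = 1" using False by (simp add: c_def norm_divide)
  have "cinner f (scaleC c g) = cmod (cinner f g)"
    using False complex_norm_square[of "cinner f g"] unfolding cinner_scale_right c_def
    by (simp add: power2_eq_square field_simps)
  then have "cmod (cinner f g) = f \<bullet> scaleC c g" by (metis Re_cinner Re_complex_of_real)
  also have "\<dots> \<le> norm f * norm (scaleC c g)" by (rule norm_cauchy_schwarz)
  finally show ?thesis by (simp add: norm_scaleC c1)
qed simp

lemma cinner_delta: "cinner (delta x) f = coord f x"
proof -
  have "cinner (delta x) f = (\<Sum>\<^sub>\<infinity>i\<in>{x}. cnj (coord (delta x) i) * coord f i)"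
    unfolding cinner_sums by (rule infsum_cong_neutral) (auto simp: coord_simps)
  then show ?thesis by (simp add: coord_simps)
qed

lemma norm_delta: "norm (delta x) = 1"
proof -
  have "complex_of_real ((norm (delta x))\<^sup>2) = 1"
    by (simp only: cinner_self[symmetric] cinner_delta) (simp add: coord_simps)
  then have "(norm (delta x))\<^sup>2 = 1" by (simp only: of_real_eq_1_iff)
  then show ?thesis using norm_ge_zero[of "delta x"] by (auto simp: power2_eq_1_iff simp del: norm_ge_zero)
qed

section \<open>Polynomials of a self-adjoint operator\<close>

lemma scaleC_add: "scaleC c (f + g) = scaleC c f + scaleC c g"
  by (rule ell2_eqI) (simp add: coord_simps distrib_left)
lemma scaleC_diff: "scaleC c (f - g) = scaleC c f - scaleC c g"
  by (rule ell2_eqI) (simp add: coord_simps right_diff_distrib)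
lemma scaleC_scaleC: "scaleC c (scaleC d f) = scaleC (c * d) f"
  by (rule ell2_eqI) (simp add: coord_simps)
lemma scaleC_add_left: "scaleC (c + d) f = scaleC c f + scaleC d f"
  by (rule ell2_eqI) (simp add: coord_simps distrib_right)
lemma scaleC_zero [simp]: "scaleC c 0 = 0" "scaleC 0 f = 0"
  by (rule ell2_eqI; simp add: coord_simps)+
lemma scaleC_one [simp]: "scaleC 1 f = f"
  by (rule ell2_eqI) (simp add: coord_simps)
lemma scaleC_sum: "scaleC c (\<Sum>x\<in>A. F x) = (\<Sum>x\<in>A. scaleC c (F x))"
  by (induct A rule: infinite_finite_induct) (auto simp: scaleC_add)

text \<open>Elements of \<open>operator\<close> are only real linear, so complex linearity is
  carried as a separate property.\<close>

definition clinear_op :: "'i operator \<Rightarrow> bool" where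
  "clinear_op T \<longleftrightarrow> (\<forall>c f. T (scaleC c f) = scaleC c (T f))"

definition selfadj :: "'i operator \<Rightarrow> bool" where
  "selfadj T \<longleftrightarrow> (\<forall>f g. cinner (T f) g = cinner f (T g))"

lemma cinner_eqI: "(\<And>g. cinner f g = cinner f' g) \<Longrightarrow> f = f'"
  by (metis cinner_commute cinner_delta ell2_eqI)

text \<open>Symmetry with respect to the sesquilinear form forces complex linearity, because a
  scalar can be moved through both sides of the form.\<close>

lemma selfadj_clinear: "selfadj T \<Longrightarrow> clinear_op T"
  unfolding clinear_op_def
  by (intro allI cinner_eqI) (simp add: selfadj_def cinner_scale_left)

lemma op_power_apply: "op_power T k f = (blinfun_apply T ^^ k) f"
  unfolding op_power_def by (induct k) (auto simp: id_blinfun.rep_eq)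

lemma op_power_0 [simp]: "op_power T 0 = id_blinfun" by (simp add: op_power_def)
lemma op_power_Suc: "op_power T (Suc k) = T o\<^sub>L op_power T k" by (simp add: op_power_def)
lemma op_power_Suc_apply: "op_power T (Suc k) f = T (op_power T k f)"
  by (simp add: op_power_apply)
lemma op_power_Suc2_apply: "op_power T (Suc k) f = op_power T k (T f)"
  by (simp add: op_power_apply funpow_swap1)

lemma norm_id_blinfun_ell2: "norm (id_blinfun :: 'i operator) \<le> 1"
  by (rule norm_blinfun_bound) (auto simp: id_blinfun.rep_eq)

lemma norm_op_power: "norm T \<le> M \<Longrightarrow> norm (op_power T k) \<le> M ^ k"
proof (induct k)
  case 0 show ?case by (simp add: norm_id_blinfun_ell2)
next
  case (Suc k)
  have "norm (op_power T (Suc k)) \<le> norm T * norm (op_power T k)"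
    unfolding op_power_Suc by (rule norm_blinfun_compose)
  also have "\<dots> \<le> M * M ^ k" using Suc by (intro mult_mono) (auto intro: order_trans[OF norm_ge_zero])
  finally show ?case by simp
qed

lemma selfadj_op_power: "selfadj T \<Longrightarrow> selfadj (op_power T k)"
proof (induct k)
  case 0 then show ?case by (simp add: selfadj_def id_blinfun.rep_eq)
next
  case (Suc k)
  show ?case unfolding selfadj_def
  proof (intro allI)
    fix f g
    have "cinner (op_power T (Suc k) f) g = cinner (op_power T k f) (T g)"
      using Suc(2) by (simp add: op_power_Suc_apply selfadj_def)
    also have "\<dots> = cinner f (op_power T (Suc k) g)"
      using Suc by (simp add: op_power_Suc2_apply selfadj_def)
    finally show "cinner (op_power T (Suc k) f) g = cinner f (op_power T (Suc k) g)" .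
  qed
qed

lemma poly_op_apply_le:
  assumes "degree p \<le> n"
  shows "poly_op p T f = (\<Sum>k\<le>n. scaleC (coeff p k) (op_power T k f))"
proof -
  have "poly_op p T f = (\<Sum>k\<le>degree p. scaleC (coeff p k) (op_power T k f))"
    by (simp add: poly_op_def blinfun.sum_left scalar_op.rep_eq)
  also have "\<dots> = (\<Sum>k\<le>n. scaleC (coeff p k) (op_power T k f))"
    by (rule sum.mono_neutral_left) (use assms in \<open>auto simp: coeff_eq_0\<close>)
  finally show ?thesis .
qed

lemma poly_op_pCons_apply:
  assumes "clinear_op T"
  shows "poly_op (pCons a p) T f = scaleC a f + T (poly_op p T f)"
proof -
  have "poly_op (pCons a p) T f = (\<Sum>k\<le>Suc (degree p). scaleC (coeff (pCons a p) k) (op_power T k f))"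
    by (rule poly_op_apply_le) (rule degree_pCons_le)
  also have "\<dots> = scaleC a f + (\<Sum>k\<le>degree p. scaleC (coeff p k) (op_power T (Suc k) f))"
    by (subst sum.atMost_Suc_shift) (simp add: id_blinfun.rep_eq)
  also have "(\<Sum>k\<le>degree p. scaleC (coeff p k) (op_power T (Suc k) f)) = T (poly_op p T f)"
    using assms by (simp add: poly_op_apply_le[OF order_refl] blinfun.sum_right op_power_Suc_apply clinear_op_def)
  finally show ?thesis .
qed

lemma poly_op_0_apply [simp]: "poly_op 0 T f = 0"
  by (subst poly_op_apply_le[of _ 0]) auto

lemma poly_op_const_apply [simp]: "poly_op [:c:] T f = scaleC c f"
  by (subst poly_op_apply_le[of _ 0]) (auto simp: id_blinfun.rep_eq)

lemma poly_op_add_apply: "poly_op (p + q) T f = poly_op p T f + poly_op q T f"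
proof -
  let ?n = "max (degree p) (degree q)"
  have "degree (p + q) \<le> ?n" by (rule degree_add_le_max)
  then show ?thesis
    by (simp add: poly_op_apply_le[of _ ?n] scaleC_add_left sum.distrib)
qed

lemma poly_op_smult_apply: "poly_op (smult c p) T f = scaleC c (poly_op p T f)"
  by (simp add: poly_op_apply_le[OF degree_smult_le] poly_op_apply_le[OF order_refl]
      scaleC_sum scaleC_scaleC)

lemma poly_op_diff_apply: "poly_op (p - q) T f = poly_op p T f - poly_op q T f"
  using poly_op_add_apply[of p "smult (-1) q" T f] poly_op_smult_apply[of "-1" q T f]
  by (simp add: scaleC_minus_one)

lemma poly_op_diff: "poly_op (p - q) T = poly_op p T - poly_op q T"
  by (rule blinfun_eqI) (simp add: poly_op_diff_apply blinfun.diff_left)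

lemma poly_op_mult_apply:
  assumes "clinear_op T"
  shows "poly_op (p * q) T f = poly_op p T (poly_op q T f)"
  using assms
  by (induct p) (auto simp: mult_pCons_left poly_op_pCons_apply poly_op_add_apply poly_op_smult_apply)

lemma poly_op_commute:
  assumes "clinear_op T" shows "poly_op p T (T f) = T (poly_op p T f)"
  using assms by (induct p) (auto simp: poly_op_pCons_apply clinear_op_def blinfun.add_right)

lemma poly_op_adjoint:
  assumes "selfadj T"
  shows "cinner (poly_op p T f) g = cinner f (poly_op (map_poly cnj p) T g)"
proof (induct p arbitrary: f g)
  case (pCons a p)
  have "cinner (T (poly_op p T f)) g = cinner f (T (poly_op (map_poly cnj p) T g))"
    using assms pCons(2)[of f "T g"] poly_op_commute[OF selfadj_clinear[OF assms]]
    by (simp add: selfadj_def)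
  then show ?case using pCons(1)
    by (simp add: poly_op_pCons_apply[OF selfadj_clinear[OF assms]] map_poly_pCons
       cinner_add_left cinner_add_right cinner_scale_left cinner_scale_right)
qed (simp add: cinner_sums coord_zero)

section \<open>The norm of p(T) and the values of p on the spectrum\<close>

definition bounded_below :: "'i operator \<Rightarrow> bool" where
  "bounded_below A \<longleftrightarrow> (\<exists>c>0. \<forall>f. c * norm f \<le> norm (A f))"

text \<open>Induction on the degree: the fundamental theorem of algebra splits off a root, and the
  lower bounds of composed operators multiply. Read contrapositively, a nonzero polynomial in T that
  is not bounded below has a root z for which T - z is not bounded below, and such a z lies in the
  spectrum.\<close>

lemma bounded_below_poly_op:
  assumes T: "clinear_op T" and r: "r \<noteq> 0"
    and b: "\<And>z. poly r z = 0 \<Longrightarrow> bounded_below (T - scalar_op z)"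
  shows "bounded_below (poly_op r T)"
  using r b
proof (induct "degree r" arbitrary: r)
  case 0
  then obtain c where c: "r = [:c:]" by (metis degree_eq_zeroE)
  then have "cmod c > 0" using 0 by auto
  then show ?case by (auto simp: bounded_below_def c norm_scaleC intro!: exI[of _ "cmod c"])
next
  case (Suc n)
  then have "\<not> constant (poly r)" by (simp add: constant_degree)
  then obtain z where z: "poly r z = 0" using fundamental_theorem_of_algebra by blast
  then obtain s where s: "r = [:-z, 1:] * s" by (auto simp: poly_eq_0_iff_dvd elim: dvdE)
  have s0: "s \<noteq> 0" using Suc s by auto
  have "degree r = Suc (degree s)" unfolding s by (subst degree_mult_eq) (use s0 in auto)
  then have "bounded_below (poly_op s T)"
    using Suc(1)[of s] Suc(2) s0 Suc(4) by (simp add: s)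
  then obtain c where c: "c > 0" "\<And>f. c * norm f \<le> norm (poly_op s T f)"
    by (auto simp: bounded_below_def)
  obtain d where d: "d > 0" "\<And>f. d * norm f \<le> norm ((T - scalar_op z) f)"
    using Suc(4)[OF z] by (auto simp: bounded_below_def)
  have e: "poly_op r T f = (T - scalar_op z) (poly_op s T f)" for f
    unfolding s poly_op_mult_apply[OF T]
    by (simp add: poly_op_pCons_apply[OF T] blinfun.diff_left scalar_op.rep_eq)
       (rule ell2_eqI, simp add: coord_simps)
  have "d * c * norm f \<le> norm (poly_op r T f)" for f
  proof -
    have "d * (c * norm f) \<le> d * norm (poly_op s T f)" using c d by simp
    also have "\<dots> \<le> norm (poly_op r T f)" unfolding e by (rule d)
    finally show ?thesis by (simp add: mult.assoc)
  qed
  then show ?case unfolding bounded_below_def using c(1) d(1) by (intro exI[of _ "d * c"]) auto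
qed

lemma bounded_below_not_spectrum:
  assumes "z \<notin> spectrum T" shows "bounded_below (T - scalar_op z)"
proof -
  obtain S where S: "S o\<^sub>L (T - scalar_op z) = id_blinfun"
    using assms by (auto simp: spectrum_def)
  have "norm f / (norm S + 1) \<le> norm ((T - scalar_op z) f)" for f
  proof -
    have "norm f = norm (S ((T - scalar_op z) f))"
      using arg_cong[OF S, of "\<lambda>A. blinfun_apply A f"] by (simp add: id_blinfun.rep_eq)
    also have "\<dots> \<le> norm S * norm ((T - scalar_op z) f)" by (rule norm_blinfun)
    also have "\<dots> \<le> (norm S + 1) * norm ((T - scalar_op z) f)" by (simp add: mult_right_mono)
    finally show ?thesis using norm_ge_zero[of S] by (simp add: field_simps add_pos_nonneg)
  qed
  then show ?thesis unfolding bounded_below_def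
    by (intro exI[of _ "1 / (norm S + 1)"]) (auto simp: add_nonneg_pos)
qed

text \<open>Since \<open>cinner f (T f)\<close> is real, the imaginary part of the form of T - z at
  f is - Im z times the squared norm of f, and Cauchy-Schwarz turns this into a lower bound.\<close>

lemma bounded_below_nonreal:
  assumes T: "selfadj T" and z: "Im z \<noteq> 0" shows "bounded_below (T - scalar_op z)"
proof -
  have "\<bar>Im z\<bar> * norm f \<le> norm ((T - scalar_op z) f)" for f
  proof (cases "f = 0")
    case False
    have "cinner f (T f) = cnj (cinner f (T f))"
      using T cinner_commute[of "T f" f] by (simp add: selfadj_def)
    then have "Im (cinner f (T f)) = 0" by (metis cnj.sel(2) equation_minus_iff neg_equal_zero)
    then have "Im (cinner f ((T - scalar_op z) f)) = - Im z * (norm f)\<^sup>2"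
      by (simp add: blinfun.diff_left scalar_op.rep_eq cinner_diff_right cinner_scale_right cinner_self
          del: of_real_power)
    then have "\<bar>Im z\<bar> * (norm f)\<^sup>2 \<le> norm f * norm ((T - scalar_op z) f)"
      using abs_Im_le_cmod[of "cinner f ((T - scalar_op z) f)"] cmod_cinner_le[of f "(T - scalar_op z) f"]
      by (simp add: abs_mult)
    then show ?thesis using False by (simp add: power2_eq_square field_simps)
  qed (simp add: blinfun.zero_right)
  then show ?thesis unfolding bounded_below_def using z by (intro exI[of _ "\<bar>Im z\<bar>"]) auto
qed

lemma norm_blinfun_attained:
  fixes B :: "'i operator"
  assumes "a < norm B" "0 \<le> a"
  shows "\<exists>f. a * norm f < norm (B f)"
proof (rule ccontr)
  assume "\<not> ?thesis"
  then have "norm B \<le> a" using assms(2) by (intro norm_blinfun_bound) (auto simp: not_less)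
  with assms show False by simp
qed

text \<open>With \<open>B = p(T)\<close> and \<open>N = \<parallel>B\<parallel>\<close>, the operator \<open>B\<^sup>* B - N\<^sup>2\<close> is not bounded below on almost
  maximising vectors of \<open>B\<close>.\<close>

lemma not_bounded_below_norm:
  fixes T :: "'i operator" and p :: "complex poly"
  assumes T: "selfadj T"
  defines "N \<equiv> norm (poly_op p T)" and "q \<equiv> map_poly cnj p * p"
  shows "\<not> bounded_below (poly_op (q - [:complex_of_real (N\<^sup>2):]) T)"
proof
  let ?B = "poly_op p T" and ?C = "poly_op (map_poly cnj p) T"
  assume "bounded_below (poly_op (q - [:complex_of_real (N\<^sup>2):]) T)"
  then obtain c where c: "c > 0" "\<And>f. c * norm f \<le> norm (poly_op (q - [:complex_of_real (N\<^sup>2):]) T f)"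
    by (auto simp: bounded_below_def)
  have N0: "N \<ge> 0" by (simp add: N_def)
  have adj: "cinner (?B f) g = cinner f (?C g)" for f g by (rule poly_op_adjoint[OF T])
  \<comment> \<open>The adjoint of B has norm at most N, by the usual estimate of the squared norm
    of the adjoint applied to g through the norm of B.\<close>
  have C: "norm (?C g) \<le> N * norm g" for g
  proof (cases "?C g = 0")
    case False
    have "(norm (?C g))\<^sup>2 = cmod (cinner (?C g) (?C g))" by (simp add: cinner_self norm_power)
    also have "\<dots> = cmod (cinner (?B (?C g)) g)" by (simp add: adj)
    also have "\<dots> \<le> norm (?B (?C g)) * norm g" by (rule cmod_cinner_le)
    also have "\<dots> \<le> N * norm (?C g) * norm g"
      unfolding N_def by (intro mult_right_mono norm_blinfun) auto
    finally show ?thesis using False by (simp add: power2_eq_square field_simps)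
  qed (simp add: N0)
  have eq: "poly_op (q - [:complex_of_real (N\<^sup>2):]) T f = ?C (?B f) - N\<^sup>2 *\<^sub>R f" for f
    unfolding q_def poly_op_diff_apply poly_op_mult_apply[OF selfadj_clinear[OF T]]
    by (simp, rule ell2_eqI, simp add: coord_simps)
  \<comment> \<open>Expand the square, using that the form of \<open>?C (?B f)\<close> at f is the
    squared norm of \<open>?B f\<close> and that \<open>?C\<close> has norm at most N. What remains
    is N^2 times the defect by which f fails to maximise B.\<close>
  have key: "(c * norm f)\<^sup>2 \<le> N\<^sup>2 * (N\<^sup>2 * (norm f)\<^sup>2 - (norm (?B f))\<^sup>2)" for f
  proof -
    have "(c * norm f)\<^sup>2 \<le> (norm (?C (?B f) - N\<^sup>2 *\<^sub>R f))\<^sup>2"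
      using c(2)[of f] c(1) unfolding eq by (intro power_mono) auto
    also have "\<dots> = (norm (?C (?B f)))\<^sup>2 - 2 * N\<^sup>2 * (f \<bullet> ?C (?B f)) + N\<^sup>2 * N\<^sup>2 * (norm f)\<^sup>2"
      by (simp only: power2_norm_eq_inner inner_diff_left inner_diff_right inner_scaleR_left inner_scaleR_right)
         (simp add: inner_commute algebra_simps)
    also have "f \<bullet> ?C (?B f) = (norm (?B f))\<^sup>2"
      by (simp add: Re_cinner[symmetric] adj[symmetric] cinner_self del: of_real_power)
    also have "(norm (?C (?B f)))\<^sup>2 \<le> (N * norm (?B f))\<^sup>2" by (intro power_mono C) auto
    finally show ?thesis by (simp add: algebra_simps power2_eq_square)
  qed
  show False
  proof (cases "N = 0")
    case True
    have "c * norm (delta undefined :: 'i ell2) \<le> 0" using key[of "delta undefined"] True c(1)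
      by simp
    then show False using c(1) by (simp add: norm_delta)
  next
    case False
    \<comment> \<open>Chosen below N with \<open>a\<^sup>2\<close> at least N^2 - c^2/N^2. A vector
      that B stretches by more than \<open>a\<close> has a defect smaller than c^2/N^2 times its
      squared norm, which contradicts \<open>key\<close>. The maximum with 0 only keeps the square
      root meaningful.\<close>
    define a where "a = sqrt (max 0 (N\<^sup>2 - c\<^sup>2 / N\<^sup>2))"
    have Np: "N > 0" using False N0 by simp
    have "N\<^sup>2 - c\<^sup>2 / N\<^sup>2 < N\<^sup>2" using c(1) Np by simp
    then have "a < N" unfolding a_def using Np by (intro real_less_lsqrt) auto
    then obtain f where f: "a * norm f < norm (?B f)"
      using norm_blinfun_attained[of a ?B] by (auto simp: N_def a_def)
    have a2: "a\<^sup>2 \<ge> N\<^sup>2 - c\<^sup>2 / N\<^sup>2" by (simp add: a_def)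
    have "a\<^sup>2 * (norm f)\<^sup>2 < (norm (?B f))\<^sup>2"
      using f by (metis a_def norm_ge_zero power_mult_distrib power_strict_mono max.cobounded1 mult_nonneg_nonneg real_sqrt_ge_zero zero_less_numeral)
    moreover have "(N\<^sup>2 - c\<^sup>2 / N\<^sup>2) * (norm f)\<^sup>2 \<le> a\<^sup>2 * (norm f)\<^sup>2"
      by (intro mult_right_mono a2) auto
    ultimately have "N\<^sup>2 * (N\<^sup>2 * (norm f)\<^sup>2 - (norm (?B f))\<^sup>2) < N\<^sup>2 * (c\<^sup>2 / N\<^sup>2 * (norm f)\<^sup>2)"
      using Np by (intro mult_strict_left_mono) (auto simp: algebra_simps)
    with key[of f] show False using Np by (simp add: power_mult_distrib)
  qed
qed

lemma poly_map_cnj_real: "poly (map_poly cnj p) (complex_of_real x) = cnj (poly p (complex_of_real x))"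
  by (induct p) (auto simp: map_poly_pCons)

text \<open>With r the polynomial |p|^2 - N^2, r(T) is not bounded below, so some root z of r is a
  spectral point. It must be real, and there r(z) = 0 says |p(z)| = N. Positive degree ensures that
  r is not the zero polynomial.\<close>

lemma spectrum_attains_norm_nonconst:
  assumes T: "selfadj T" and d: "degree p > 0"
  shows "\<exists>x. complex_of_real x \<in> spectrum T \<and> norm (poly_op p T) = cmod (poly p (complex_of_real x))"
proof -
  define N where "N = norm (poly_op p T)"
  define r where "r = map_poly cnj p * p - [:complex_of_real (N\<^sup>2):]"
  have dq: "degree (map_poly cnj p * p) > 0"
    using d by (subst degree_mult_eq) (auto simp: degree_map_poly map_poly_eq_0_iff)
  have "r \<noteq> 0"
  proof
    assume "r = 0"
    then have "map_poly cnj p * p = [:complex_of_real (N\<^sup>2):]" by (simp add: r_def)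
    then show False using dq by simp
  qed
  then obtain z where z: "poly r z = 0" "\<not> bounded_below (T - scalar_op z)"
    using bounded_below_poly_op[OF selfadj_clinear[OF T], of r] not_bounded_below_norm[OF T, of p]
    unfolding r_def N_def by blast
  have sp: "z \<in> spectrum T" using z bounded_below_not_spectrum by blast
  obtain x where x: "z = complex_of_real x"
    using bounded_below_nonreal[OF T, of z] z by (metis complex_eq_iff Re_complex_of_real Im_complex_of_real)
  have "cnj (poly p z) * poly p z = complex_of_real (N\<^sup>2)"
    using z(1) by (simp add: r_def x poly_map_cnj_real)
  then have "complex_of_real ((cmod (poly p z))\<^sup>2) = complex_of_real (N\<^sup>2)"
    by (metis complex_norm_square mult.commute)
  then have "(cmod (poly p z))\<^sup>2 = N\<^sup>2" by (simp only: of_real_eq_iff)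
  then have "cmod (poly p z) = N" by (simp add: N_def power2_eq_iff_nonneg)
  then show ?thesis using sp x N_def by auto
qed

lemma norm_poly_op_le_spectrum:
  assumes T: "selfadj T"
  shows "\<exists>x. complex_of_real x \<in> spectrum T \<and> norm (poly_op p T) \<le> cmod (poly p (complex_of_real x))"
proof (cases "degree p = 0")
  case True
  then obtain c where c: "p = [:c:]" by (metis degree_eq_zeroE)
  have "norm (poly_op p T) \<le> cmod c"
    by (rule norm_blinfun_bound) (auto simp: c norm_scaleC)
  \<comment> \<open>For constant p it only remains to see that the real spectrum is nonempty, which
    is the nonconstant case for the polynomial X.\<close>
  moreover obtain x where "complex_of_real x \<in> spectrum T"
    using spectrum_attains_norm_nonconst[OF T, of "[:0, 1:]"] by auto
  ultimately show ?thesis by (auto simp: c)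
next
  case False
  then show ?thesis using spectrum_attains_norm_nonconst[OF T, of p] by auto
qed

section \<open>The continuous functional calculus\<close>

text \<open>Neumann series: for |z| larger than the norm of T, the series S of the operators
  z^(-k-1) T^k converges in norm, and applying T - z makes it telescope to minus the identity. Hence
  -S is a two-sided inverse.\<close>

lemma spectrum_le_norm:
  fixes T :: "'i operator"
  assumes T: "clinear_op T" and z: "z \<in> spectrum T" shows "cmod z \<le> norm T"
proof (rule ccontr)
  assume "\<not> ?thesis"
  then have lt: "norm T < cmod z" by simp
  then have z0: "z \<noteq> 0" by auto
  define A where "A k = scalar_op (inverse z ^ Suc k) o\<^sub>L op_power T k" for k
  have A_apply: "A k f = scaleC (inverse z ^ Suc k) (op_power T k f)" for k f
    by (simp add: A_def scalar_op.rep_eq)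
  have scT: "op_power T k (scaleC c f) = scaleC c (op_power T k f)" for k c f
    using T by (induct k) (auto simp: op_power_Suc_apply clinear_op_def id_blinfun.rep_eq)
  define r where "r = norm T / cmod z"
  have r: "0 \<le> r" "r < 1" using lt z0 by (auto simp: r_def)
  have nA: "norm (A k) \<le> inverse (cmod z) * r ^ k" for k
  proof (rule norm_blinfun_bound)
    show "norm (A k f) \<le> inverse (cmod z) * r ^ k * norm f" for f
    proof -
      have "norm (op_power T k f) \<le> norm T ^ k * norm f"
        using norm_blinfun[of "op_power T k" f] norm_op_power[OF order_refl, of T k]
        by (meson mult_right_mono norm_ge_zero order_trans)
      then have "inverse (cmod z) ^ Suc k * norm (op_power T k f)
          \<le> inverse (cmod z) ^ Suc k * (norm T ^ k * norm f)"
        by (intro mult_left_mono) auto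
      also have "\<dots> = inverse (cmod z) * r ^ k * norm f"
        by (simp add: r_def power_divide divide_inverse power_inverse power_mult_distrib)
      finally show ?thesis
        by (simp add: A_apply norm_scaleC norm_power norm_inverse norm_mult)
    qed
  qed (use r in auto)
  have "summable A"
  proof (rule summable_norm_cancel, rule summable_comparison_test')
    show "summable (\<lambda>k. inverse (cmod z) * r ^ k)"
      using r by (intro summable_mult summable_geometric) auto
    show "\<And>k. k \<ge> 0 \<Longrightarrow> norm (norm (A k)) \<le> inverse (cmod z) * r ^ k" using nA by simp
  qed
  then obtain S where S: "A sums S" by (auto simp: summable_def)
  have Sf: "(\<lambda>k. A k f) sums S f" for f
    using bounded_linear.sums[OF blinfun.bounded_linear_left S] .
  have zA: "scaleC z (A k f) = scaleC (inverse z ^ k) (op_power T k f)" for k f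
    using z0 by (simp add: A_apply scaleC_scaleC mult.assoc[symmetric])
  have step: "T (A k f) - scaleC z (A k f)
      = scaleC (inverse z ^ Suc k) (op_power T (Suc k) f) - scaleC (inverse z ^ k) (op_power T k f)"
    for k f
    using T unfolding zA by (simp add: A_apply clinear_op_def op_power_Suc_apply)
  have lim: "(\<lambda>k. scaleC (inverse z ^ k) (op_power T k f)) \<longlonglongrightarrow> 0" for f
  proof -
    have "(\<lambda>k. scaleC z (A k f)) \<longlonglongrightarrow> scaleC z 0"
      using bounded_linear.tendsto[OF blinfun.bounded_linear_right summable_LIMSEQ_zero[OF sums_summable[OF Sf[of f]]], of "scalar_op z"]
      by (simp add: scalar_op.rep_eq)
    then show ?thesis by (simp add: zA)
  qed
  have tel: "(\<lambda>k. T (A k f) - scaleC z (A k f)) sums (0 - f)" for f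
    unfolding step
    using telescope_sums[OF lim[of f]] by (simp add: id_blinfun.rep_eq)
  have R: "(T - scalar_op z) (S f) = - f" for f
  proof -
    have "(\<lambda>k. (T - scalar_op z) (A k f)) sums (T - scalar_op z) (S f)"
      by (rule bounded_linear.sums[OF blinfun.bounded_linear_right Sf])
    then show ?thesis using tel[of f] sums_unique2
      by (fastforce simp: blinfun.diff_left scalar_op.rep_eq)
  qed
  have comm: "A k ((T - scalar_op z) f) = (T - scalar_op z) (A k f)" for k f
    using T by (simp add: A_apply blinfun.diff_left blinfun.diff_right scalar_op.rep_eq scT
        scaleC_diff clinear_op_def scaleC_scaleC mult.commute flip: op_power_Suc_apply op_power_Suc2_apply)
  have L: "S ((T - scalar_op z) f) = - f" for f
  proof -
    have "(\<lambda>k. (T - scalar_op z) (A k f)) sums S ((T - scalar_op z) f)"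
      using Sf[of "(T - scalar_op z) f"] unfolding comm .
    then show ?thesis using tel[of f] sums_unique2
      by (fastforce simp: blinfun.diff_left scalar_op.rep_eq)
  qed
  have "(- S) o\<^sub>L (T - scalar_op z) = id_blinfun" "(T - scalar_op z) o\<^sub>L (- S) = id_blinfun"
    using L R by (auto intro!: blinfun_eqI simp: blinfun.minus_left blinfun.minus_right id_blinfun.rep_eq)
  then show False using z unfolding spectrum_def by blast
qed

lemma norm_poly_op_le:
  assumes "selfadj T" "\<And>x. complex_of_real x \<in> spectrum T \<Longrightarrow> cmod (poly p (complex_of_real x)) \<le> e"
  shows "norm (poly_op p T) \<le> e"
  using norm_poly_op_le_spectrum[OF assms(1), of p] assms(2) by force

lemma real_spectrum_bound:
  assumes "selfadj T" "norm T \<le> M" "complex_of_real x \<in> spectrum T" shows "x \<in> {-M..M}"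
  using spectrum_le_norm[OF selfadj_clinear[OF assms(1)] assms(3)] assms(2) by auto

lemma complex_poly_approx:
  fixes g :: "real \<Rightarrow> complex"
  assumes "continuous_on {-M..M} g" "0 < e"
  shows "\<exists>p. \<forall>x\<in>{-M..M}. cmod (g x - poly p (complex_of_real x)) \<le> e"
proof -
  have real: "\<exists>p :: complex poly. \<forall>x\<in>{-M..M}. cmod (complex_of_real (f x) - poly p (complex_of_real x)) \<le> d"
    if f: "continuous_on {-M..M} f" and d: "0 < d" for f :: "real \<Rightarrow> real" and d
  proof -
    obtain q where q: "real_polynomial_function q" "\<And>x. x \<in> {-M..M} \<Longrightarrow> \<bar>f x - q x\<bar> < d"
      using Stone_Weierstrass_real_polynomial_function[OF compact_Icc f d] by auto
    obtain a n where a: "q = (\<lambda>x. \<Sum>i\<le>n. a i * x ^ i)"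
      using q(1) real_polynomial_function_iff_sum by auto
    define p where "p = (\<Sum>i\<le>n. monom (complex_of_real (a i)) i)"
    have "poly p (complex_of_real x) = complex_of_real (q x)" for x
      by (simp add: p_def a poly_sum poly_monom)
    then show ?thesis using q(2) by (intro exI[of _ p]) (auto simp flip: of_real_diff simp: less_imp_le)
  qed
  have "continuous_on {-M..M} (\<lambda>x. Re (g x))" "continuous_on {-M..M} (\<lambda>x. Im (g x))"
    using assms(1) by (auto intro: continuous_intros)
  then obtain p q where p: "\<forall>x\<in>{-M..M}. cmod (complex_of_real (Re (g x)) - poly p (complex_of_real x)) \<le> e/2"
    and q: "\<forall>x\<in>{-M..M}. cmod (complex_of_real (Im (g x)) - poly q (complex_of_real x)) \<le> e/2"
    using real assms(2) by (meson half_gt_zero)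
  have "cmod (g x - poly (p + smult \<i> q) (complex_of_real x)) \<le> e" if x: "x \<in> {-M..M}" for x
  proof -
    have "g x - poly (p + smult \<i> q) (complex_of_real x)
      = (complex_of_real (Re (g x)) - poly p (complex_of_real x))
        + \<i> * (complex_of_real (Im (g x)) - poly q (complex_of_real x))"
      by (subst complex_eq[of "g x"]) (simp add: algebra_simps)
    also have "cmod \<dots> \<le> e/2 + e/2"
      using p q x by (intro order_trans[OF norm_triangle_ineq] add_mono) (auto simp: norm_mult)
    finally show ?thesis by simp
  qed
  then show ?thesis by blast
qed

text \<open>Shows that the description defining \<open>fun_calc\<close> has exactly one value. By
  the spectral norm inequality, two polynomial sequences with the same uniform limit on the spectrum
  give operator sequences whose difference tends to 0, and each is Cauchy. The given sequence
  \<open>p\<close> keeps the defining implication from being vacuous, which yields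
  uniqueness.\<close>

lemma fun_calc_limit:
  fixes T :: "'i operator"
  assumes T: "selfadj T" and M: "norm T \<le> M" and g: "continuous_on UNIV g"
    and lim: "uniform_limit {x. complex_of_real x \<in> spectrum T} (\<lambda>n x. poly (p n) (complex_of_real x)) g sequentially"
  shows "(\<lambda>n. poly_op (p n) T) \<longlonglongrightarrow> fun_calc g T"
proof -
  let ?s = "{x. complex_of_real x \<in> spectrum T}"
  let ?P = "\<lambda>S. \<forall>p :: nat \<Rightarrow> complex poly.
     uniform_limit ?s (\<lambda>n x. poly (p n) (complex_of_real x)) g sequentially
     \<longrightarrow> (\<lambda>n. poly_op (p n) T) \<longlonglongrightarrow> S"
  have close: "\<exists>N. \<forall>m\<ge>N. \<forall>n\<ge>N. norm (poly_op (p m) T - poly_op (q n) T) < e"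
    if p: "uniform_limit ?s (\<lambda>n x. poly (p n) (complex_of_real x)) g sequentially"
      and q: "uniform_limit ?s (\<lambda>n x. poly (q n) (complex_of_real x)) g sequentially"
      and e: "0 < e" for p q :: "nat \<Rightarrow> complex poly" and e
  proof -
    have e3: "e / 3 > 0" using e by simp
    obtain N1 where N1: "\<And>n x. n \<ge> N1 \<Longrightarrow> x \<in> ?s \<Longrightarrow> dist (poly (p n) (complex_of_real x)) (g x) < e / 3"
      using uniform_limitD[OF p e3] unfolding eventually_sequentially by blast
    obtain N2 where N2: "\<And>n x. n \<ge> N2 \<Longrightarrow> x \<in> ?s \<Longrightarrow> dist (poly (q n) (complex_of_real x)) (g x) < e / 3"
      using uniform_limitD[OF q e3] unfolding eventually_sequentially by blast
    have "norm (poly_op (p m) T - poly_op (q n) T) < e" if mn: "m \<ge> max N1 N2" "n \<ge> max N1 N2" for m n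
    proof -
      have "norm (poly_op (p m - q n) T) \<le> e / 3 + e / 3"
      proof (rule norm_poly_op_le[OF T])
        fix x assume x: "complex_of_real x \<in> spectrum T"
        have "dist (poly (p m) (complex_of_real x)) (poly (q n) (complex_of_real x)) \<le> e / 3 + e / 3"
          using N1[of m x] N2[of n x] x mn
            dist_triangle2[of "poly (p m) (complex_of_real x)" "poly (q n) (complex_of_real x)" "g x"] by auto
        then show "cmod (poly (p m - q n) (complex_of_real x)) \<le> e / 3 + e / 3"
          by (simp add: dist_norm)
      qed
      then show ?thesis using e by (simp add: poly_op_diff)
    qed
    then show ?thesis by blast
  qed
  have conv: "\<exists>S. (\<lambda>n. poly_op (p n) T) \<longlonglongrightarrow> S"
    if "uniform_limit ?s (\<lambda>n x. poly (p n) (complex_of_real x)) g sequentially" for p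
    using close[OF that that] Cauchy_convergent_iff[of "\<lambda>n. poly_op (p n) T"]
    by (auto simp: convergent_def intro!: CauchyI)
  obtain S where S: "(\<lambda>n. poly_op (p n) T) \<longlonglongrightarrow> S" using conv[OF lim] ..
  have PS: "?P S"
  proof (intro allI impI)
    fix q :: "nat \<Rightarrow> complex poly"
    assume q: "uniform_limit ?s (\<lambda>n x. poly (q n) (complex_of_real x)) g sequentially"
    have "(\<lambda>n. poly_op (q n) T - poly_op (p n) T) \<longlonglongrightarrow> 0"
    proof (rule LIMSEQ_I)
      fix r :: real assume "0 < r"
      then show "\<exists>no. \<forall>n\<ge>no. norm (poly_op (q n) T - poly_op (p n) T - 0) < r"
        using close[OF q lim] by fastforce
    qed
    from tendsto_add[OF this S] show "(\<lambda>n. poly_op (q n) T) \<longlonglongrightarrow> S" by simp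
  qed
  have "fun_calc g T = S" unfolding fun_calc_def
  proof (rule the_equality)
    show "?P S" by (rule PS)
    show "S' = S" if "?P S'" for S'
      using that lim S LIMSEQ_unique by blast
  qed
  then show ?thesis using S by simp
qed

lemma complex_poly_seq:
  assumes "continuous_on UNIV g"
  obtains p :: "nat \<Rightarrow> complex poly" where
    "uniform_limit {-M..M} (\<lambda>n x. poly (p n) (complex_of_real x)) g sequentially"
proof -
  have "\<exists>p. \<forall>x\<in>{-M..M}. cmod (g x - poly p (complex_of_real x)) \<le> inverse (real (Suc n))" for n
    using assms by (intro complex_poly_approx) (auto intro: continuous_on_subset)
  then obtain p where p: "\<And>n x. x \<in> {-M..M} \<Longrightarrow> cmod (g x - poly (p n) (complex_of_real x)) \<le> inverse (real (Suc n))"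
    by metis
  have "uniform_limit {-M..M} (\<lambda>n x. poly (p n) (complex_of_real x)) g sequentially"
    unfolding uniform_limit_iff
  proof (intro allI impI)
    fix e :: real assume "0 < e"
    then have "\<forall>\<^sub>F n in sequentially. inverse (real (Suc n)) < e"
      using LIMSEQ_inverse_real_of_nat by (rule order_tendstoD(2)[rotated])
    then show "\<forall>\<^sub>F n in sequentially. \<forall>x\<in>{-M..M}. dist (poly (p n) (complex_of_real x)) (g x) < e"
    proof eventually_elim
      case (elim n)
      then show ?case using p[of _ n] order_le_less_trans unfolding dist_norm norm_minus_commute[of _ "g _"]
        by blast
    qed
  qed
  then show thesis by (rule that)
qed

lemma fun_calc_limit_Icc:
  assumes "selfadj T" "norm T \<le> M" "continuous_on UNIV g"
    and "uniform_limit {-M..M} (\<lambda>n x. poly (p n) (complex_of_real x)) g sequentially"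
  shows "(\<lambda>n. poly_op (p n) T) \<longlonglongrightarrow> fun_calc g T"
  by (rule fun_calc_limit[OF assms(1-3)], rule uniform_limit_on_subset[OF assms(4)])
     (use real_spectrum_bound[OF assms(1,2)] in auto)

text \<open>The error is measured on a fixed interval rather than on the spectrum of T, so a single
  p serves all self-adjoint operators of norm at most M at once.\<close>

lemma fun_calc_poly_close:
  assumes T: "selfadj T" "norm T \<le> M" and g: "continuous_on UNIV g"
    and e: "\<And>x. x \<in> {-M..M} \<Longrightarrow> cmod (g x - poly p (complex_of_real x)) \<le> e"
  shows "norm (fun_calc g T - poly_op p T) \<le> e"
proof (rule field_le_epsilon)
  fix d :: real assume d: "0 < d"
  obtain q where q: "uniform_limit {-M..M} (\<lambda>n x. poly (q n) (complex_of_real x)) g sequentially"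
    using complex_poly_seq[OF g] .
  have lim: "(\<lambda>n. norm (poly_op (q n) T - poly_op p T)) \<longlonglongrightarrow> norm (fun_calc g T - poly_op p T)"
    by (intro tendsto_intros fun_calc_limit_Icc[OF T g q])
  have "\<forall>\<^sub>F n in sequentially. norm (poly_op (q n) T - poly_op p T) \<le> e + d"
    using uniform_limitD[OF q d]
  proof eventually_elim
    case (elim n)
    have "norm (poly_op (q n - p) T) \<le> e + d"
    proof (rule norm_poly_op_le[OF T(1)])
      fix x assume "complex_of_real x \<in> spectrum T"
      then have x: "x \<in> {-M..M}" by (rule real_spectrum_bound[OF T])
      show "cmod (poly (q n - p) (complex_of_real x)) \<le> e + d"
        using norm_triangle_ineq[of "poly (q n) (complex_of_real x) - g x" "g x - poly p (complex_of_real x)"]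
          e[OF x] elim[rule_format, OF x] by (simp add: dist_norm)
    qed
    then show ?case by (simp add: poly_op_diff)
  qed
  with lim show "norm (fun_calc g T - poly_op p T) \<le> e + d"
    by (intro tendsto_upperbound[OF lim]) auto
qed

lemma fun_calc_add:
  assumes T: "selfadj T" and g: "continuous_on UNIV g1" "continuous_on UNIV g2"
  shows "fun_calc (\<lambda>x. g1 x + g2 x) T f = fun_calc g1 T f + fun_calc g2 T f"
proof -
  let ?M = "norm T"
  obtain p where p: "uniform_limit {-?M..?M} (\<lambda>n x. poly (p n) (complex_of_real x)) g1 sequentially"
    using complex_poly_seq[OF g(1)] .
  obtain q where q: "uniform_limit {-?M..?M} (\<lambda>n x. poly (q n) (complex_of_real x)) g2 sequentially"
    using complex_poly_seq[OF g(2)] .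
  have "uniform_limit {-?M..?M} (\<lambda>n x. poly (p n + q n) (complex_of_real x)) (\<lambda>x. g1 x + g2 x) sequentially"
    using uniform_limit_add[OF p q] by simp
  then have "(\<lambda>n. poly_op (p n + q n) T) \<longlonglongrightarrow> fun_calc (\<lambda>x. g1 x + g2 x) T"
    by (rule fun_calc_limit_Icc[OF T order_refl, rotated]) (intro continuous_intros g)
  moreover have "(\<lambda>n. poly_op (p n) T + poly_op (q n) T) \<longlonglongrightarrow> fun_calc g1 T + fun_calc g2 T"
    by (intro tendsto_add fun_calc_limit_Icc[OF T order_refl] g p q)
  moreover have "poly_op (p n + q n) T = poly_op (p n) T + poly_op (q n) T" for n
    by (rule blinfun_eqI) (simp add: poly_op_add_apply blinfun.add_left)
  ultimately have "fun_calc (\<lambda>x. g1 x + g2 x) T = fun_calc g1 T + fun_calc g2 T"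
    using LIMSEQ_unique by auto
  then show ?thesis by (simp add: blinfun.add_left)
qed

lemma fun_calc_cmult:
  assumes T: "selfadj T" and g: "continuous_on UNIV g"
  shows "fun_calc (\<lambda>x. c * g x) T f = scaleC c (fun_calc g T f)"
proof -
  let ?M = "norm T"
  obtain p where p: "uniform_limit {-?M..?M} (\<lambda>n x. poly (p n) (complex_of_real x)) g sequentially"
    using complex_poly_seq[OF g] .
  have "uniform_limit {-?M..?M} (\<lambda>n x. poly (smult c (p n)) (complex_of_real x)) (\<lambda>x. c * g x) sequentially"
    using bounded_linear.uniform_limit[OF bounded_linear_mult_right p, of c] by simp
  then have "(\<lambda>n. poly_op (smult c (p n)) T) \<longlonglongrightarrow> fun_calc (\<lambda>x. c * g x) T"
    by (rule fun_calc_limit_Icc[OF T order_refl, rotated]) (intro continuous_intros g)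
  then have "(\<lambda>n. poly_op (smult c (p n)) T f) \<longlonglongrightarrow> fun_calc (\<lambda>x. c * g x) T f"
    by (rule bounded_linear.tendsto[OF blinfun.bounded_linear_left])
  moreover have "(\<lambda>n. scalar_op c (poly_op (p n) T f)) \<longlonglongrightarrow> scalar_op c (fun_calc g T f)"
    by (intro bounded_linear.tendsto[OF blinfun.bounded_linear_right]
        bounded_linear.tendsto[OF blinfun.bounded_linear_left] fun_calc_limit_Icc[OF T order_refl g p])
  moreover have "poly_op (smult c (p n)) T f = scalar_op c (poly_op (p n) T f)" for n
    by (simp add: poly_op_smult_apply scalar_op.rep_eq)
  ultimately show ?thesis using LIMSEQ_unique by (auto simp: scalar_op.rep_eq)
qed

lemma fun_calc_norm_le:
  assumes "selfadj T" "norm T \<le> M" "continuous_on UNIV g" "\<And>x. x \<in> {-M..M} \<Longrightarrow> cmod (g x) \<le> e"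
  shows "norm (fun_calc g T) \<le> e"
proof -
  have "poly_op 0 T = 0" by (rule blinfun_eqI) simp
  then show ?thesis using fun_calc_poly_close[OF assms(1-3), of 0 e] assms(4) by simp
qed

lemma fun_calc_one:
  assumes "selfadj T" shows "fun_calc (\<lambda>_. 1) T f = f"
proof -
  have "norm (fun_calc (\<lambda>_. 1) T - poly_op [:1:] T) \<le> 0"
    by (rule fun_calc_poly_close[OF assms order_refl]) auto
  then have "fun_calc (\<lambda>_. 1) T = poly_op [:1:] T" by simp
  then show ?thesis by simp
qed

section \<open>Operators with a symmetric Schur kernel\<close>


definition schur_kernel :: "('i \<Rightarrow> 'i \<Rightarrow> real) \<Rightarrow> real \<Rightarrow> bool" where
  "schur_kernel K M \<longleftrightarrow> 0 \<le> M \<and> (\<forall>i j. K i j = K j i) \<and>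
     (\<forall>i. (\<lambda>j. \<bar>K i j\<bar>) summable_on UNIV \<and> (\<Sum>\<^sub>\<infinity>j. \<bar>K i j\<bar>) \<le> M)"

definition has_kernel :: "'i operator \<Rightarrow> ('i \<Rightarrow> 'i \<Rightarrow> real) \<Rightarrow> bool" where
  "has_kernel T K \<longleftrightarrow> (\<forall>\<psi> i. coord (T \<psi>) i = (\<Sum>\<^sub>\<infinity>j. complex_of_real (K i j) * coord \<psi> j))"

lemma schur_kernel_sym: "schur_kernel K M \<Longrightarrow> K i j = K j i"
  by (simp add: schur_kernel_def)

lemma schur_kernel_nonneg: "schur_kernel K M \<Longrightarrow> 0 \<le> M"
  by (simp add: schur_kernel_def)

lemma schur_kernel_row: "schur_kernel K M \<Longrightarrow> finite F \<Longrightarrow> (\<Sum>j\<in>F. \<bar>K i j\<bar>) \<le> M"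
  unfolding schur_kernel_def using finite_sum_le_infsum[of "\<lambda>j. \<bar>K i j\<bar>" UNIV F]
  by (metis abs_ge_zero order_trans subset_UNIV)

lemma schur_kernelI:
  assumes "0 \<le> M" "\<And>i j. K i j = K j i" "\<And>i F. finite F \<Longrightarrow> (\<Sum>j\<in>F. \<bar>K i j\<bar>) \<le> M"
  shows "schur_kernel K M"
proof -
  have s: "(\<lambda>j. \<bar>K i j\<bar>) summable_on UNIV" for i
    by (rule nonneg_bdd_above_summable_on) (auto intro!: bdd_aboveI2 assms(3))
  then show ?thesis using assms by (auto simp: schur_kernel_def intro!: infsum_le_finite_sums)
qed

lemma schur_kernel_mult_summable:
  assumes "schur_kernel K M"
  shows "(\<lambda>j. \<bar>K i j\<bar> * cmod (coord \<psi> j)) summable_on UNIV"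
proof (rule summable_on_comparison_test)
  show "(\<lambda>j. \<bar>K i j\<bar> * norm \<psi>) summable_on UNIV"
    using assms by (intro summable_on_cmult_left) (auto simp: schur_kernel_def)
qed (auto intro: mult_left_mono cmod_coord_le)

lemma schur_kernel_summable:
  assumes "schur_kernel K M"
  shows "(\<lambda>j. complex_of_real (K i j) * coord \<psi> j) summable_on UNIV"
  by (rule abs_summable_summable) (use schur_kernel_mult_summable[OF assms] in \<open>simp add: norm_mult\<close>)

lemma infsum_finite_sum:
  fixes f :: "'a \<Rightarrow> 'b \<Rightarrow> real"
  assumes "finite F" "\<And>i. f i summable_on A"
  shows "(\<lambda>j. \<Sum>i\<in>F. f i j) summable_on A"
    and "(\<Sum>\<^sub>\<infinity>j\<in>A. \<Sum>i\<in>F. f i j) = (\<Sum>i\<in>F. \<Sum>\<^sub>\<infinity>j\<in>A. f i j)"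
proof -
  have "(\<lambda>j. \<Sum>i\<in>F. f i j) summable_on A \<and>
      (\<Sum>\<^sub>\<infinity>j\<in>A. \<Sum>i\<in>F. f i j) = (\<Sum>i\<in>F. \<Sum>\<^sub>\<infinity>j\<in>A. f i j)"
    using assms by (induct F) (auto simp: infsum_add summable_on_add)
  then show "(\<lambda>j. \<Sum>i\<in>F. f i j) summable_on A"
    and "(\<Sum>\<^sub>\<infinity>j\<in>A. \<Sum>i\<in>F. f i j) = (\<Sum>i\<in>F. \<Sum>\<^sub>\<infinity>j\<in>A. f i j)" by auto
qed

text \<open>Schur test. Writing |K| as sqrt |K| times sqrt |K|, Cauchy-Schwarz bounds each squared
  entry by M times a sum of squares weighted by |K|. Summing over rows, symmetry turns the row bound
  into a column bound and supplies the second factor M.\<close>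

lemma schur_test_sum:
  assumes K: "schur_kernel K M" and F: "finite F"
  shows "(\<Sum>i\<in>F. (cmod (\<Sum>\<^sub>\<infinity>j. complex_of_real (K i j) * coord \<psi> j))\<^sup>2) \<le> (M * norm \<psi>)\<^sup>2"
proof -
  let ?w = "\<lambda>i j. \<bar>K i j\<bar> * (cmod (coord \<psi> j))\<^sup>2"
  have M: "0 \<le> M" by (rule schur_kernel_nonneg[OF K])
  have sw: "?w i summable_on UNIV" for i
  proof (rule summable_on_comparison_test)
    show "(\<lambda>j. M * (cmod (coord \<psi> j))\<^sup>2) summable_on UNIV"
      by (intro summable_on_cmult_right ell2_sq_summable)
    show "?w i j \<le> M * (cmod (coord \<psi> j))\<^sup>2" for j
      using schur_kernel_row[OF K, of "{j}" i] by (intro mult_right_mono) auto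
  qed auto
  have row: "(cmod (\<Sum>\<^sub>\<infinity>j. complex_of_real (K i j) * coord \<psi> j))\<^sup>2 \<le> M * (\<Sum>\<^sub>\<infinity>j. ?w i j)" for i
  proof -
    have W: "0 \<le> (\<Sum>\<^sub>\<infinity>j. ?w i j)" by (rule infsum_nonneg) auto
    have "cmod (\<Sum>\<^sub>\<infinity>j. complex_of_real (K i j) * coord \<psi> j) \<le> (\<Sum>\<^sub>\<infinity>j. \<bar>K i j\<bar> * cmod (coord \<psi> j))"
      using norm_infsum_bound[of "\<lambda>j. complex_of_real (K i j) * coord \<psi> j" UNIV]
        schur_kernel_mult_summable[OF K, of i \<psi>] by (simp add: norm_mult)
    also have "\<dots> \<le> sqrt (M * (\<Sum>\<^sub>\<infinity>j. ?w i j))"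
    proof (rule infsum_le_finite_sums[OF schur_kernel_mult_summable[OF K]])
      fix J :: "'a set" assume J: "finite J"
      have "(\<Sum>j\<in>J. \<bar>K i j\<bar> * cmod (coord \<psi> j))
          = (\<Sum>j\<in>J. \<bar>sqrt \<bar>K i j\<bar>\<bar> * \<bar>sqrt \<bar>K i j\<bar> * cmod (coord \<psi> j)\<bar>)"
        by (rule sum.cong) (auto simp: abs_mult simp flip: mult.assoc)
      also have "\<dots> \<le> L2_set (\<lambda>j. sqrt \<bar>K i j\<bar>) J * L2_set (\<lambda>j. sqrt \<bar>K i j\<bar> * cmod (coord \<psi> j)) J"
        by (rule L2_set_mult_ineq)
      also have "\<dots> = sqrt (\<Sum>j\<in>J. \<bar>K i j\<bar>) * sqrt (\<Sum>j\<in>J. ?w i j)"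
        by (simp add: L2_set_def power_mult_distrib)
      also have "\<dots> \<le> sqrt M * sqrt (\<Sum>\<^sub>\<infinity>j. ?w i j)"
        using schur_kernel_row[OF K J] finite_sum_le_infsum[OF sw J]
        by (intro mult_mono real_sqrt_le_mono) (auto simp: sum_nonneg M)
      finally show "(\<Sum>j\<in>J. \<bar>K i j\<bar> * cmod (coord \<psi> j)) \<le> sqrt (M * (\<Sum>\<^sub>\<infinity>j. ?w i j))"
        by (simp add: real_sqrt_mult)
    qed
    finally have "(cmod (\<Sum>\<^sub>\<infinity>j. complex_of_real (K i j) * coord \<psi> j))\<^sup>2 \<le> (sqrt (M * (\<Sum>\<^sub>\<infinity>j. ?w i j)))\<^sup>2"
      by (rule power_mono) simp
    then show ?thesis using M W by simp
  qed
  have "(\<Sum>i\<in>F. (cmod (\<Sum>\<^sub>\<infinity>j. complex_of_real (K i j) * coord \<psi> j))\<^sup>2) \<le> (\<Sum>i\<in>F. M * (\<Sum>\<^sub>\<infinity>j. ?w i j))"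
    by (intro sum_mono row)
  also have "\<dots> = M * (\<Sum>\<^sub>\<infinity>j. \<Sum>i\<in>F. ?w i j)"
    using infsum_finite_sum(2)[OF F, of ?w UNIV] sw by (simp add: sum_distrib_left)
  also have "\<dots> \<le> M * (M * (norm \<psi>)\<^sup>2)"
  proof (rule mult_left_mono[OF _ M])
    have "(\<Sum>\<^sub>\<infinity>j. \<Sum>i\<in>F. ?w i j) \<le> (\<Sum>\<^sub>\<infinity>j. M * (cmod (coord \<psi> j))\<^sup>2)"
  proof (rule infsum_mono)
    show "(\<lambda>j. \<Sum>i\<in>F. ?w i j) summable_on UNIV" by (rule infsum_finite_sum(1)[OF F sw])
    show "(\<lambda>j. M * (cmod (coord \<psi> j))\<^sup>2) summable_on UNIV"
      by (intro summable_on_cmult_right ell2_sq_summable)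
    show "(\<Sum>i\<in>F. ?w i j) \<le> M * (cmod (coord \<psi> j))\<^sup>2" for j
      using schur_kernel_row[OF K F, of j] schur_kernel_sym[OF K, of j]
      by (simp add: sum_distrib_right[symmetric] mult_right_mono)
  qed
  also have "\<dots> = M * (norm \<psi>)\<^sup>2"
    unfolding norm_ell2_sq by (rule infsum_cmult_right) (simp add: ell2_sq_summable)
    finally show "(\<Sum>\<^sub>\<infinity>j. \<Sum>i\<in>F. ?w i j) \<le> M * (norm \<psi>)\<^sup>2" .
  qed
  finally show ?thesis by (simp add: power2_eq_square mult_ac)
qed

lemma has_kernel_norm_le:
  assumes T: "has_kernel T K" and K: "schur_kernel K M" shows "norm T \<le> M"
proof (rule norm_blinfun_bound)
  show M: "0 \<le> M" by (rule schur_kernel_nonneg[OF K])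
  fix \<psi>
  have "\<exists>g. coord g = coord (T \<psi>) \<and> norm g \<le> M * norm \<psi>"
  proof (rule ell2_of_bounded_sums)
    show "(\<Sum>i\<in>F. (cmod (coord (T \<psi>) i))\<^sup>2) \<le> (M * norm \<psi>)\<^sup>2" if "finite F" for F
      using schur_test_sum[OF K that, of \<psi>] T by (simp add: has_kernel_def)
  qed (rule mult_nonneg_nonneg[OF M norm_ge_zero])
  then show "norm (T \<psi>) \<le> M * norm \<psi>" by (auto simp: coord_inject)
qed

lemma has_kernel_exists:
  assumes K: "schur_kernel K M" shows "\<exists>T. has_kernel T K"
proof -
  have M: "0 \<le> M" by (rule schur_kernel_nonneg[OF K])
  have "\<exists>g. coord g = (\<lambda>i. \<Sum>\<^sub>\<infinity>j. complex_of_real (K i j) * coord \<psi> j) \<and> norm g \<le> M * norm \<psi>" for \<psi>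
    by (rule ell2_of_bounded_sums) (auto intro: schur_test_sum[OF K] mult_nonneg_nonneg[OF M])
  then obtain t where t: "\<And>\<psi> i. coord (t \<psi>) i = (\<Sum>\<^sub>\<infinity>j. complex_of_real (K i j) * coord \<psi> j)"
    "\<And>\<psi>. norm (t \<psi>) \<le> M * norm \<psi>"
    by metis
  note s = schur_kernel_summable[OF K]
  have "bounded_linear t"
  proof (rule bounded_linear_intro)
    show "t (f + g) = t f + t g" for f g
      by (rule ell2_eqI) (simp add: coord_simps t distrib_left infsum_add s)
    show "t (r *\<^sub>R f) = r *\<^sub>R t f" for r f
    proof (rule ell2_eqI)
      fix i
      have "(\<Sum>\<^sub>\<infinity>j. complex_of_real r * (complex_of_real (K i j) * coord f j))
          = complex_of_real r * (\<Sum>\<^sub>\<infinity>j. complex_of_real (K i j) * coord f j)"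
        by (rule infsum_cmult_right) (simp add: s)
      then show "coord (t (r *\<^sub>R f)) i = coord (r *\<^sub>R t f) i"
        by (simp add: coord_simps t mult.left_commute)
    qed
    show "norm (t f) \<le> norm f * M" for f using t(2)[of f] by (simp add: mult.commute)
  qed
  then show ?thesis
    using t by (intro exI[of _ "Blinfun t"]) (simp add: has_kernel_def bounded_linear_Blinfun_apply)
qed

lemma has_kernel_diff:
  assumes "has_kernel T K" "has_kernel T' K'" "schur_kernel K M" "schur_kernel K' M'"
  shows "has_kernel (T - T') (\<lambda>i j. K i j - K' i j)"
  unfolding has_kernel_def
proof (intro allI)
  fix \<psi> i
  note s = schur_kernel_summable[OF assms(3), of i \<psi>] schur_kernel_summable[OF assms(4), of i \<psi>]
  have "(\<Sum>\<^sub>\<infinity>j. complex_of_real (K i j) * coord \<psi> j + - (complex_of_real (K' i j) * coord \<psi> j))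
      = coord (T \<psi>) i + - coord (T' \<psi>) i"
    using assms(1,2) s by (subst infsum_add) (auto simp: has_kernel_def infsum_uminus summable_on_uminus)
  then show "coord ((T - T') \<psi>) i = (\<Sum>\<^sub>\<infinity>j. complex_of_real (K i j - K' i j) * coord \<psi> j)"
    by (simp add: blinfun.diff_left coord_simps left_diff_distrib)
qed

lemma has_kernel_delta:
  assumes "has_kernel T K" shows "coord (T (delta x)) i = complex_of_real (K i x)"
proof -
  have "coord (T (delta x)) i = (\<Sum>\<^sub>\<infinity>j\<in>{x}. complex_of_real (K i j) * coord (delta x) j)"
    using assms unfolding has_kernel_def
    by (simp only:) (rule infsum_cong_neutral, auto simp: coord_simps)
  then show ?thesis by (simp add: coord_simps)
qed

text \<open>The point is to interchange two infinite sums. Absolute summability comes from the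
  operator \<open>T'\<close> with kernel |K| applied to the vector \<open>f'\<close> of absolute
  values of f: its entries are the inner sums of absolute values, and two square-summable families
  have a summable product.\<close>

lemma has_kernel_selfadj:
  assumes T: "has_kernel T K" and K: "schur_kernel K M" shows "selfadj T"
  unfolding selfadj_def
proof (intro allI)
  fix f g
  let ?h = "\<lambda>i j. complex_of_real (K i j) * cnj (coord f j) * coord g i"
  obtain f' where f': "coord f' = (\<lambda>j. complex_of_real (cmod (coord f j)))"
    using ell2_of_bounded_sums[of "\<lambda>j. complex_of_real (cmod (coord f j))" "norm f"]
    by (auto simp: sum_sq_le_norm)
  have K': "schur_kernel (\<lambda>i j. \<bar>K i j\<bar>) M" using K by (simp add: schur_kernel_def)
  obtain T' where T': "has_kernel T' (\<lambda>i j. \<bar>K i j\<bar>)" using has_kernel_exists[OF K'] ..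
  have inner: "(\<Sum>\<^sub>\<infinity>j. norm (?h i j)) = cmod (coord (T' f') i) * cmod (coord g i)" for i
  proof -
    have "coord (T' f') i = (\<Sum>\<^sub>\<infinity>j. complex_of_real (\<bar>K i j\<bar> * cmod (coord f j)))"
      using T' by (simp add: has_kernel_def f')
    also have "\<dots> = complex_of_real (\<Sum>\<^sub>\<infinity>j. \<bar>K i j\<bar> * cmod (coord f j))"
      by (rule infsumI[OF has_sum_of_real[OF has_sum_infsum[OF schur_kernel_mult_summable[OF K]]]])
    finally have "cmod (coord (T' f') i) = (\<Sum>\<^sub>\<infinity>j. \<bar>K i j\<bar> * cmod (coord f j))"
      by (simp add: infsum_nonneg)
    moreover have "(\<Sum>\<^sub>\<infinity>j. (\<bar>K i j\<bar> * cmod (coord f j)) * cmod (coord g i))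
        = (\<Sum>\<^sub>\<infinity>j. \<bar>K i j\<bar> * cmod (coord f j)) * cmod (coord g i)"
      by (rule infsum_cmult_left) (simp add: schur_kernel_mult_summable[OF K])
    ultimately show ?thesis by (simp add: norm_mult)
  qed
  have "(\<lambda>p. norm (case p of (i, j) \<Rightarrow> ?h i j)) summable_on UNIV \<times> UNIV"
  proof (subst Infinite_Sum.abs_summable_on_Sigma_iff, intro conjI ballI)
    show "(\<lambda>j. norm (case (i, j) of (i, j) \<Rightarrow> ?h i j)) summable_on UNIV" for i
      using summable_on_cmult_left[OF schur_kernel_mult_summable[OF K, of i f], of "cmod (coord g i)"]
      by (simp add: norm_mult)
    show "(\<lambda>i. norm (\<Sum>\<^sub>\<infinity>j. norm (case (i, j) of (i, j) \<Rightarrow> ?h i j))) summable_on UNIV"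
      using ell2_summable_cmod_mult[OF ell2_sq_summable[of "T' f'"] ell2_sq_summable[of g]]
      by (simp only: prod.case inner) simp
  qed
  then have swap: "(\<Sum>\<^sub>\<infinity>i. \<Sum>\<^sub>\<infinity>j. ?h i j) = (\<Sum>\<^sub>\<infinity>j. \<Sum>\<^sub>\<infinity>i. ?h i j)"
    by (rule infsum_swap_banach[OF abs_summable_summable])
  have "cinner (T f) g = (\<Sum>\<^sub>\<infinity>i. \<Sum>\<^sub>\<infinity>j. ?h i j)"
  proof -
    have "cnj (coord (T f) i) * coord g i = (\<Sum>\<^sub>\<infinity>j. ?h i j)" for i
    proof -
      have "cnj (coord (T f) i) = (\<Sum>\<^sub>\<infinity>j. complex_of_real (K i j) * cnj (coord f j))"
        using T by (simp add: has_kernel_def flip: infsum_cnj)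
      moreover have "(\<lambda>j. complex_of_real (K i j) * cnj (coord f j)) summable_on UNIV"
        by (rule abs_summable_summable) (use schur_kernel_mult_summable[OF K] in \<open>simp add: norm_mult\<close>)
      ultimately show ?thesis by (simp add: infsum_cmult_left)
    qed
    then show ?thesis by (simp add: cinner_sums)
  qed
  also have "\<dots> = cinner f (T g)"
  proof -
    have "cnj (coord f j) * coord (T g) j = (\<Sum>\<^sub>\<infinity>i. ?h i j)" for j
    proof -
      have "(\<Sum>\<^sub>\<infinity>i. ?h i j) = (\<Sum>\<^sub>\<infinity>i. cnj (coord f j) * (complex_of_real (K j i) * coord g i))"
        using schur_kernel_sym[OF K, of j] by (simp add: mult_ac)
      also have "\<dots> = cnj (coord f j) * coord (T g) j"
        using T unfolding has_kernel_def
        by (simp only:) (rule infsum_cmult_right, simp add: schur_kernel_summable[OF K])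
      finally show ?thesis by simp
    qed
    then show ?thesis unfolding swap by (simp add: cinner_sums)
  qed
  finally show "cinner (T f) g = cinner f (T g)" .
qed

section \<open>Relabelling the index set\<close>

definition reindex_op :: "('i \<Rightarrow> 'i) \<Rightarrow> 'i operator" where
  "reindex_op \<pi> = (SOME U. \<forall>\<psi> i. coord (blinfun_apply U \<psi>) i = coord \<psi> (\<pi> i))"

text \<open>Composition with \<pi> is not bounded for every \<pi>, which is why the operator is
  introduced by choice; injectivity makes it a contraction, since a finite sum over \<open>F\<close>
  becomes a sum over the image of \<open>F\<close>.\<close>

lemma reindex_op:
  fixes \<pi> :: "'i \<Rightarrow> 'i"
  assumes "inj \<pi>" shows "coord (reindex_op \<pi> \<psi>) i = coord \<psi> (\<pi> i)"
proof -
  have "\<exists>g. coord g = (\<lambda>i. coord \<psi> (\<pi> i)) \<and> norm g \<le> norm \<psi>" for \<psi> :: "'i ell2"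
  proof (rule ell2_of_bounded_sums)
    fix F :: "'i set" assume "finite F"
    then have "(\<Sum>i\<in>\<pi> ` F. (cmod (coord \<psi> i))\<^sup>2) \<le> (norm \<psi>)\<^sup>2" by (intro sum_sq_le_norm) simp
    then show "(\<Sum>i\<in>F. (cmod (coord \<psi> (\<pi> i)))\<^sup>2) \<le> (norm \<psi>)\<^sup>2"
      using assms by (subst (asm) sum.reindex) (auto simp: inj_on_def)
  qed simp
  then obtain t where t: "\<And>\<psi> i. coord (t \<psi>) i = coord \<psi> (\<pi> i)" "\<And>\<psi>. norm (t \<psi>) \<le> norm \<psi>"
    by metis
  have "bounded_linear t"
    by (rule bounded_linear_intro[of _ 1]) (auto intro!: ell2_eqI simp: coord_simps t)
  then have "\<exists>U :: 'i operator. \<forall>\<psi> i. coord (U \<psi>) i = coord \<psi> (\<pi> i)"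
    using t by (intro exI[of _ "Blinfun t"]) (simp add: bounded_linear_Blinfun_apply)
  from someI_ex[OF this] show ?thesis unfolding reindex_op_def by blast
qed

lemma has_kernel_reindex:
  assumes T: "has_kernel T K" and T': "has_kernel T' (\<lambda>i j. K (\<pi> i) (\<pi> j))" and \<pi>: "bij \<pi>"
  shows "reindex_op \<pi> (T \<psi>) = T' (reindex_op \<pi> \<psi>)"
proof (rule ell2_eqI)
  fix i
  note U = reindex_op[OF bij_is_inj[OF \<pi>]]
  have "coord (reindex_op \<pi> (T \<psi>)) i = (\<Sum>\<^sub>\<infinity>j. complex_of_real (K (\<pi> i) j) * coord \<psi> j)"
    using T by (simp add: U has_kernel_def)
  also have "\<dots> = (\<Sum>\<^sub>\<infinity>j. complex_of_real (K (\<pi> i) (\<pi> j)) * coord \<psi> (\<pi> j))"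
    by (rule infsum_reindex_bij_betw[OF \<pi>, symmetric])
  also have "\<dots> = coord (T' (reindex_op \<pi> \<psi>)) i"
    using T' by (simp add: U has_kernel_def)
  finally show "coord (reindex_op \<pi> (T \<psi>)) i = coord (T' (reindex_op \<pi> \<psi>)) i" .
qed

text \<open>Intertwining passes from T and T' to their polynomials and then to norm limits. The
  interval is taken large enough for both spectra, so the same polynomials approximate on both
  sides.\<close>

lemma fun_calc_intertwine:
  fixes U T T' :: "'i operator"
  assumes T: "selfadj T" "selfadj T'" and U: "clinear_op U" "\<And>f. U (T f) = T' (U f)"
    and g: "continuous_on UNIV g"
  shows "U (fun_calc g T f) = fun_calc g T' (U f)"
proof -
  define M where "M = max (norm T) (norm T')"
  have M: "norm T \<le> M" "norm T' \<le> M" by (auto simp: M_def)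
  obtain p where p: "uniform_limit {-M..M} (\<lambda>n x. poly (p n) (complex_of_real x)) g sequentially"
    using complex_poly_seq[OF g] .
  have e: "U (poly_op q T f) = poly_op q T' (U f)" for q f
  proof (induct q)
    case 0
    then show ?case by (simp add: blinfun.zero_right)
  next
    case (pCons a q)
    have "U (poly_op (pCons a q) T f) = scaleC a (U f) + U (T (poly_op q T f))"
      using U(1) by (simp add: poly_op_pCons_apply[OF selfadj_clinear[OF T(1)]] blinfun.add_right clinear_op_def)
    also have "\<dots> = poly_op (pCons a q) T' (U f)"
      using pCons by (simp add: poly_op_pCons_apply[OF selfadj_clinear[OF T(2)]] U(2))
    finally show ?case .
  qed
  have "(\<lambda>n. U (poly_op (p n) T f)) \<longlonglongrightarrow> U (fun_calc g T f)"
    by (intro bounded_linear.tendsto[OF blinfun.bounded_linear_right]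
        bounded_linear.tendsto[OF blinfun.bounded_linear_left] fun_calc_limit_Icc[OF T(1) M(1) g p])
  moreover have "(\<lambda>n. poly_op (p n) T' (U f)) \<longlonglongrightarrow> fun_calc g T' (U f)"
    by (intro bounded_linear.tendsto[OF blinfun.bounded_linear_left] fun_calc_limit_Icc[OF T(2) M(2) g p])
  ultimately show ?thesis unfolding e using LIMSEQ_unique by blast
qed

lemma fun_calc_diag_reindex:
  fixes \<pi> :: "'i \<Rightarrow> 'i"
  assumes T: "has_kernel T K" "schur_kernel K M" and T': "has_kernel T' (\<lambda>i j. K (\<pi> i) (\<pi> j))"
    and T'': "selfadj T'"
    and \<pi>: "bij \<pi>" and g: "continuous_on UNIV g"
  shows "coord (fun_calc g T (delta (\<pi> x))) (\<pi> x) = coord (fun_calc g T' (delta x)) x"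
proof -
  let ?U = "reindex_op \<pi>"
  note U = reindex_op[OF bij_is_inj[OF \<pi>]]
  have Ud: "?U (delta (\<pi> x)) = delta x"
    by (rule ell2_eqI) (use bij_is_inj[OF \<pi>] in \<open>auto simp: U coord_simps inj_eq\<close>)
  have "coord (fun_calc g T (delta (\<pi> x))) (\<pi> x) = coord (?U (fun_calc g T (delta (\<pi> x)))) x"
    by (simp add: U)
  also have "?U (fun_calc g T (delta (\<pi> x))) = fun_calc g T' (?U (delta (\<pi> x)))"
    by (rule fun_calc_intertwine[OF has_kernel_selfadj[OF T] T'' _ has_kernel_reindex[OF T(1) T' \<pi>] g])
       (auto simp: clinear_op_def U coord_simps intro!: ell2_eqI)
  finally show ?thesis by (simp add: Ud)
qed

section \<open>Diagonal entries of compressions\<close>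

lemma coord_power_delta_swap:
  assumes "selfadj T" shows "coord (op_power T k (delta x)) u = cnj (coord (op_power T k (delta u)) x)"
proof -
  have "coord (op_power T k (delta x)) u = cinner (op_power T k (delta u)) (delta x)"
    using selfadj_op_power[OF assms, of k] by (simp add: selfadj_def cinner_delta[symmetric])
  also have "\<dots> = cnj (coord (op_power T k (delta u)) x)"
    by (subst cinner_commute) (simp add: cinner_delta)
  finally show ?thesis .
qed

lemma selfadj_proj_op: "selfadj (proj_op S)"
  unfolding selfadj_def proj_op.rep_eq cinner_sums
  by (auto simp: coord_simps intro!: infsum_cong)

lemma norm_proj_op_le: "norm (proj_op S) \<le> 1"
proof (rule norm_blinfun_bound)
  show "norm (proj_op S f) \<le> 1 * norm f" for f
    using norm_ell2_le[of "restrict_ell2 S f" 1 f] by (simp add: proj_op.rep_eq restrict_ell2.rep_eq)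
qed simp

lemma selfadj_compress:
  assumes "selfadj T" shows "selfadj (proj_op S o\<^sub>L T o\<^sub>L proj_op S)"
  using assms selfadj_proj_op[of S] by (simp add: selfadj_def)

lemma norm_compress_le:
  assumes "norm T \<le> M" shows "norm (proj_op S o\<^sub>L T o\<^sub>L proj_op S) \<le> M"
proof -
  have "norm (proj_op S o\<^sub>L T o\<^sub>L proj_op S) \<le> norm (proj_op S o\<^sub>L T) * norm (proj_op S)"
    by (rule norm_blinfun_compose)
  also have "\<dots> \<le> (norm (proj_op S) * norm T) * norm (proj_op S)"
    by (intro mult_right_mono norm_blinfun_compose) auto
  also have "\<dots> \<le> (1 * norm T) * 1"
    by (intro mult_mono norm_proj_op_le) auto
  finally show ?thesis using assms by simp
qed

text \<open>One term of the telescoping expansion of \<open>A\<^sup>k P - P T\<^sup>k\<close> for the compression \<open>A = P T P\<close>.\<close>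

lemma compress_term_bound:
  fixes T :: "'i operator"
  assumes T: "selfadj T" "norm T \<le> M" and S: "finite S" and A: "A = proj_op S o\<^sub>L T o\<^sub>L proj_op S"
  shows "(\<Sum>x\<in>S. cmod (coord (op_power A j (proj_op S (T (op_power T m (delta x)
              - proj_op S (op_power T m (delta x)))))) x))
     \<le> M ^ j * M ^ m * (\<Sum>u\<in>S. norm (T (delta u) - proj_op S (T (delta u))))"
proof -
  let ?P = "proj_op S"
  \<comment> \<open>The part of the column T \<delta>_u that leaves S. By self-adjointness of T and
    of the projection, all dependence of the term on the outside of S goes through these
    vectors.\<close>
  define r where "r u = T (delta u) - ?P (T (delta u))" for u
  have P: "cinner (?P f) g = cinner f (?P g)" for f g
    using selfadj_proj_op[of S] by (simp add: selfadj_def)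
  have sT: "cinner (T f) g = cinner f (T g)" for f g using T by (simp add: selfadj_def)
  have sA: "selfadj A" unfolding A by (rule selfadj_compress[OF T(1)])
  have nA: "norm A \<le> M" unfolding A by (rule norm_compress_le[OF T(2)])
  have M: "0 \<le> M" using T(2) norm_ge_zero order_trans by blast
  have pt: "cmod (coord (op_power A j (?P (T (op_power T m (delta x) - ?P (op_power T m (delta x)))))) x)
      \<le> (\<Sum>u\<in>S. cmod (coord (op_power A j (delta u)) x) * cmod (coord (op_power T m (r u)) x))" for x
  proof -
    define y where "y = op_power T m (delta x)"
    define w where "w = ?P (T (y - ?P y))"
    have w: "coord w u = (if u \<in> S then cnj (coord (op_power T m (r u)) x) else 0)" for u
    proof -
      have "coord (T (y - ?P y)) u = cinner (T (delta u)) (y - ?P y)"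
        by (simp add: cinner_delta[symmetric] sT)
      also have "\<dots> = cinner (r u) y" by (simp add: r_def cinner_diff_left cinner_diff_right P)
      also have "\<dots> = cinner (op_power T m (r u)) (delta x)"
        using selfadj_op_power[OF T(1), of m] by (simp add: y_def selfadj_def)
      also have "\<dots> = cnj (coord (op_power T m (r u)) x)"
        by (subst cinner_commute) (simp add: cinner_delta)
      finally show ?thesis by (simp add: w_def proj_op.rep_eq coord_simps)
    qed
    have "coord (op_power A j w) x = cinner (op_power A j (delta x)) w"
      using selfadj_op_power[OF sA, of j] by (simp add: cinner_delta[symmetric] selfadj_def)
    also have "\<dots> = (\<Sum>\<^sub>\<infinity>u\<in>S. cnj (coord (op_power A j (delta x)) u) * coord w u)"
      unfolding cinner_sums by (rule infsum_cong_neutral) (auto simp: w)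
    also have "\<dots> = (\<Sum>u\<in>S. coord (op_power A j (delta u)) x * cnj (coord (op_power T m (r u)) x))"
      using S by (simp add: w) (subst coord_power_delta_swap[OF sA], simp)
    finally have "cmod (coord (op_power A j w) x)
        \<le> (\<Sum>u\<in>S. cmod (coord (op_power A j (delta u)) x * cnj (coord (op_power T m (r u)) x)))"
      by (simp add: norm_sum)
    then show ?thesis by (simp add: norm_mult w_def y_def)
  qed
  have "(\<Sum>x\<in>S. cmod (coord (op_power A j (?P (T (op_power T m (delta x) - ?P (op_power T m (delta x)))))) x))
     \<le> (\<Sum>x\<in>S. \<Sum>u\<in>S. cmod (coord (op_power A j (delta u)) x) * cmod (coord (op_power T m (r u)) x))"
    by (intro sum_mono pt)
  \<comment> \<open>With u as the outer variable, the sum over x pairs two vectors, so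
    Cauchy-Schwarz costs only their norms and no factor \<open>card S\<close>.\<close>
  also have "\<dots> = (\<Sum>u\<in>S. \<Sum>x\<in>S. cmod (coord (op_power A j (delta u)) x) * cmod (coord (op_power T m (r u)) x))"
    by (rule sum.swap)
  also have "\<dots> \<le> (\<Sum>u\<in>S. M ^ j * M ^ m * norm (r u))"
  proof (rule sum_mono)
    fix u
    have "norm (op_power A j (delta u)) \<le> M ^ j"
      using norm_blinfun[of "op_power A j" "delta u"] norm_op_power[OF nA, of j] by (simp add: norm_delta)
    moreover have "norm (op_power T m (r u)) \<le> M ^ m * norm (r u)"
      using norm_blinfun[of "op_power T m" "r u"] norm_op_power[OF T(2), of m]
      by (meson mult_right_mono norm_ge_zero order_trans)
    ultimately have "norm (op_power A j (delta u)) * norm (op_power T m (r u)) \<le> M ^ j * (M ^ m * norm (r u))"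
      using M by (intro mult_mono) auto
    then show "(\<Sum>x\<in>S. cmod (coord (op_power A j (delta u)) x) * cmod (coord (op_power T m (r u)) x))
        \<le> M ^ j * M ^ m * norm (r u)"
      using sum_cmod_mult_le_norm[OF S, of "op_power A j (delta u)" "op_power T m (r u)"]
      by (simp add: mult.assoc)
  qed
  finally show ?thesis by (simp add: r_def sum_distrib_left)
qed

text \<open>For x in S the two diagonal entries differ by that of A^k P - P T^k, whose telescoping
  expansion has k terms. Each is controlled by the leakage out of S and not by the size of
  S.\<close>

lemma compress_power_diag:
  fixes T :: "'i operator"
  assumes T: "selfadj T" "norm T \<le> M" and S: "finite S" and A: "A = proj_op S o\<^sub>L T o\<^sub>L proj_op S"
  shows "(\<Sum>x\<in>S. cmod (coord (op_power A k (delta x)) x - coord (op_power T k (delta x)) x))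
     \<le> real k * M ^ (k - 1) * (\<Sum>u\<in>S. norm (T (delta u) - proj_op S (T (delta u))))"
proof -
  let ?P = "proj_op S"
  let ?R = "\<Sum>u\<in>S. norm (T (delta u) - proj_op S (T (delta u)))"
  have tel: "op_power A k (?P f) - ?P (op_power T k f) =
     - (\<Sum>j<k. op_power A j (?P (T (op_power T (k - Suc j) f - ?P (op_power T (k - Suc j) f)))))" for f
  proof -
    \<comment> \<open>A^j P T^(k-j) interpolates between P T^k at j = 0 and A^k P at j = k;
      consecutive members differ by one factor P T (1 - P).\<close>
    let ?X = "\<lambda>j. op_power A j (?P (op_power T (k - j) f))"
    have PP: "?P (?P g) = ?P g" for g
      by (rule ell2_eqI) (simp add: proj_op.rep_eq coord_simps)
    have step: "?X (Suc j) - ?X j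
        = - op_power A j (?P (T (op_power T (k - Suc j) f - ?P (op_power T (k - Suc j) f))))"
      if "j < k" for j
    proof -
      have kj: "k - j = Suc (k - Suc j)" using that by simp
      have "A (?P (op_power T (k - Suc j) f)) = ?P (T (?P (op_power T (k - Suc j) f)))"
        by (simp add: A PP)
      then show ?thesis
        unfolding kj op_power_Suc2_apply[of A] op_power_Suc_apply[of T]
        by (simp add: blinfun.diff_right)
    qed
    have "op_power A k (?P f) - ?P (op_power T k f) = ?X k - ?X 0"
      by (simp add: id_blinfun.rep_eq)
    also have "\<dots> = (\<Sum>j<k. ?X (Suc j) - ?X j)" by (rule sum_lessThan_telescope[symmetric])
    also have "\<dots> = (\<Sum>j<k. - op_power A j (?P (T (op_power T (k - Suc j) f - ?P (op_power T (k - Suc j) f)))))"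
      by (intro sum.cong refl step) simp
    finally show ?thesis by (simp add: sum_negf)
  qed
  have "(\<Sum>x\<in>S. cmod (coord (op_power A k (delta x)) x - coord (op_power T k (delta x)) x))
      \<le> (\<Sum>x\<in>S. \<Sum>j<k. cmod (coord (op_power A j (?P (T (op_power T (k - Suc j) (delta x)
            - ?P (op_power T (k - Suc j) (delta x)))))) x))"
  proof (rule sum_mono)
    fix x assume x: "x \<in> S"
    have "?P (delta x) = delta x"
      by (rule ell2_eqI) (use x in \<open>auto simp: proj_op.rep_eq coord_simps\<close>)
    moreover have "coord (?P (op_power T k (delta x))) x = coord (op_power T k (delta x)) x"
      using x by (simp add: proj_op.rep_eq coord_simps)
    ultimately have "coord (op_power A k (delta x)) x - coord (op_power T k (delta x)) x
        = coord (op_power A k (?P (delta x)) - ?P (op_power T k (delta x))) x"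
      by (simp add: coord_diff)
    also have "cmod \<dots> \<le> (\<Sum>j<k. cmod (coord (op_power A j (?P (T (op_power T (k - Suc j) (delta x)
            - ?P (op_power T (k - Suc j) (delta x)))))) x))"
      unfolding tel by (simp add: coord_uminus coord_sum norm_sum)
    finally show "cmod (coord (op_power A k (delta x)) x - coord (op_power T k (delta x)) x)
      \<le> (\<Sum>j<k. cmod (coord (op_power A j (?P (T (op_power T (k - Suc j) (delta x)
            - ?P (op_power T (k - Suc j) (delta x)))))) x))" .
  qed
  also have "\<dots> = (\<Sum>j<k. \<Sum>x\<in>S. cmod (coord (op_power A j (?P (T (op_power T (k - Suc j) (delta x)
            - ?P (op_power T (k - Suc j) (delta x)))))) x))"
    by (rule sum.swap)
  also have "\<dots> \<le> (\<Sum>j<k. M ^ (k - 1) * ?R)"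
  proof (rule sum_mono)
    fix j assume "j \<in> {..<k}"
    then have e: "M ^ j * M ^ (k - Suc j) = M ^ (k - 1)" by (simp flip: power_add)
    show "(\<Sum>x\<in>S. cmod (coord (op_power A j (?P (T (op_power T (k - Suc j) (delta x)
            - ?P (op_power T (k - Suc j) (delta x)))))) x)) \<le> M ^ (k - 1) * ?R"
      using compress_term_bound[OF T S A, of j "k - Suc j"] unfolding e .
  qed
  finally show ?thesis by (simp add: mult.assoc)
qed

text \<open>The quantifier order matters: the constant depends only on p and M, hence is the same
  for all b and all L.\<close>

lemma compress_poly_diag:
  assumes "0 \<le> M"
  shows "\<exists>C\<ge>0. \<forall>(T :: 'i operator) (S :: 'i set). selfadj T \<longrightarrow> norm T \<le> M \<longrightarrow> finite S \<longrightarrow>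
    (\<Sum>x\<in>S. cmod (coord (poly_op p (proj_op S o\<^sub>L T o\<^sub>L proj_op S) (delta x)) x - coord (poly_op p T (delta x)) x))
     \<le> C * (\<Sum>u\<in>S. norm (T (delta u) - proj_op S (T (delta u))))"
proof (intro exI[of _ "\<Sum>k\<le>degree p. cmod (coeff p k) * (real k * M ^ (k - 1))"] conjI allI impI)
  show "0 \<le> (\<Sum>k\<le>degree p. cmod (coeff p k) * (real k * M ^ (k - 1)))"
    using assms by (intro sum_nonneg) auto
  fix T :: "'i operator" and S :: "'i set" assume T: "selfadj T" "norm T \<le> M" and S: "finite S"
  let ?A = "proj_op S o\<^sub>L T o\<^sub>L proj_op S"
  let ?R = "\<Sum>u\<in>S. norm (T (delta u) - proj_op S (T (delta u)))"
  let ?d = "\<lambda>k x. cmod (coord (op_power ?A k (delta x)) x - coord (op_power T k (delta x)) x)"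
  have "(\<Sum>x\<in>S. cmod (coord (poly_op p ?A (delta x)) x - coord (poly_op p T (delta x)) x))
      \<le> (\<Sum>x\<in>S. \<Sum>k\<le>degree p. cmod (coeff p k) * ?d k x)"
  proof (rule sum_mono)
    fix x
    have "coord (poly_op p ?A (delta x)) x - coord (poly_op p T (delta x)) x
      = (\<Sum>k\<le>degree p. coeff p k * (coord (op_power ?A k (delta x)) x - coord (op_power T k (delta x)) x))"
      by (simp add: poly_op_apply_le[OF order_refl] coord_sum scaleC.rep_eq right_diff_distrib sum_subtractf)
    also have "cmod \<dots> \<le> (\<Sum>k\<le>degree p. cmod (coeff p k) * ?d k x)"
      by (rule order_trans[OF norm_sum]) (simp add: norm_mult)
    finally show "cmod (coord (poly_op p ?A (delta x)) x - coord (poly_op p T (delta x)) x)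
      \<le> (\<Sum>k\<le>degree p. cmod (coeff p k) * ?d k x)" .
  qed
  also have "\<dots> = (\<Sum>k\<le>degree p. cmod (coeff p k) * (\<Sum>x\<in>S. ?d k x))"
    by (subst sum.swap) (simp add: sum_distrib_left)
  also have "\<dots> \<le> (\<Sum>k\<le>degree p. cmod (coeff p k) * (real k * M ^ (k - 1) * ?R))"
    by (intro sum_mono mult_left_mono compress_power_diag[OF T S refl]) auto
  finally show "(\<Sum>x\<in>S. cmod (coord (poly_op p ?A (delta x)) x - coord (poly_op p T (delta x)) x))
      \<le> (\<Sum>k\<le>degree p. cmod (coeff p k) * (real k * M ^ (k - 1))) * ?R"
    by (simp add: sum_distrib_right mult.assoc)
qed

section \<open>Equidistribution\<close>

lemma irrational_good_denominator:
  fixes \<alpha> :: real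
  assumes "\<alpha> \<notin> \<rat>"
  shows "\<exists>a q :: int. q \<ge> Q \<and> q > 0 \<and> coprime a q \<and> \<bar>\<alpha> - of_int a / of_int q\<bar> < 1 / (of_int q)\<^sup>2"
proof -
  have "infinite (approx_set \<alpha>)" using assms rational_iff_finite_approx_set by blast
  then obtain a q where "(a, q) \<in> approx_set \<alpha>" "q > Q" using infinite_approx_set by blast
  then show ?thesis by (intro exI[of _ a] exI[of _ q]) (auto simp: approx_set_def)
qed

lemma periodic_add_int:
  fixes F :: "real \<Rightarrow> 'a"
  assumes "\<And>x. F (x + p) = F x" shows "F (x + of_int n * p) = F x"
proof (induct n rule: int_induct[where k = 0])
  case (step1 n) then show ?case using assms[of "x + of_int n * p"] by (simp add: algebra_simps)
next
  case (step2 n) then show ?case using assms[of "x + of_int (n - 1) * p"] by (simp add: algebra_simps)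
qed simp

lemma periodic_reduce:
  assumes "0 < (p :: real)" obtains n :: int where "x + of_int n * p \<in> {0..p}"
proof -
  have "x + of_int (- \<lfloor>x / p\<rfloor>) * p \<in> {0..p}"
    using floor_divide_lower[OF assms, of x] floor_divide_upper[OF assms, of x] by (auto simp: algebra_simps)
  then show thesis by (rule that)
qed

lemma periodic_bounded:
  fixes F :: "real \<Rightarrow> 'a::real_normed_vector"
  assumes "continuous_on UNIV F" "0 < p" "\<And>x. F (x + p) = F x"
  obtains B where "0 \<le> B" "\<And>x. norm (F x) \<le> B"
proof -
  have "bounded (F ` {0..p})"
    by (intro compact_imp_bounded compact_continuous_image) (auto intro: continuous_on_subset[OF assms(1)])
  then obtain B where B: "0 < B" "\<And>x. x \<in> {0..p} \<Longrightarrow> norm (F x) \<le> B" by (force simp: bounded_pos)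
  have "norm (F x) \<le> B" for x
    using periodic_reduce[OF assms(2), of x] B(2) periodic_add_int[of F p x, OF assms(3)] by metis
  with B(1) show thesis by (intro that[of B]) auto
qed

lemma periodic_uniformly_continuous:
  fixes F :: "real \<Rightarrow> 'a::real_normed_vector"
  assumes F: "continuous_on UNIV F" "0 < p" "\<And>x. F (x + p) = F x" and e: "0 < e"
  obtains d where "0 < d" "\<And>x y. \<bar>x - y\<bar> < d \<Longrightarrow> norm (F x - F y) < e"
proof -
  \<comment> \<open>One period enlarged by a full period on both sides: once x is shifted into
    [0, p], any y closer to x than p remains in the interval after the same shift.\<close>
  have "uniformly_continuous_on {-p..2*p} F"
    by (intro compact_uniformly_continuous) (auto intro: continuous_on_subset[OF F(1)])
  then obtain d where d: "0 < d" "\<And>x y. x \<in> {-p..2*p} \<Longrightarrow> y \<in> {-p..2*p} \<Longrightarrow> dist y x < d \<Longrightarrow> dist (F y) (F x) < e"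
    unfolding uniformly_continuous_on_def using e by metis
  have "norm (F x - F y) < e" if xy: "\<bar>x - y\<bar> < min d p" for x y
  proof -
    obtain n :: int where n: "x + of_int n * p \<in> {0..p}" using periodic_reduce[OF F(2)] .
    have "dist (F (x + of_int n * p)) (F (y + of_int n * p)) < e"
      using n xy by (intro d(2)) (auto simp: dist_real_def)
    then show ?thesis by (simp add: dist_norm periodic_add_int[of F p, OF F(3)])
  qed
  then show thesis using d(1) F(2) by (intro that[of "min d p"]) auto
qed

lemma riemann_sum_bound:
  fixes F :: "real \<Rightarrow> 'a::{real_normed_vector, banach}"
  assumes F: "continuous_on UNIV F" and w: "0 < w" and e: "\<And>x y. \<bar>x - y\<bar> \<le> w \<Longrightarrow> norm (F x - F y) \<le> e"
  shows "norm ((\<Sum>r<q. w *\<^sub>R F (of_nat r * w)) - integral {0..of_nat q * w} F) \<le> of_nat q * (w * e)"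
proof (induct q)
  case (Suc q)
  have c: "continuous_on A F" for A using F by (rule continuous_on_subset) auto
  have int: "F integrable_on {a..b}" for a b by (rule integrable_continuous_real[OF c])
  let ?a = "of_nat q * w" and ?b = "of_nat (Suc q) * w"
  have ab: "0 \<le> ?a" "?a \<le> ?b" using w by (auto simp: mult_right_mono)
  have split: "integral {0..?b} F = integral {0..?a} F + integral {?a..?b} F"
    by (rule Henstock_Kurzweil_Integration.integral_combine[symmetric]) (use ab int in auto)
  have "norm (integral {?a..?b} (\<lambda>x. F ?a - F x)) \<le> e * (?b - ?a)"
    by (rule integral_bound) (use ab w in \<open>auto intro!: continuous_intros c e simp: algebra_simps\<close>)
  also have "integral {?a..?b} (\<lambda>x. F ?a - F x) = w *\<^sub>R F ?a - integral {?a..?b} F"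
    using ab int by (subst Henstock_Kurzweil_Integration.integral_diff) (auto simp: algebra_simps)
  finally have "norm (w *\<^sub>R F ?a - integral {?a..?b} F) \<le> w * e" by (simp add: algebra_simps)
  then have "norm (((\<Sum>r<q. w *\<^sub>R F (of_nat r * w)) - integral {0..?a} F) + (w *\<^sub>R F ?a - integral {?a..?b} F))
     \<le> of_nat q * (w * e) + w * e"
    using Suc by (intro order_trans[OF norm_triangle_ineq] add_mono)
  then show ?case unfolding split by (simp add: algebra_simps)
qed simp

text \<open>For a convergent \<open>a/q\<close> of \<open>s/p\<close> the points \<open>c + j s\<close>, \<open>j < q\<close>, are, modulo \<open>p\<close> and up to
  \<open>2p/q\<close>, a permutation of the grid \<open>r p/q\<close>, \<open>r < q\<close>.\<close>

lemma equidistribution_block: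
  fixes F :: "real \<Rightarrow> 'a::{real_normed_vector, banach}"
  assumes F: "continuous_on UNIV F" and p: "0 < p" and per: "\<And>x. F (x + p) = F x"
    and irr: "s / p \<notin> \<rat>" and e: "0 < e"
  obtains q :: nat where "q > 0"
    "\<And>c. norm ((\<Sum>j<q. F (c + s * of_nat j)) - (of_nat q / p) *\<^sub>R integral {0..p} F) \<le> e * of_nat q"
proof -
  obtain d where d: "0 < d" "\<And>x y. \<bar>x - y\<bar> < d \<Longrightarrow> norm (F x - F y) < e / 2"
    using periodic_uniformly_continuous[OF F p per, of "e/2"] e by auto
  \<comment> \<open>The lower bound on the denominator makes two grid steps 2p/q smaller than the
    modulus of continuity d.\<close>
  obtain a q' :: int where q': "q' \<ge> \<lceil>2 * p / d\<rceil> + 1" "q' > 0" "coprime a q'"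
    "\<bar>s / p - of_int a / of_int q'\<bar> < 1 / (of_int q')\<^sup>2"
    using irrational_good_denominator[OF irr] by blast
  define q where "q = nat q'"
  have q: "q > 0" "int q = q'" "real_of_int q' = real q" using q' by (auto simp: q_def)
  have "2 * p / d < real q" using q'(1) q(3) by linarith
  then have mesh: "2 * p / real q < d" using d(1) q(1) by (simp add: field_simps)
  define w where "w = p / real q"
  have w: "0 < w" "real q * w = p" "2 * w < d" using p q(1) mesh by (auto simp: w_def)
  have block: "norm ((\<Sum>j<q. F (c + s * of_nat j)) - (\<Sum>r<q. F (of_nat r * w))) \<le> real q * (e / 2)" for c
  proof -
    \<comment> \<open>c lies in the k-th grid cell. Replacing c by k w and s by a w turns the orbit
      into k + a j modulo q, a permutation of the residues because a and q are coprime.\<close>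
    define k where "k = \<lfloor>c / w\<rfloor>"
    define \<pi> where "\<pi> j = nat ((k + a * int j) mod int q)" for j
    have inj: "inj_on \<pi> {..<q}"
    proof (rule inj_onI)
      fix i j assume ij: "i \<in> {..<q}" "j \<in> {..<q}" "\<pi> i = \<pi> j"
      then have "(k + a * int i) mod int q = (k + a * int j) mod int q"
        using q(1) by (simp add: \<pi>_def nat_eq_iff2 eq_nat_nat_iff)
      then have "int q dvd (k + a * int i) - (k + a * int j)" by (rule mod_eq_dvd_iff[THEN iffD1])
      then have "int q dvd a * (int i - int j)" by (simp add: algebra_simps)
      then have "int q dvd int i - int j"
        using q'(3) q(2) by (simp add: coprime_dvd_mult_right_iff coprime_commute)
      moreover have "\<bar>int i - int j\<bar> < int q" using ij(1,2) by auto
      ultimately show "i = j" using dvd_imp_le_int[of "int i - int j" "int q"] by fastforce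
    qed
    have "\<pi> ` {..<q} \<subseteq> {..<q}" using q(1) by (auto simp: \<pi>_def nat_less_iff)
    then have im: "\<pi> ` {..<q} = {..<q}" using inj by (simp add: endo_inj_surj)
    have "(\<Sum>r<q. F (of_nat r * w)) = (\<Sum>r\<in>\<pi> ` {..<q}. F (of_nat r * w))" by (simp add: im)
    also have "\<dots> = (\<Sum>j<q. F (of_nat (\<pi> j) * w))" by (rule sum.reindex[OF inj, unfolded o_def])
    finally have eq: "(\<Sum>r<q. F (of_nat r * w)) = (\<Sum>j<q. F (of_nat (\<pi> j) * w))" .
    have close: "norm (F (c + s * of_nat j) - F (of_nat (\<pi> j) * w)) \<le> e / 2" if j: "j < q" for j
    proof -
      define l where "l = (k + a * int j) div int q"
      have "int (\<pi> j) = k + a * int j - int q * l"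
        using q(1) by (simp add: \<pi>_def l_def minus_mult_div_eq_mod)
      then have "real (\<pi> j) = of_int k + of_int a * real j - real q * of_int l"
        by (metis of_int_add of_int_diff of_int_mult of_int_of_nat_eq)
      then have "real (\<pi> j) * w = (of_int k + of_int a * real j) * w - of_int l * (real q * w)"
        by (simp only: left_diff_distrib) (simp add: mult_ac)
      then have "real (\<pi> j) * w = (of_int k + of_int a * real j) * w + of_int (- l) * p"
        by (simp add: w(2))
      then have red: "F (real (\<pi> j) * w) = F ((of_int k + of_int a * real j) * w)"
        by (simp only: periodic_add_int[of F p, OF per])
      have 1: "\<bar>c - of_int k * w\<bar> \<le> w"
      proof -
        have "of_int k \<le> c / w" "c / w < of_int k + 1" unfolding k_def by linarith+
        then show ?thesis using w(1) by (auto simp: field_simps abs_le_iff)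
      qed
      \<comment> \<open>Here the quadratic quality of the rational approximation enters: after j < q
        steps the accumulated error is below p q / q^2, one grid step.\<close>
      have 2: "\<bar>s * real j - of_int a * real j * w\<bar> < w"
      proof -
        have "s * real j - of_int a * real j * w = p * real j * (s / p - of_int a / of_int q')"
          using p q by (simp add: w_def field_simps)
        then have "\<bar>s * real j - of_int a * real j * w\<bar> = p * real j * \<bar>s / p - of_int a / of_int q'\<bar>"
          using p by (simp add: abs_mult)
        also have "\<dots> \<le> p * real q * \<bar>s / p - of_int a / of_int q'\<bar>"
          using j p by (intro mult_right_mono mult_left_mono) auto
        also have "\<dots> < p * real q * (1 / (of_int q')\<^sup>2)"
          using q' p q(1) by (intro mult_strict_left_mono) auto
        also have "\<dots> = w" using q by (simp add: w_def power2_eq_square)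
        finally show ?thesis .
      qed
      have "(c + s * real j) - (of_int k + of_int a * real j) * w
          = (c - of_int k * w) + (s * real j - of_int a * real j * w)" by (simp add: algebra_simps)
      then have "\<bar>(c + s * real j) - (of_int k + of_int a * real j) * w\<bar> < d" using 1 2 w(3) by linarith
      then show ?thesis unfolding red using d(2) less_imp_le by blast
    qed
    have "norm ((\<Sum>j<q. F (c + s * of_nat j)) - (\<Sum>r<q. F (of_nat r * w)))
        \<le> (\<Sum>j<q. norm (F (c + s * of_nat j) - F (of_nat (\<pi> j) * w)))"
      unfolding eq sum_subtractf[symmetric] by (rule norm_sum)
    also have "\<dots> \<le> (\<Sum>j<q. e / 2)" by (rule sum_mono) (use close in auto)
    finally show ?thesis by simp
  qed
  have grid: "norm ((\<Sum>r<q. F (of_nat r * w)) - (of_nat q / p) *\<^sub>R integral {0..p} F) \<le> real q * (e / 2)"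
  proof -
    have "norm ((\<Sum>r<q. w *\<^sub>R F (of_nat r * w)) - integral {0..of_nat q * w} F) \<le> of_nat q * (w * (e / 2))"
      by (rule riemann_sum_bound[OF F w(1)]) (use d(2) w in \<open>auto intro!: less_imp_le\<close>)
    then have "norm (w *\<^sub>R ((\<Sum>r<q. F (of_nat r * w)) - (1 / w) *\<^sub>R integral {0..p} F)) \<le> w * (real q * (e / 2))"
      using w by (simp add: scaleR_diff_right scaleR_sum_right mult_ac)
    then have "norm ((\<Sum>r<q. F (of_nat r * w)) - (1 / w) *\<^sub>R integral {0..p} F) \<le> real q * (e / 2)"
      using w(1) by simp
    then show ?thesis by (simp add: w_def)
  qed
  have "norm ((\<Sum>j<q. F (c + s * of_nat j)) - (of_nat q / p) *\<^sub>R integral {0..p} F) \<le> e * of_nat q" for c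
    using norm_triangle_ineq[of "(\<Sum>j<q. F (c + s * of_nat j)) - (\<Sum>r<q. F (of_nat r * w))"
        "(\<Sum>r<q. F (of_nat r * w)) - (of_nat q / p) *\<^sub>R integral {0..p} F"] block[of c] grid
    by (simp add: algebra_simps)
  then show thesis using q(1) that by blast
qed

text \<open>N points are cut into blocks of length q and a remainder of fewer than q points, which
  is negligible once N is at least 2 q (B + norm I) / e. The block estimate holds for every starting
  point, so \<open>D\<close> does not depend on c.\<close>

lemma equidistribution:
  fixes F :: "real \<Rightarrow> 'a::{real_normed_vector, banach}"
  assumes F: "continuous_on UNIV F" and p: "0 < p" and per: "\<And>x. F (x + p) = F x"
    and irr: "s / p \<notin> \<rat>" and e: "0 < e"
  obtains D where "\<And>N c. real N \<ge> D \<Longrightarrow>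
    norm ((\<Sum>j<N. F (c + s * of_nat j)) - (of_nat N / p) *\<^sub>R integral {0..p} F) \<le> e * of_nat N"
proof -
  define I where "I = (1 / p) *\<^sub>R integral {0..p} F"
  have e2: "0 < e / 2" using e by simp
  obtain q :: nat where q: "q > 0"
    "\<And>c. norm ((\<Sum>j<q. F (c + s * of_nat j)) - (of_nat q / p) *\<^sub>R integral {0..p} F) \<le> e / 2 * of_nat q"
    using equidistribution_block[OF F p per irr e2] by blast
  obtain B where B: "0 \<le> B" "\<And>x. norm (F x) \<le> B" using periodic_bounded[OF F p per] by blast
  have "norm ((\<Sum>j<N. F (c + s * of_nat j)) - (of_nat N / p) *\<^sub>R integral {0..p} F) \<le> e * of_nat N"
    if N: "real N \<ge> 2 * real q * (B + norm I) / e" for N c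
  proof -
    let ?f = "\<lambda>j. F (c + s * of_nat j) - I"
    define m where "m = N div q"
    have mq: "m * q \<le> N" "N - m * q < q" using q(1) by (auto simp: m_def minus_div_mult_eq_mod)
    have "(\<Sum>j<N. F (c + s * of_nat j)) - (of_nat N / p) *\<^sub>R integral {0..p} F = (\<Sum>j<N. ?f j)"
      by (simp add: sum_subtractf I_def sum_constant_scaleR)
    also have "\<dots> = (\<Sum>j<m * q. ?f j) + (\<Sum>j=m * q..<N. ?f j)"
      using mq(1) by (simp add: lessThan_atLeast0 sum.atLeastLessThan_concat)
    also have "(\<Sum>j<m * q. ?f j) = (\<Sum>i<m. \<Sum>j<q. F ((c + s * of_nat (i * q)) + s * of_nat j) - I)"
    proof -
      have "(\<Sum>j<m * q. ?f j) = (\<Sum>i<m. sum ?f {i * q..<i * q + q})" by (rule sum.nat_group[symmetric])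
      also have "\<dots> = (\<Sum>i<m. \<Sum>j<q. ?f (j + i * q))"
        using sum.shift_bounds_nat_ivl[of ?f 0 "_ * q" q]
        by (simp add: lessThan_atLeast0 add.commute)
      finally show ?thesis by (simp add: algebra_simps)
    qed
    finally have eq: "(\<Sum>j<N. F (c + s * of_nat j)) - (of_nat N / p) *\<^sub>R integral {0..p} F
      = (\<Sum>i<m. \<Sum>j<q. F ((c + s * of_nat (i * q)) + s * of_nat j) - I) + (\<Sum>j=m * q..<N. ?f j)" .
    have "norm (\<Sum>i<m. \<Sum>j<q. F ((c + s * of_nat (i * q)) + s * of_nat j) - I) \<le> (\<Sum>i<m. e / 2 * of_nat q)"
      by (rule sum_norm_le)
         (use q(2) in \<open>simp add: sum_subtractf I_def sum_constant_scaleR\<close>)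
    also have "\<dots> = e / 2 * real (m * q)" by simp
    also have "\<dots> \<le> e / 2 * real N" using mq(1) e by (intro mult_left_mono) (auto simp flip: of_nat_mult)
    finally have 1: "norm (\<Sum>i<m. \<Sum>j<q. F ((c + s * of_nat (i * q)) + s * of_nat j) - I) \<le> e / 2 * real N" .
    have "norm (\<Sum>j=m * q..<N. ?f j) \<le> (\<Sum>j=m * q..<N. B + norm I)"
      by (rule sum_norm_le) (rule order_trans[OF norm_triangle_ineq4 add_right_mono[OF B(2)]])
    also have "\<dots> \<le> real q * (B + norm I)"
      using mq(2) B(1) by (simp add: mult_right_mono)
    also have "\<dots> \<le> e / 2 * real N" using N e by (simp add: field_simps)
    finally have 2: "norm (\<Sum>j=m * q..<N. ?f j) \<le> e / 2 * real N" .
    show ?thesis unfolding eq using norm_triangle_le[OF add_mono[OF 1 2]] by simp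
  qed
  then show thesis by (rule that)
qed

lemma int_interval_eq: "{n :: int. A \<le> real_of_int n \<and> real_of_int n \<le> B} = {\<lceil>A\<rceil>..\<lfloor>B\<rfloor>}"
  by (auto simp: ceiling_le_iff le_floor_iff)

text \<open>The first summation index is the ceiling of A L and moves with L; the uniformity in c of
  \<open>equidistribution\<close> absorbs this. The number of integers in the interval differs from
  its length by at most 1.\<close>

lemma equidistribution_interval:
  fixes F :: "real \<Rightarrow> 'a::{real_normed_vector, banach}"
  assumes F: "continuous_on UNIV F" and p: "0 < p" and per: "\<And>x. F (x + p) = F x"
    and irr: "s / p \<notin> \<rat>" and lim: "filterlim (\<lambda>L. B L - A L) at_top G"
  shows "((\<lambda>L. (\<Sum>n\<in>{n. A L \<le> real_of_int n \<and> real_of_int n \<le> B L}. F (c + s * of_int n)) /\<^sub>R (B L - A L))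
     \<longlongrightarrow> (1 / p) *\<^sub>R integral {0..p} F) G"
proof (rule tendstoI)
  fix e :: real assume e: "0 < e"
  define I where "I = (1 / p) *\<^sub>R integral {0..p} F"
  obtain D where D: "\<And>N c. real N \<ge> D \<Longrightarrow>
    norm ((\<Sum>j<N. F (c + s * of_nat j)) - (of_nat N / p) *\<^sub>R integral {0..p} F) \<le> e / 4 * of_nat N"
    using equidistribution[OF F p per irr, of "e/4"] e by auto
  \<comment> \<open>D + 1 guarantees at least D summands, and 2 norm I / e + 1 makes the discrepancy
    between their number and the length cost less than half of the permitted error.\<close>
  have "\<forall>\<^sub>F L in G. max (max (D + 1) 1) (2 * norm I / e + 1) \<le> B L - A L"
    using lim unfolding filterlim_at_top by blast
  then show "\<forall>\<^sub>F L in G. dist ((\<Sum>n\<in>{n. A L \<le> real_of_int n \<and> real_of_int n \<le> B L}. F (c + s * of_int n)) /\<^sub>R (B L - A L))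
     ((1 / p) *\<^sub>R integral {0..p} F) < e"
  proof eventually_elim
    case (elim L)
    define N where "N = nat (\<lfloor>B L\<rfloor> - \<lceil>A L\<rceil> + 1)"
    define l where "l = B L - A L"
    have l: "D + 1 \<le> l" "1 \<le> l" "2 * norm I / e + 1 \<le> l" using elim by (auto simp: l_def)
    have bd: "\<lfloor>B L\<rfloor> - \<lceil>A L\<rceil> + 1 \<ge> 0" "\<bar>of_int (\<lfloor>B L\<rfloor> - \<lceil>A L\<rceil> + 1) - l\<bar> \<le> 1"
      using l unfolding l_def by linarith+
    then have N: "\<bar>real N - l\<bar> \<le> 1" unfolding N_def by (simp only: of_nat_nat)
    have sum: "(\<Sum>n\<in>{n. A L \<le> real_of_int n \<and> real_of_int n \<le> B L}. F (c + s * of_int n))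
        = (\<Sum>j<N. F ((c + s * of_int \<lceil>A L\<rceil>) + s * of_nat j))"
    proof -
      have "bij_betw (\<lambda>j. \<lceil>A L\<rceil> + int j) {..<N} {\<lceil>A L\<rceil>..\<lfloor>B L\<rfloor>}"
        by (rule bij_betw_byWitness[where f' = "\<lambda>n. nat (n - \<lceil>A L\<rceil>)"]) (auto simp: N_def)
      from sum.reindex_bij_betw[OF this, of "\<lambda>n. F (c + s * of_int n)"]
      show ?thesis unfolding int_interval_eq by (simp add: algebra_simps)
    qed
    let ?S = "\<Sum>j<N. F ((c + s * of_int \<lceil>A L\<rceil>) + s * of_nat j)"
    have "norm (?S - real N *\<^sub>R I) \<le> e / 4 * real N"
      using D[of N "c + s * of_int \<lceil>A L\<rceil>"] N l(1) by (simp add: I_def)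
    also have "\<dots> \<le> e / 4 * (2 * l)" using N l(2) e by (intro mult_left_mono) auto
    finally have 1: "norm (?S - real N *\<^sub>R I) \<le> e / 2 * l" by simp
    have "norm (real N *\<^sub>R I - l *\<^sub>R I) = \<bar>real N - l\<bar> * norm I"
      by (simp flip: scaleR_diff_left)
    also have "\<dots> \<le> 1 * norm I" using N by (intro mult_right_mono) auto
    also have "\<dots> < e / 2 * l" using l(3) e by (simp add: field_simps)
    finally have "norm (?S - l *\<^sub>R I) < e * l"
      using 1 norm_triangle_ineq[of "?S - real N *\<^sub>R I" "real N *\<^sub>R I - l *\<^sub>R I"] by simp
    moreover have "?S /\<^sub>R l - I = (?S - l *\<^sub>R I) /\<^sub>R l" using l(2) by (simp add: scaleR_diff_right)
    moreover have "norm ((?S - l *\<^sub>R I) /\<^sub>R l) = norm (?S - l *\<^sub>R I) / l"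
      using l(2) by (simp only: norm_scaleR) (simp add: divide_inverse mult.commute)
    ultimately have "norm (?S /\<^sub>R l - I) < e"
      using l(2) by (simp only: pos_divide_less_eq)
    then show ?case unfolding sum by (simp add: dist_norm I_def l_def)
  qed
qed

section \<open>Riesz representation on the line\<close>

text \<open>A unital functional bounded by the supremum norm is positive. For real s the functions i
  s + u have modulus at most sqrt (s^2 + 1), and the resulting inequality 2 s Im \<le> 1 for all s
  forces Im = 0. Since u - 1/2 is at most 1/2 in modulus, the value lies within 1/2 of 1/2.\<close>

lemma state_nonneg:
  fixes \<Lambda> :: "(real \<Rightarrow> complex) \<Rightarrow> complex"
  assumes add: "\<And>f g. continuous_on UNIV f \<Longrightarrow> continuous_on UNIV g \<Longrightarrow> \<Lambda> (\<lambda>x. f x + g x) = \<Lambda> f + \<Lambda> g"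
    and mult: "\<And>c f. continuous_on UNIV f \<Longrightarrow> \<Lambda> (\<lambda>x. c * f x) = c * \<Lambda> f"
    and one: "\<Lambda> (\<lambda>_. 1) = 1"
    and bd: "\<And>f e. continuous_on UNIV f \<Longrightarrow> (\<And>x. x \<in> {-M..M} \<Longrightarrow> cmod (f x) \<le> e) \<Longrightarrow> cmod (\<Lambda> f) \<le> e"
    and u: "continuous_on UNIV u" "\<And>x. x \<in> {-M..M} \<Longrightarrow> 0 \<le> u x" "\<And>x. x \<in> {-M..M} \<Longrightarrow> u x \<le> (1 :: real)"
  shows "Im (\<Lambda> (\<lambda>x. complex_of_real (u x))) = 0" "0 \<le> Re (\<Lambda> (\<lambda>x. complex_of_real (u x)))"
proof -
  let ?l = "\<Lambda> (\<lambda>x. complex_of_real (u x))"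
  have cu: "continuous_on UNIV (\<lambda>x. complex_of_real (u x))" by (intro continuous_intros u(1))
  have shift: "\<Lambda> (\<lambda>x. c + complex_of_real (u x)) = c + ?l" for c
    using add[of "\<lambda>_. c" "\<lambda>x. complex_of_real (u x)"] mult[of "\<lambda>_. 1" c] one cu by simp
  have im: "2 * s * Im ?l \<le> 1" for s
  proof -
    have "cmod (\<i> * complex_of_real s + ?l) \<le> sqrt (s\<^sup>2 + 1)"
      unfolding shift[symmetric]
    proof (rule bd)
      show "cmod (\<i> * complex_of_real s + complex_of_real (u x)) \<le> sqrt (s\<^sup>2 + 1)" if "x \<in> {-M..M}" for x
        using u(2,3)[OF that] by (simp add: cmod_def abs_square_le_1[symmetric] power_le_one)
    qed (intro continuous_intros u(1))
    then have "(cmod (\<i> * complex_of_real s + ?l))\<^sup>2 \<le> (sqrt (s\<^sup>2 + 1))\<^sup>2" by (intro power_mono) auto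
    then have "(Re ?l)\<^sup>2 + (s + Im ?l)\<^sup>2 \<le> s\<^sup>2 + 1" by (simp add: cmod_power2)
    moreover have "(s + Im ?l)\<^sup>2 = s\<^sup>2 + 2 * s * Im ?l + (Im ?l)\<^sup>2" by (simp add: power2_sum)
    ultimately show ?thesis using zero_le_power2[of "Re ?l"] zero_le_power2[of "Im ?l"] by linarith
  qed
  show "Im ?l = 0"
  proof (rule ccontr)
    assume "Im ?l \<noteq> 0" then show False using im[of "1 / Im ?l"] by simp
  qed
  have "cmod (-1/2 + ?l) \<le> 1/2"
    unfolding shift[symmetric]
  proof (rule bd)
    show "cmod (-1/2 + complex_of_real (u x)) \<le> 1/2" if "x \<in> {-M..M}" for x
    proof -
      have "-1/2 + complex_of_real (u x) = complex_of_real (u x - 1/2)" by simp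
      then show ?thesis using u(2,3)[OF that] by (simp only: norm_of_real)
    qed
  qed (intro continuous_intros u(1))
  then show "0 \<le> Re ?l" using abs_Re_le_cmod[of "-1/2 + ?l"] by simp
qed

lemma Bernstein_Weierstrass_complex:
  fixes g :: "real \<Rightarrow> complex"
  assumes g: "continuous_on {0..1} g" and e: "0 < e"
  shows "\<exists>N. \<forall>n\<ge>N. \<forall>x\<in>{0..1}.
     cmod (g x - (\<Sum>k\<le>n. g (real k / real n) * complex_of_real (Bernstein n k x))) \<le> e"
proof -
  have "continuous_on {0..1} (\<lambda>x. Re (g x))" "continuous_on {0..1} (\<lambda>x. Im (g x))"
    by (auto intro: continuous_intros g)
  note BW = this[THEN Bernstein_Weierstrass, OF half_gt_zero[OF e]]
  obtain N1 where N1: "\<And>n x. N1 \<le> n \<Longrightarrow> x \<in> {0..1} \<Longrightarrow>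
      \<bar>Re (g x) - (\<Sum>k\<le>n. Re (g (k/n)) * Bernstein n k x)\<bar> < e/2"
    using BW(1) by blast
  obtain N2 where N2: "\<And>n x. N2 \<le> n \<Longrightarrow> x \<in> {0..1} \<Longrightarrow>
      \<bar>Im (g x) - (\<Sum>k\<le>n. Im (g (k/n)) * Bernstein n k x)\<bar> < e/2"
    using BW(2) by blast
  have "cmod (g x - (\<Sum>k\<le>n. g (real k / real n) * complex_of_real (Bernstein n k x))) \<le> e"
    if "n \<ge> max N1 N2" "x \<in> {0..1}" for n x
  proof -
    let ?z = "g x - (\<Sum>k\<le>n. g (real k / real n) * complex_of_real (Bernstein n k x))"
    have "cmod ?z \<le> \<bar>Re ?z\<bar> + \<bar>Im ?z\<bar>" by (rule cmod_le)
    also have "\<dots> \<le> e/2 + e/2"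
      using N1[of n x] N2[of n x] that by (intro add_mono) auto
    finally show ?thesis by simp
  qed
  then show ?thesis by blast
qed

text \<open>The functional is represented as a weak limit of discrete
  measures whose weights are its values on the Bernstein polynomials.\<close>

lemma state_representation:
  fixes \<Lambda> :: "(real \<Rightarrow> complex) \<Rightarrow> complex"
  assumes add: "\<And>f g. continuous_on UNIV f \<Longrightarrow> continuous_on UNIV g \<Longrightarrow> \<Lambda> (\<lambda>x. f x + g x) = \<Lambda> f + \<Lambda> g"
    and mult: "\<And>c f. continuous_on UNIV f \<Longrightarrow> \<Lambda> (\<lambda>x. c * f x) = c * \<Lambda> f"
    and one: "\<Lambda> (\<lambda>_. 1) = 1" and M: "0 < M"
    and bd: "\<And>f e. continuous_on UNIV f \<Longrightarrow> (\<And>x. x \<in> {-M..M} \<Longrightarrow> cmod (f x) \<le> e) \<Longrightarrow> cmod (\<Lambda> f) \<le> e"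
  shows "\<exists>\<mu>. real_distribution \<mu> \<and>
    (\<forall>g B. continuous_on UNIV g \<longrightarrow> (\<forall>x. cmod (g x) \<le> B) \<longrightarrow> (LINT x|\<mu>. g x) = \<Lambda> g)"
proof -
  define b where "b n k x = Bernstein n k ((x + M) / (2 * M))" for n k x
  define node where "node n k = 2 * M * (real k / real n) - M" for n k
  define w where "w n k = (if k \<le> n then Re (\<Lambda> (\<lambda>x. complex_of_real (b n k x))) else 0)" for n k
  have cb: "continuous_on UNIV (b n k)" for n k
    unfolding b_def Bernstein_def using M by (intro continuous_intros) auto
  have cbc: "continuous_on UNIV (\<lambda>x. complex_of_real (b n k x))" for n k
    by (intro continuous_intros cb)
  have unit: "(x + M) / (2 * M) \<in> {0..1}" if "x \<in> {-M..M}" for x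
    using that M by (auto simp: field_simps)
  have b0: "0 \<le> b n k x" if "x \<in> {-M..M}" for n k x
    using unit[OF that] by (auto simp: b_def intro: Bernstein_nonneg)
  have b1: "b n k x \<le> 1" if "x \<in> {-M..M}" "k \<le> n" for n k x
  proof -
    have "b n k x \<le> (\<Sum>k\<le>n. b n k x)"
      by (rule member_le_sum) (use that b0 in auto)
    then show ?thesis by (simp add: b_def)
  qed
  have w: "\<Lambda> (\<lambda>x. complex_of_real (b n k x)) = complex_of_real (w n k)" "0 \<le> w n k" if k: "k \<le> n" for n k
  proof -
    have im: "Im (\<Lambda> (\<lambda>x. complex_of_real (b n k x))) = 0"
      by (rule state_nonneg(1)[of \<Lambda> M]; (rule add mult one bd cb b0 b1[OF _ k])?; assumption?)
    have re: "0 \<le> Re (\<Lambda> (\<lambda>x. complex_of_real (b n k x)))"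
      by (rule state_nonneg(2)[of \<Lambda> M]; (rule add mult one bd cb b0 b1[OF _ k])?; assumption?)
    show "\<Lambda> (\<lambda>x. complex_of_real (b n k x)) = complex_of_real (w n k)" "0 \<le> w n k"
      using im re k by (simp_all add: w_def complex_eq_iff)
  qed
  have w0: "0 \<le> w n k" for n k using w(2) by (cases "k \<le> n") (auto simp: w_def)
  have \<Lambda>sum: "\<Lambda> (\<lambda>x. \<Sum>k\<in>A. c k * complex_of_real (b n k x)) = (\<Sum>k\<in>A. c k * \<Lambda> (\<lambda>x. complex_of_real (b n k x)))"
    if "finite A" for A c n
    using that
  proof (induct A)
    case empty
    show ?case using mult[of "\<lambda>_. 1" 0] by simp
  next
    case (insert k A)
    have "\<Lambda> (\<lambda>x. c k * complex_of_real (b n k x) + (\<Sum>k\<in>A. c k * complex_of_real (b n k x)))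
        = \<Lambda> (\<lambda>x. c k * complex_of_real (b n k x)) + \<Lambda> (\<lambda>x. \<Sum>k\<in>A. c k * complex_of_real (b n k x))"
      by (rule add) (intro continuous_intros cb)+
    then show ?case using insert mult[OF cbc] by simp
  qed
  have wsum: "(\<Sum>k\<le>n. w n k) = 1" for n
  proof -
    have "complex_of_real (\<Sum>k\<le>n. w n k) = (\<Sum>k\<le>n. \<Lambda> (\<lambda>x. complex_of_real (b n k x)))"
      by (simp add: w(1))
    also have "\<dots> = \<Lambda> (\<lambda>x. \<Sum>k\<le>n. 1 * complex_of_real (b n k x))" by (subst \<Lambda>sum) auto
    also have "(\<lambda>x. \<Sum>k\<le>n. 1 * complex_of_real (b n k x)) = (\<lambda>_. 1)"
      by (simp add: b_def flip: of_real_sum)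
    finally show ?thesis using one by (simp only: of_real_eq_1_iff)
  qed
  define P where "P n = embed_pmf (w n)" for n
  have pmfP: "pmf (P n) k = w n k" for n k
    unfolding P_def
  proof (rule pmf_embed_pmf[OF w0])
    have "(\<integral>\<^sup>+ k. ennreal (w n k) \<partial>count_space UNIV) = (\<Sum>k\<le>n. ennreal (w n k))"
      by (rule nn_integral_count_space'[of "{..n}"]) (auto simp: w_def)
    also have "\<dots> = 1" by (subst sum_ennreal) (auto simp: w0 wsum)
    finally show "(\<integral>\<^sup>+ k. ennreal (w n k) \<partial>count_space UNIV) = 1" .
  qed
  have setP: "set_pmf (P n) \<subseteq> {..n}" for n
    by (auto simp: set_pmf_iff pmfP w_def split: if_splits)
  define \<mu> where "\<mu> n = distr (measure_pmf (P n)) borel (node n)" for n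
  have node: "node n k \<in> {-M..M}" if "k \<le> n" for n k
  proof -
    have "0 \<le> real k / real n" "real k / real n \<le> 1" using that by (auto simp: divide_le_eq_1)
    then have "2 * M * (real k / real n) \<le> 2 * M * 1" "0 \<le> 2 * M * (real k / real n)"
      using M by (intro mult_left_mono mult_nonneg_nonneg; simp)+
    then show ?thesis unfolding node_def by simp
  qed
  have rd: "real_distribution (\<mu> n)" for n
    unfolding \<mu>_def by (rule prob_space.real_distribution_distr) (auto simp: measure_pmf.prob_space_axioms)
  have tight: "tight \<mu>"
    unfolding tight_def
  proof (intro conjI allI impI rd)
    fix e :: real assume e: "0 < e"
    \<comment> \<open>All nodes lie in [-M, M]. The interval is open on the left, so its left end is
      moved to -M - 1 to keep the node -M inside.\<close>
    have "measure (\<mu> n) {- M - 1<..M} = 1" for n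
    proof -
      have "measure (\<mu> n) {- M - 1<..M} = measure (measure_pmf (P n)) (node n -` {- M - 1<..M})"
        unfolding \<mu>_def by (subst measure_distr) auto
      also have "\<dots> = 1"
        by (rule measure_pmf.prob_eq_1[THEN iffD2])
           (use setP[of n] node[of _ n] in \<open>force simp: AE_measure_pmf_iff\<close>)+
      finally show ?thesis .
    qed
    then show "\<exists>a b. a < b \<and> (\<forall>n. 1 - e < measure (\<mu> n) {a<..b})"
      using M e by (intro exI[of _ "- M - 1"] exI[of _ M]) auto
  qed
  \<comment> \<open>A weakly convergent subsequence is enough: the integrals of g are shown below to
    converge to \<Lambda> g along the whole sequence, which identifies the limit.\<close>
  obtain r \<nu> where r: "strict_mono r" "real_distribution \<nu>" "weak_conv_m (\<mu> \<circ> id \<circ> r) \<nu>"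
    using tight_imp_convergent_subsubsequence[OF tight strict_mono_id] by blast
  have "(LINT x|\<nu>. g x) = \<Lambda> g" if g: "continuous_on UNIV g" and B: "\<forall>x. cmod (g x) \<le> B" for g B
  proof -
    have "(\<lambda>n. LINT x|(\<mu> \<circ> id \<circ> r) n. g x) \<longlonglongrightarrow> (LINT x|\<nu>. g x)"
    proof (rule weak_conv_imp_integral_bdd_continuous_conv[OF _ r(2,3)])
      show "real_distribution ((\<mu> \<circ> id \<circ> r) n)" for n using rd by simp
      show "isCont g x" for x using g by (simp add: continuous_on_eq_continuous_at)
      show "cmod (g x) \<le> B" for x using B by blast
    qed
    then have lim1: "(\<lambda>n. LINT x|\<mu> (r n). g x) \<longlonglongrightarrow> (LINT x|\<nu>. g x)" by simp
    have gm: "g \<in> borel_measurable borel" using g by (rule borel_measurable_continuous_onI)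
    \<comment> \<open>The right-hand side is \<Lambda> applied to the n-th Bernstein polynomial of g
      on [-M, M], so its distance from \<Lambda> g is at most the error of Bernstein approximation
      there.\<close>
    have int: "(LINT x|\<mu> n. g x) = (\<Sum>k\<le>n. g (node n k) * complex_of_real (w n k))" for n
    proof -
      have "(LINT x|\<mu> n. g x) = (LINT k|measure_pmf (P n). g (node n k))"
        unfolding \<mu>_def by (rule integral_distr) (auto simp: gm)
      also have "\<dots> = (\<Sum>k\<in>{..n}. pmf (P n) k *\<^sub>R g (node n k))"
        by (rule integral_measure_pmf) (use setP[of n] in auto)
      finally show ?thesis by (simp add: pmfP scaleR_conv_of_real mult.commute)
    qed
    have "(\<lambda>n. LINT x|\<mu> n. g x) \<longlonglongrightarrow> \<Lambda> g"
    proof (rule LIMSEQ_I)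
      fix e :: real assume e: "0 < e"
      define G where "G t = g (2 * M * t - M)" for t
      have "continuous_on {0..1} G"
        unfolding G_def by (rule continuous_on_compose2[OF g]) (auto intro!: continuous_intros)
      from Bernstein_Weierstrass_complex[OF this, of "e/2"] e obtain N where N: "\<And>n t. n \<ge> N \<Longrightarrow> t \<in> {0..1} \<Longrightarrow>
         cmod (G t - (\<Sum>k\<le>n. G (real k / real n) * complex_of_real (Bernstein n k t))) \<le> e/2"
        by force
      have "norm ((LINT x|\<mu> n. g x) - \<Lambda> g) < e" if n: "n \<ge> N" for n
      proof -
        let ?s = "\<lambda>x. \<Sum>k\<le>n. (- g (node n k)) * complex_of_real (b n k x)"
        have cs: "continuous_on UNIV ?s" by (intro continuous_intros cb)
        have "\<Lambda> (\<lambda>x. g x + ?s x) = \<Lambda> g + \<Lambda> ?s" by (rule add[OF g cs])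
        also have "\<Lambda> ?s = - (LINT x|\<mu> n. g x)"
          by (subst \<Lambda>sum) (auto simp: int w(1) sum_negf)
        finally have "\<Lambda> g - (LINT x|\<mu> n. g x) = \<Lambda> (\<lambda>x. g x + ?s x)" by simp
        moreover have "cmod (\<Lambda> (\<lambda>x. g x + ?s x)) \<le> e/2"
        proof (rule bd)
          show "continuous_on UNIV (\<lambda>x. g x + ?s x)" by (intro continuous_intros g cs)
          fix x assume x: "x \<in> {-M..M}"
          have "2 * M * ((x + M) / (2 * M)) - M = x" using M by simp
          then show "cmod (g x + ?s x) \<le> e/2"
            using N[OF n unit[OF x]] by (simp add: G_def b_def node_def sum_negf)
        qed
        ultimately show ?thesis using e by (simp add: norm_minus_commute)
      qed
      then show "\<exists>no. \<forall>n\<ge>no. norm ((LINT x|\<mu> n. g x) - \<Lambda> g) < e" by blast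
    qed
    then have "(\<lambda>n. LINT x|\<mu> (r n). g x) \<longlonglongrightarrow> \<Lambda> g"
      using LIMSEQ_subseq_LIMSEQ[OF _ r(1)] unfolding o_def by blast
    with lim1 show ?thesis by (rule LIMSEQ_unique)
  qed
  then show ?thesis using r(2) by blast
qed

section \<open>Radon measures and their integrals over \<open>Cc\<close>\<close>

lemma real_distribution_radon: "real_distribution \<mu> \<Longrightarrow> radon_measure \<mu>"
proof -
  assume "real_distribution \<mu>"
  then interpret real_distribution \<mu> .
  have "emeasure \<mu> B = (SUP K\<in>{K. K \<subseteq> B \<and> compact K}. emeasure \<mu> K)" if "B \<in> sets borel" for B
    by (rule inner_regular) (use that in \<open>auto simp: events_eq_borel\<close>)
  moreover have "emeasure \<mu> K < \<infinity>" for K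
    using emeasure_finite[of K] by (simp only: infinity_ennreal_def less_top)
  ultimately show ?thesis unfolding radon_measure_def using events_eq_borel by blast
qed

text \<open>The functions \<open>g n\<close> are continuous, vanish outside the interval and tend
  pointwise to its indicator, which also dominates them. Thus integrals of compactly supported
  continuous functions determine the measure of bounded open intervals.\<close>

lemma radon_measure_Ioo_limit:
  fixes a b :: real
  assumes \<mu>: "radon_measure \<mu>"
  defines "g \<equiv> \<lambda>n x. min 1 (real n * max 0 (min (x - a) (b - x)))"
  shows "(\<lambda>n. LINT x|\<mu>. complex_of_real (g n x)) \<longlonglongrightarrow> complex_of_real (measure \<mu> {a<..<b})"
proof -
  have sets: "sets \<mu> = sets borel" using \<mu> by (simp add: radon_measure_def)
  have fin: "emeasure \<mu> {a..b} < \<infinity>"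
    using \<mu> compact_Icc[of a b] unfolding radon_measure_def by blast
  have fin': "emeasure \<mu> {a<..<b} < \<infinity>"
    by (rule order_le_less_trans[OF emeasure_mono fin]) (auto simp: sets)
  have "(\<lambda>n. LINT x|\<mu>. complex_of_real (g n x)) \<longlonglongrightarrow> (LINT x|\<mu>. complex_of_real (indicator {a<..<b} x))"
  proof (rule integral_dominated_convergence[where w = "indicator {a<..<b}"])
    show "integrable \<mu> (indicator {a<..<b} :: real \<Rightarrow> real)"
      using fin' by (intro integrable_real_indicator) (auto simp: sets)
    show "(\<lambda>x. complex_of_real (g n x)) \<in> borel_measurable \<mu>" for n
      unfolding g_def by (subst measurable_cong_sets[OF sets refl]) measurable
    show "(\<lambda>x. complex_of_real (indicator {a<..<b} x)) \<in> borel_measurable \<mu>"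
      by (subst measurable_cong_sets[OF sets refl]) measurable
    show "AE x in \<mu>. (\<lambda>n. complex_of_real (g n x)) \<longlonglongrightarrow> complex_of_real (indicator {a<..<b} x)"
    proof (rule AE_I2, rule tendsto_of_real)
      fix x
      show "(\<lambda>n. g n x) \<longlonglongrightarrow> indicator {a<..<b} x"
      proof (cases "x \<in> {a<..<b}")
        case True
        define d where "d = min (x - a) (b - x)"
        have d: "d > 0" using True by (simp add: d_def)
        obtain N where N: "1 / d < real N" using reals_Archimedean2 by blast
        have "g n x = 1" if "n \<ge> N" for n
        proof -
          have "1 / d \<le> real n" using N that by linarith
          then have "1 \<le> real n * d" using d by (simp add: field_simps)
          then show ?thesis using d unfolding g_def d_def[symmetric] by simp
        qed
        then have "\<forall>\<^sub>F n in sequentially. g n x = 1" unfolding eventually_sequentially by blast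
        then show ?thesis using True by (simp add: tendsto_eventually)
      next
        case False
        then have "max 0 (min (x - a) (b - x)) = 0" by auto
        then show ?thesis using False by (simp add: g_def)
      qed
    qed
    show "AE x in \<mu>. norm (complex_of_real (g n x)) \<le> indicator {a<..<b} x" for n
      by (rule AE_I2) (auto simp: g_def indicator_def)
  qed
  then show ?thesis using sets by (simp add: sets_eq_imp_space_eq)
qed

lemma sets_borel_Ioo: "sets borel = sigma_sets UNIV (range (\<lambda>(a, b). {a<..<b::real}))"
  unfolding borel_eq_box by (simp add: box_real case_prod_unfold)

text \<open>Bounded open intervals are an intersection-stable generator that exhausts the line, and
  finiteness on compact sets makes their measure finite, so agreement on them suffices.\<close>

lemma radon_measure_unique:
  assumes \<mu>: "radon_measure \<mu>" and \<nu>: "radon_measure \<nu>"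
    and eq: "\<And>g. g \<in> Cc \<Longrightarrow> (LINT x|\<mu>. g x) = (LINT x|\<nu>. g x)"
  shows "\<mu> = \<nu>"
proof (rule measure_eqI_generator_eq[where E = "range (\<lambda>(a, b). {a<..<b::real})" and \<Omega> = UNIV
      and A = "\<lambda>n. {- real n<..<real n}"])
  have fin: "emeasure \<rho> {a<..<b} \<noteq> \<infinity>" if "radon_measure \<rho>" for a b :: real and \<rho>
  proof -
    have "emeasure \<rho> {a<..<b} \<le> emeasure \<rho> {a..b}"
      using that by (intro emeasure_mono) (auto simp: radon_measure_def)
    also have "\<dots> < \<infinity>"
      using that compact_Icc[of a b] unfolding radon_measure_def by blast
    finally show ?thesis by simp
  qed
  show "Int_stable (range (\<lambda>(a, b). {a<..<b::real}))"
    by (auto simp: Int_stable_def)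
  show "emeasure \<mu> X = emeasure \<nu> X" if X: "X \<in> range (\<lambda>(a, b). {a<..<b::real})" for X
  proof -
    obtain a b where ab: "X = {a<..<b}" using X by auto
    have "(\<lambda>x. complex_of_real (min 1 (real n * max 0 (min (x - a) (b - x))))) \<in> Cc" for n
    proof -
      have "closure {x. complex_of_real (min 1 (real n * max 0 (min (x - a) (b - x)))) \<noteq> 0} \<subseteq> {a..b}"
        by (rule closure_minimal) (auto simp: max_def min_def split: if_splits)
      then have "compact (closure {x. complex_of_real (min 1 (real n * max 0 (min (x - a) (b - x)))) \<noteq> 0})"
        using bounded_subset[OF bounded_closed_interval] by (simp only: compact_eq_bounded_closed closed_closure) blast
      then show ?thesis unfolding Cc_def by (auto intro!: continuous_intros)
    qed
    from eq[OF this] have "complex_of_real (measure \<mu> {a<..<b}) = complex_of_real (measure \<nu> {a<..<b})"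
      using LIMSEQ_unique[OF radon_measure_Ioo_limit[OF \<mu>, of a b]] radon_measure_Ioo_limit[OF \<nu>, of a b]
      by simp
    then show ?thesis using fin[OF \<mu>, of a b] fin[OF \<nu>, of a b]
      by (simp add: ab emeasure_eq_ennreal_measure)
  qed
  show "sets \<mu> = sigma_sets UNIV (range (\<lambda>(a, b). {a<..<b::real}))"
    "sets \<nu> = sigma_sets UNIV (range (\<lambda>(a, b). {a<..<b::real}))"
    using \<mu> \<nu> by (simp_all add: radon_measure_def sets_borel_Ioo)
  show "(\<Union>i. {- real i<..<real i}) = UNIV"
  proof (intro equalityI subsetI)
    fix x :: real
    obtain n where "\<bar>x\<bar> < real n" using reals_Archimedean2 by blast
    then show "x \<in> (\<Union>i. {- real i<..<real i})" by (intro UN_I[of n]) auto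
  qed simp
  show "emeasure \<mu> {- real i<..<real i} \<noteq> \<infinity>" for i by (rule fin[OF \<mu>])
qed auto

lemma Cc_bounded: assumes "g \<in> Cc" shows "\<exists>B. \<forall>x. cmod (g x) \<le> B"
proof -
  let ?S = "closure {x. g x \<noteq> 0}"
  have "compact (g ` ?S)"
    using assms by (intro compact_continuous_image) (auto simp: Cc_def intro: continuous_on_subset)
  then obtain B where B: "0 < B" "\<And>x. x \<in> ?S \<Longrightarrow> cmod (g x) \<le> B"
    using compact_imp_bounded by (force simp: bounded_pos)
  have "cmod (g x) \<le> B" for x
    using B closure_subset[of "{x. g x \<noteq> 0}"] by (cases "g x = 0") auto
  then show ?thesis by blast
qed

text \<open>Resolves the definite description once for both \<open>dos_measure_trunc\<close> and
  \<open>dos_measure\<close>: existence is \<open>state_representation\<close>, uniqueness is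
  \<open>radon_measure_unique\<close>.\<close>

lemma integral_state_measure:
  fixes \<Lambda> :: "(real \<Rightarrow> complex) \<Rightarrow> complex"
  assumes "\<And>f g. continuous_on UNIV f \<Longrightarrow> continuous_on UNIV g \<Longrightarrow> \<Lambda> (\<lambda>x. f x + g x) = \<Lambda> f + \<Lambda> g"
    and "\<And>c f. continuous_on UNIV f \<Longrightarrow> \<Lambda> (\<lambda>x. c * f x) = c * \<Lambda> f"
    and "\<Lambda> (\<lambda>_. 1) = 1" and "0 < M"
    and "\<And>f e. continuous_on UNIV f \<Longrightarrow> (\<And>x. x \<in> {-M..M} \<Longrightarrow> cmod (f x) \<le> e) \<Longrightarrow> cmod (\<Lambda> f) \<le> e"
    and g: "g \<in> Cc"
  shows "(LINT x|(THE \<mu>. radon_measure \<mu> \<and> (\<forall>g\<in>Cc. (LINT x|\<mu>. g x) = \<Lambda> g)). g x) = \<Lambda> g"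
proof -
  obtain \<mu> where \<mu>: "real_distribution \<mu>"
    "\<And>g B. continuous_on UNIV g \<Longrightarrow> (\<And>x. cmod (g x) \<le> B) \<Longrightarrow> (LINT x|\<mu>. g x) = \<Lambda> g"
    using state_representation[of \<Lambda> M] assms(1-5) by blast
  have rep: "(LINT x|\<mu>. g x) = \<Lambda> g" if "g \<in> Cc" for g
    using Cc_bounded[OF that] \<mu>(2)[of g] that by (auto simp: Cc_def)
  have "(THE \<mu>. radon_measure \<mu> \<and> (\<forall>g\<in>Cc. (LINT x|\<mu>. g x) = \<Lambda> g)) = \<mu>"
  proof (rule the_equality)
    show "radon_measure \<mu> \<and> (\<forall>g\<in>Cc. (LINT x|\<mu>. g x) = \<Lambda> g)"
      using real_distribution_radon[OF \<mu>(1)] rep by blast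
    show "\<nu> = \<mu>" if "radon_measure \<nu> \<and> (\<forall>g\<in>Cc. (LINT x|\<nu>. g x) = \<Lambda> g)" for \<nu>
      by (rule radon_measure_unique) (use that rep real_distribution_radon[OF \<mu>(1)] in auto)
  qed
  then show ?thesis using rep[OF g] by simp
qed

section \<open>The coupled chain\<close>


text \<open>Rounding t down to a multiple s n0 of s costs the factor exp (c s). On either side of n0
  the terms are distinct powers of exp (- c s), so each side is at most a geometric series and the
  bound does not depend on t.\<close>

lemma int_exp_sum_bounded:
  fixes c s :: real
  assumes c: "0 < c" and s: "0 < s"
  obtains B where "0 \<le> B" "\<And>t F. finite F \<Longrightarrow> (\<Sum>n\<in>F. exp (- c * \<bar>s * of_int n - t\<bar>)) \<le> B"
proof -
  define r where "r = exp (- (c * s))"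
  have r: "0 < r" "r < 1" using c s by (auto simp: r_def)
  have geo: "(\<Sum>n\<in>A. r ^ nat \<bar>n - n0\<bar>) \<le> 1 / (1 - r)"
    if "finite A" "inj_on (\<lambda>n. nat \<bar>n - n0\<bar>) A" for A :: "int set" and n0
  proof -
    have "(\<Sum>n\<in>A. r ^ nat \<bar>n - n0\<bar>) = (\<Sum>k\<in>(\<lambda>n. nat \<bar>n - n0\<bar>) ` A. r ^ k)"
      using sum.reindex[OF that(2), of "\<lambda>k. r ^ k"] by simp
    also have "\<dots> \<le> (\<Sum>k. r ^ k)"
      by (rule sum_le_suminf) (use r that(1) in \<open>auto intro: summable_geometric\<close>)
    also have "\<dots> = 1 / (1 - r)" using r by (intro suminf_geometric) auto
    finally show ?thesis .
  qed
  have "(\<Sum>n\<in>F. exp (- c * \<bar>s * of_int n - t\<bar>)) \<le> exp (c * s) * (2 / (1 - r))"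
    if F: "finite F" for t and F :: "int set"
  proof -
    define n0 where "n0 = \<lfloor>t / s\<rfloor>"
    have n0: "of_int n0 * s \<le> t" "t < (of_int n0 + 1) * s"
      unfolding n0_def using floor_divide_lower[OF s, of t] floor_divide_upper[OF s, of t] by auto
    have "exp (- c * \<bar>s * of_int n - t\<bar>) \<le> exp (c * s) * r ^ nat \<bar>n - n0\<bar>" for n
    proof -
      have "s * of_int \<bar>n - n0\<bar> = \<bar>s * of_int n - s * of_int n0\<bar>"
        using s by (simp add: abs_mult flip: right_diff_distrib)
      also have "\<dots> \<le> \<bar>s * of_int n - t\<bar> + s" using n0 by (simp add: algebra_simps)
      finally have "c * (s * of_int \<bar>n - n0\<bar>) \<le> c * (\<bar>s * of_int n - t\<bar> + s)"
        using c by (intro mult_left_mono) auto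
      then have "- c * \<bar>s * of_int n - t\<bar> \<le> c * s + real (nat \<bar>n - n0\<bar>) * (- (c * s))"
        by (simp add: algebra_simps)
      then have "exp (- c * \<bar>s * of_int n - t\<bar>) \<le> exp (c * s + real (nat \<bar>n - n0\<bar>) * (- (c * s)))"
        by simp
      then show ?thesis by (simp only: exp_add exp_of_nat_mult r_def)
    qed
    then have "(\<Sum>n\<in>F. exp (- c * \<bar>s * of_int n - t\<bar>)) \<le> (\<Sum>n\<in>F. exp (c * s) * r ^ nat \<bar>n - n0\<bar>)"
      by (intro sum_mono)
    also have "\<dots> = exp (c * s) * (\<Sum>n\<in>F. r ^ nat \<bar>n - n0\<bar>)" by (simp add: sum_distrib_left)
    also have "\<dots> \<le> exp (c * s) * (2 / (1 - r))"
    proof (rule mult_left_mono)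
      have "F = (F \<inter> {n0..}) \<union> (F \<inter> {..<n0})" by auto
      then have "(\<Sum>n\<in>F. r ^ nat \<bar>n - n0\<bar>)
          = (\<Sum>n\<in>F \<inter> {n0..}. r ^ nat \<bar>n - n0\<bar>) + (\<Sum>n\<in>F \<inter> {..<n0}. r ^ nat \<bar>n - n0\<bar>)"
        using F by (subst sum.union_disjoint[symmetric]) auto
      also have "\<dots> \<le> 1 / (1 - r) + 1 / (1 - r)"
        using F by (intro add_mono geo) (auto simp: inj_on_def)
      finally show "(\<Sum>n\<in>F. r ^ nat \<bar>n - n0\<bar>) \<le> 2 / (1 - r)" by simp
    qed simp
    finally show ?thesis .
  qed
  then show thesis using r by (intro that[of "exp (c * s) * (2 / (1 - r))"]) auto
qed

definition site_pos :: "real \<Rightarrow> real \<Rightarrow> int + int \<Rightarrow> real" where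
  "site_pos \<theta> b v = (case v of Inl n \<Rightarrow> of_int n | Inr n \<Rightarrow> (1 - \<theta>) * of_int n + b)"

definition laplace_kernel :: "int \<Rightarrow> int \<Rightarrow> real" where
  "laplace_kernel n m = (if n = m then 2 else if \<bar>n - m\<bar> = 1 then -1 else 0)"

text \<open>Both coupling sums of \<open>H_op\<close> evaluate \<open>h\<close> at the position of
  the row site minus that of the column site, so one formula covers the two off-diagonal blocks;
  evenness of \<open>h\<close> makes it symmetric.\<close>

definition chain_kernel :: "real \<Rightarrow> (real \<Rightarrow> real) \<Rightarrow> real \<Rightarrow> int + int \<Rightarrow> int + int \<Rightarrow> real" where
  "chain_kernel \<theta> h b v w = (case (v, w) of (Inl n, Inl m) \<Rightarrow> laplace_kernel n m
     | (Inr n, Inr m) \<Rightarrow> laplace_kernel n m | _ \<Rightarrow> h (site_pos \<theta> b v - site_pos \<theta> b w))"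

definition Lambda_sites :: "real \<Rightarrow> real \<Rightarrow> real \<Rightarrow> (int + int) set" where
  "Lambda_sites \<theta> b L = Inl ` Lambda1 L \<union> Inr ` Lambda2 \<theta> b L"

lemma finite_Lambda1: "finite (Lambda1 L)"
  unfolding Lambda1_def int_interval_eq by simp

lemma finite_Lambda2: "finite (Lambda2 \<theta> b L)"
  unfolding Lambda2_def int_interval_eq by simp

lemma finite_Lambda_sites: "finite (Lambda_sites \<theta> b L)"
  by (simp add: Lambda_sites_def finite_Lambda1 finite_Lambda2)

lemma sum_Lambda_sites:
  "(\<Sum>v\<in>Lambda_sites \<theta> b L. f v) = (\<Sum>x\<in>Lambda1 L. f (Inl x)) + (\<Sum>x\<in>Lambda2 \<theta> b L. f (Inr x))"
  unfolding Lambda_sites_def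
  by (subst sum.union_disjoint) (auto simp: finite_Lambda1 finite_Lambda2 sum.reindex)

lemma card_Lambda_eq: "card_Lambda \<theta> b L = card (Lambda_sites \<theta> b L)"
  using sum_Lambda_sites[of "\<lambda>_. 1 :: nat" \<theta> b L] by (simp add: card_Lambda_def)

lemma card_Lambda_pos: "0 < L \<Longrightarrow> 0 < card_Lambda \<theta> b L"
proof -
  assume "0 < L"
  then have "0 \<in> Lambda1 L" by (simp add: Lambda1_def)
  then have "card (Lambda1 L) > 0" using finite_Lambda1[of L] card_gt_0_iff by blast
  then show ?thesis by (simp add: card_Lambda_def)
qed

lemma infsum_int_sum_split:
  fixes f :: "int + int \<Rightarrow> complex"
  assumes "f summable_on UNIV"
  shows "infsum f UNIV = (\<Sum>\<^sub>\<infinity>n. f (Inl n)) + (\<Sum>\<^sub>\<infinity>n. f (Inr n))"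
proof -
  have U: "(UNIV :: (int + int) set) = range Inl \<union> range Inr" using UNIV_sum by simp
  have "infsum f (range Inl \<union> range Inr) = infsum f (range Inl) + infsum f (range Inr)"
    by (rule infsum_Un_disjoint) (auto intro: summable_on_subset_banach[OF assms])
  also have "infsum f (range Inl) = (\<Sum>\<^sub>\<infinity>n. f (Inl n))" by (subst infsum_reindex) (auto simp: o_def)
  also have "infsum f (range Inr) = (\<Sum>\<^sub>\<infinity>n. f (Inr n))" by (subst infsum_reindex) (auto simp: o_def)
  finally show ?thesis by (simp add: U)
qed

lemma infsum_laplace_kernel:
  "(\<Sum>\<^sub>\<infinity>m. complex_of_real (laplace_kernel n m) * f m) = - (f (n + 1) - 2 * f n + f (n - 1))"
proof -
  have "(\<Sum>\<^sub>\<infinity>m. complex_of_real (laplace_kernel n m) * f m)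
      = (\<Sum>\<^sub>\<infinity>m\<in>{n - 1, n, n + 1}. complex_of_real (laplace_kernel n m) * f m)"
    by (rule infsum_cong_neutral) (auto simp: laplace_kernel_def)
  then show ?thesis by (simp add: laplace_kernel_def)
qed

lemma diag_coord: "diag T x = coord (T (delta x)) x"
  by (simp add: diag_def cinner_delta)

lemma cmod_diag_le: "norm T \<le> e \<Longrightarrow> cmod (diag T x) \<le> e"
  unfolding diag_coord using cmod_coord_le[of "T (delta x)" x] norm_blinfun[of T "delta x"]
  by (simp add: norm_delta)

lemma uniform_measure_integral:
  fixes F :: "real \<Rightarrow> complex"
  assumes F: "continuous_on UNIV F" and p: "0 < p"
  shows "(LINT b|uniform_measure lborel {0..<p}. F b) = (1 / p) *\<^sub>R integral {0..p} F"
proof -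
  have Fm: "F \<in> borel_measurable borel" using F by (rule borel_measurable_continuous_onI)
  have "uniform_measure lborel {0..<p} = density lborel (\<lambda>x. ennreal (indicator {0..<p} x / p))"
    unfolding uniform_measure_def using p
    by (intro arg_cong[where f = "density lborel"] ext)
       (auto simp: indicator_def divide_ennreal ennreal_1[symmetric] simp del: ennreal_1)
  then have "(LINT b|uniform_measure lborel {0..<p}. F b) = (LINT b|lborel. (indicator {0..<p} b / p) *\<^sub>R F b)"
    using p Fm by (simp only:) (subst integral_density; auto)
  also have "\<dots> = (LINT b|lborel. (1 / p) *\<^sub>R (indicator {0..p} b *\<^sub>R F b))"
  proof (rule integral_cong_AE)
    show "AE b in lborel. (indicator {0..<p} b / p) *\<^sub>R F b = (1 / p) *\<^sub>R (indicator {0..p} b *\<^sub>R F b)"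
      using AE_lborel_singleton[of p] by eventually_elim (auto simp: indicator_def)
  qed (use Fm in auto)
  also have "\<dots> = (1 / p) *\<^sub>R (LINT b:{0..p}|lborel. F b)"
    by (simp only: set_lebesgue_integral_def integral_scaleR_right)
  also have "(LINT b:{0..p}|lborel. F b) = integral {0..p} F"
    by (rule set_borel_integral_eq_integral(2), rule borel_integrable_atLeastAtMost')
       (rule continuous_on_subset[OF F], simp)
  finally show ?thesis .
qed

section \<open>Kernel estimates uniform in b\<close>

locale incommensurate_chain =
  fixes \<theta> :: real and h :: "real \<Rightarrow> real" and C c :: real
  assumes theta: "0 < \<theta>" "\<theta> < 1" "\<theta> \<notin> \<rat>"
    and h_even: "\<And>x. h (- x) = h x" and h_cont: "continuous_on UNIV h"
    and C_pos: "0 < C" and c_pos: "0 < c" and h_decay: "\<And>x. \<bar>h x\<bar> \<le> C * exp (- c * \<bar>x\<bar>)"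
begin

abbreviation "pos \<equiv> site_pos \<theta>"
abbreviation "K \<equiv> chain_kernel \<theta> h"
abbreviation "H \<equiv> H_op \<theta> h"
abbreviation "sites \<equiv> Lambda_sites \<theta>"

lemma site_exp_sum_bounded:
  assumes a: "0 < a"
  obtains B where "0 < B" "\<And>b t F. finite F \<Longrightarrow> (\<Sum>v\<in>F. exp (- a * \<bar>pos b v - t\<bar>)) \<le> B"
proof -
  obtain B1 where B1: "0 \<le> B1" "\<And>t F. finite F \<Longrightarrow> (\<Sum>n\<in>F. exp (- a * \<bar>1 * of_int n - t\<bar>)) \<le> B1"
    using int_exp_sum_bounded[OF a zero_less_one] by blast
  have th: "0 < 1 - \<theta>" using theta by simp
  obtain B2 where B2: "0 \<le> B2" "\<And>t F. finite F \<Longrightarrow> (\<Sum>n\<in>F. exp (- a * \<bar>(1 - \<theta>) * of_int n - t\<bar>)) \<le> B2"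
    using int_exp_sum_bounded[OF a th] by blast
  \<comment> \<open>The additional 1 makes the bound strictly positive, so that later estimates may
    divide by it.\<close>
  have "(\<Sum>v\<in>F. exp (- a * \<bar>pos b v - t\<bar>)) \<le> B1 + B2 + 1" if F: "finite F" for b t and F :: "(int + int) set"
  proof -
    let ?e = "\<lambda>v. exp (- a * \<bar>pos b v - t\<bar>)"
    have fin: "finite (Inl -` F)" "finite (Inr -` F)" using F by (auto intro: finite_vimageI)
    have "F = (Inl -` F) <+> (Inr -` F)"
      by (auto simp: Plus_def) (metis obj_sumE rangeI image_eqI vimageI)
    then have "sum ?e F = sum ?e ((Inl -` F) <+> (Inr -` F))" by simp
    also have "\<dots> = (\<Sum>n\<in>Inl -` F. ?e (Inl n)) + (\<Sum>n\<in>Inr -` F. ?e (Inr n))"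
      using sum.Plus[OF fin, of ?e] by (simp add: o_def)
    also have "(\<Sum>n\<in>Inl -` F. ?e (Inl n)) \<le> B1"
      using B1(2)[OF fin(1), of t] by (simp add: site_pos_def)
    also have "(\<Sum>n\<in>Inr -` F. ?e (Inr n)) \<le> B2"
      using B2(2)[OF fin(2), of "t - b"] by (simp add: site_pos_def algebra_simps)
    finally show ?thesis by simp
  qed
  then show thesis using B1(1) B2(1) by (intro that[of "B1 + B2 + 1"]) auto
qed

text \<open>C accounts for the coupling by \<open>h\<close>. The discrete Laplacian has entries of
  modulus at most 2 between sites at distance at most 1, and 2 = 2 exp c * exp (- c) gives the other
  summand.\<close>

definition "decay_const = C + 2 * exp c"

lemma decay_const_pos: "0 < decay_const" using C_pos by (simp add: decay_const_def add_pos_pos)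

lemma kernel_sym: "K b v w = K b w v"
  using h_even[of "pos b v - pos b w"]
  by (auto simp: chain_kernel_def laplace_kernel_def abs_minus_commute split: sum.splits)

lemma kernel_decay: "\<bar>K b v w\<bar> \<le> decay_const * exp (- c * \<bar>pos b v - pos b w\<bar>)"
proof -
  have cross: "\<bar>h x\<bar> \<le> decay_const * exp (- c * \<bar>x\<bar>)" for x
    by (rule order_trans[OF h_decay]) (simp add: decay_const_def)
  have lap: "\<bar>laplace_kernel n m\<bar> \<le> decay_const * exp (- c * d)" if "\<bar>n - m\<bar> \<le> 1 \<Longrightarrow> d \<le> 1" for n m d
  proof (cases "\<bar>n - m\<bar> \<le> 1")
    case True
    have "\<bar>laplace_kernel n m\<bar> \<le> 2" by (simp add: laplace_kernel_def)
    also have "\<dots> = 2 * exp c * exp (- c)" by (simp flip: exp_add)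
    also have "\<dots> \<le> decay_const * exp (- c * d)"
      using that[OF True] C_pos c_pos by (intro mult_mono) (auto simp: decay_const_def)
    finally show ?thesis .
  qed (use decay_const_pos in \<open>auto simp: laplace_kernel_def\<close>)
  have scale: "\<bar>(1 - \<theta>) * real_of_int n - (1 - \<theta>) * real_of_int m\<bar> \<le> 1" if "\<bar>n - m\<bar> \<le> 1" for n m
  proof -
    have "\<bar>(1 - \<theta>) * real_of_int n - (1 - \<theta>) * real_of_int m\<bar> = (1 - \<theta>) * of_int \<bar>n - m\<bar>"
      using theta by (simp add: abs_mult flip: right_diff_distrib)
    also have "\<dots> \<le> 1 * 1" using theta that by (intro mult_mono) auto
    finally show ?thesis by simp
  qed
  have unit: "\<bar>real_of_int n - real_of_int m\<bar> \<le> 1" if "\<bar>n - m\<bar> \<le> 1" for n m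
    using that by linarith
  have scale': "\<bar>((1 - \<theta>) * real_of_int n + b) - ((1 - \<theta>) * real_of_int m + b)\<bar> \<le> 1" if "\<bar>n - m\<bar> \<le> 1" for n m
    using scale[OF that] by simp
  show ?thesis
    by (cases v; cases w; simp only: chain_kernel_def site_pos_def prod.case sum.case)
       (rule cross lap; (rule unit scale'; assumption)?)+
qed

lemma schur_exists: "\<exists>M>0. \<forall>b. schur_kernel (K b) M"
proof -
  obtain B where B: "0 < B" "\<And>b t F. finite F \<Longrightarrow> (\<Sum>v\<in>F. exp (- c * \<bar>pos b v - t\<bar>)) \<le> B"
    using site_exp_sum_bounded[OF c_pos] by blast
  have "schur_kernel (K b) (decay_const * B)" for b
  proof (rule schur_kernelI)
    fix v and F :: "(int + int) set" assume F: "finite F"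
    have "(\<Sum>w\<in>F. \<bar>K b v w\<bar>) \<le> (\<Sum>w\<in>F. decay_const * exp (- c * \<bar>pos b w - pos b v\<bar>))"
      using kernel_decay[of b v] by (intro sum_mono) (simp add: abs_minus_commute)
    also have "\<dots> \<le> decay_const * B"
      using B(2)[OF F, of b "pos b v"] decay_const_pos by (simp add: mult_left_mono flip: sum_distrib_left)
    finally show "(\<Sum>w\<in>F. \<bar>K b v w\<bar>) \<le> decay_const * B" .
  qed (use decay_const_pos B kernel_sym in auto)
  then show ?thesis using decay_const_pos B(1) by (intro exI[of _ "decay_const * B"]) auto
qed

text \<open>One bound for all b: all spectra, including those of the truncations, then lie in a
  fixed interval.\<close>

definition "norm_bound = (SOME B. 0 < B \<and> (\<forall>b. schur_kernel (K b) B))"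

lemma norm_bound: "0 < norm_bound" "schur_kernel (K b) norm_bound"
  using someI_ex[OF schur_exists, folded norm_bound_def] by auto

text \<open>Resolves the description \<open>H_op\<close>: the operator with kernel
  \<open>K b\<close> satisfies the defining equations, and these fix every coordinate of the image
  of every vector.\<close>

lemma H_has_kernel: "has_kernel (H b) (K b)"
proof -
  obtain T where T: "has_kernel T (K b)" using has_kernel_exists[OF norm_bound(2)] ..
  let ?P = "\<lambda>T. \<forall>(\<psi> :: chain) (n :: int).
     coord (blinfun_apply T \<psi>) (Inl n) =
       - (coord \<psi> (Inl (n + 1)) - 2 * coord \<psi> (Inl n) + coord \<psi> (Inl (n - 1)))
       + (\<Sum>\<^sub>\<infinity>n'. complex_of_real (h (real_of_int n - (1 - \<theta>) * real_of_int n' - b)) * coord \<psi> (Inr n')) \<and>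
     coord (blinfun_apply T \<psi>) (Inr n) =
       - (coord \<psi> (Inr (n + 1)) - 2 * coord \<psi> (Inr n) + coord \<psi> (Inr (n - 1)))
       + (\<Sum>\<^sub>\<infinity>n'. complex_of_real (h ((1 - \<theta>) * real_of_int n + b - real_of_int n')) * coord \<psi> (Inl n'))"
  have PT: "?P T"
  proof (intro allI conjI)
    fix \<psi> :: chain and n :: int
    have split: "coord (T \<psi>) v = (\<Sum>\<^sub>\<infinity>m. complex_of_real (K b v (Inl m)) * coord \<psi> (Inl m))
        + (\<Sum>\<^sub>\<infinity>m. complex_of_real (K b v (Inr m)) * coord \<psi> (Inr m))" for v
      using T unfolding has_kernel_def
      by (simp only:) (rule infsum_int_sum_split[OF schur_kernel_summable[OF norm_bound(2)]])
    show "coord (blinfun_apply T \<psi>) (Inl n) =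
       - (coord \<psi> (Inl (n + 1)) - 2 * coord \<psi> (Inl n) + coord \<psi> (Inl (n - 1)))
       + (\<Sum>\<^sub>\<infinity>n'. complex_of_real (h (real_of_int n - (1 - \<theta>) * real_of_int n' - b)) * coord \<psi> (Inr n'))"
      unfolding split by (simp add: chain_kernel_def site_pos_def infsum_laplace_kernel diff_diff_eq)
    show "coord (blinfun_apply T \<psi>) (Inr n) =
       - (coord \<psi> (Inr (n + 1)) - 2 * coord \<psi> (Inr n) + coord \<psi> (Inr (n - 1)))
       + (\<Sum>\<^sub>\<infinity>n'. complex_of_real (h ((1 - \<theta>) * real_of_int n + b - real_of_int n')) * coord \<psi> (Inl n'))"
      unfolding split by (simp add: chain_kernel_def site_pos_def infsum_laplace_kernel add.commute)
  qed
  have "H b = T" unfolding H_op_def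
  proof (rule the_equality)
    show "?P T" by (rule PT)
    fix T' :: chain_op assume "?P T'"
    then have "coord (T' \<psi>) v = coord (T \<psi>) v" for \<psi> v using PT by (cases v) auto
    then show "T' = T" by (intro blinfun_eqI ell2_eqI)
  qed
  then show ?thesis using T by simp
qed

lemma H_selfadj: "selfadj (H b)" by (rule has_kernel_selfadj[OF H_has_kernel norm_bound(2)])

lemma H_norm: "norm (H b) \<le> norm_bound" by (rule has_kernel_norm_le[OF H_has_kernel norm_bound(2)])

lemma H_trunc_eq: "H_trunc \<theta> h b L = proj_op (sites b L) o\<^sub>L H b o\<^sub>L proj_op (sites b L)"
  by (simp add: H_trunc_def P_Lambda_def Lambda_sites_def)

lemma H_trunc_selfadj: "selfadj (H_trunc \<theta> h b L)"
  unfolding H_trunc_eq by (rule selfadj_compress[OF H_selfadj])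

lemma H_trunc_norm: "norm (H_trunc \<theta> h b L) \<le> norm_bound"
  unfolding H_trunc_eq by (rule norm_compress_le[OF H_norm])

lemma sites_iff: "v \<in> sites b L \<longleftrightarrow> - L \<le> pos b v \<and> pos b v \<le> L"
  using theta
  by (cases v) (auto simp: Lambda_sites_def Lambda1_def Lambda2_def site_pos_def field_simps)

text \<open>If u lies in the window and v outside, the distance from u to v is at least the distance
  from u to L or to -L. Half of the decay rate pays for this distance, giving the factor
  \<open>X u\<close>; the other half remains to sum the squares over v. The sum of
  \<open>X u\<close> over all u is concentrated at the two boundary points and hence bounded
  independently of b and L.\<close>

lemma boundary_bounded:
  obtains B where "0 \<le> B" "\<And>b L. (\<Sum>u\<in>sites b L. norm (H b (delta u) - proj_op (sites b L) (H b (delta u)))) \<le> B"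
proof -
  obtain B1 where B1: "0 < B1" "\<And>b t F. finite F \<Longrightarrow> (\<Sum>v\<in>F. exp (- c * \<bar>pos b v - t\<bar>)) \<le> B1"
    using site_exp_sum_bounded[OF c_pos] by blast
  have c2: "0 < c / 2" using c_pos by simp
  obtain B2 where B2: "0 < B2" "\<And>b t F. finite F \<Longrightarrow> (\<Sum>v\<in>F. exp (- (c / 2) * \<bar>pos b v - t\<bar>)) \<le> B2"
    using site_exp_sum_bounded[OF c2] by blast
  have "(\<Sum>u\<in>sites b L. norm (H b (delta u) - proj_op (sites b L) (H b (delta u)))) \<le> decay_const * sqrt B1 * (B2 + B2)" for b L
  proof -
    let ?S = "sites b L"
    define X where "X u = exp (- (c / 2) * \<bar>pos b u - L\<bar>) + exp (- (c / 2) * \<bar>pos b u - (- L)\<bar>)" for u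
    have X0: "0 \<le> X u" for u by (simp add: X_def add_nonneg_nonneg)
    have r: "norm (H b (delta u) - proj_op ?S (H b (delta u))) \<le> decay_const * sqrt B1 * X u" if u: "u \<in> ?S" for u
    proof -
      let ?r = "H b (delta u) - proj_op ?S (H b (delta u))"
      have pt: "cmod (coord ?r v) \<le> decay_const * X u * exp (- (c / 2) * \<bar>pos b v - pos b u\<bar>)" for v
      proof (cases "v \<in> ?S")
        case True
        then show ?thesis using decay_const_pos X0 by (simp add: proj_op.rep_eq coord_simps)
      next
        case False
        have "exp (- (c / 2) * \<bar>pos b v - pos b u\<bar>) \<le> X u"
        proof -
          have "\<bar>pos b u - L\<bar> \<le> \<bar>pos b v - pos b u\<bar> \<or> \<bar>pos b u - (- L)\<bar> \<le> \<bar>pos b v - pos b u\<bar>"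
            using u False unfolding sites_iff by linarith
          then have "exp (- (c / 2) * \<bar>pos b v - pos b u\<bar>) \<le> exp (- (c / 2) * \<bar>pos b u - L\<bar>) \<or>
             exp (- (c / 2) * \<bar>pos b v - pos b u\<bar>) \<le> exp (- (c / 2) * \<bar>pos b u - (- L)\<bar>)"
            using c_pos by auto
          then show ?thesis
            using exp_ge_zero[of "- (c / 2) * \<bar>pos b u - L\<bar>"] exp_ge_zero[of "- (c / 2) * \<bar>pos b u - (- L)\<bar>"]
            unfolding X_def by linarith
        qed
        then have "decay_const * (exp (- (c / 2) * \<bar>pos b v - pos b u\<bar>) * exp (- (c / 2) * \<bar>pos b v - pos b u\<bar>))
            \<le> decay_const * (X u * exp (- (c / 2) * \<bar>pos b v - pos b u\<bar>))"
          using decay_const_pos by (intro mult_left_mono mult_right_mono) auto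
        moreover have "exp (- (c / 2) * \<bar>pos b v - pos b u\<bar>) * exp (- (c / 2) * \<bar>pos b v - pos b u\<bar>)
            = exp (- c * \<bar>pos b v - pos b u\<bar>)" by (simp flip: exp_add)
        moreover have "cmod (coord ?r v) = \<bar>K b v u\<bar>"
          using False by (simp add: proj_op.rep_eq coord_simps has_kernel_delta[OF H_has_kernel])
        ultimately show ?thesis using kernel_decay[of b v u] by (simp add: mult.assoc)
      qed
      have nn: "0 \<le> decay_const * sqrt B1 * X u" using decay_const_pos B1 X0 by simp
      have "\<exists>g. coord g = coord ?r \<and> norm g \<le> decay_const * sqrt B1 * X u"
      proof (rule ell2_of_bounded_sums[OF _ nn])
        fix F :: "(int + int) set" assume F: "finite F"
        have "(\<Sum>v\<in>F. (cmod (coord ?r v))\<^sup>2) \<le> (\<Sum>v\<in>F. (decay_const * X u * exp (- (c / 2) * \<bar>pos b v - pos b u\<bar>))\<^sup>2)"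
          by (intro sum_mono power_mono pt) auto
        also have "\<dots> = (decay_const * X u)\<^sup>2 * (\<Sum>v\<in>F. exp (- c * \<bar>pos b v - pos b u\<bar>))"
          unfolding sum_distrib_left
          by (rule sum.cong) (auto simp: power_mult_distrib simp flip: exp_double)
        also have "\<dots> \<le> (decay_const * X u)\<^sup>2 * B1" by (intro mult_left_mono B1(2) F) auto
        also have "\<dots> = (decay_const * sqrt B1 * X u)\<^sup>2" using B1(1) by (simp add: power_mult_distrib)
        finally show "(\<Sum>v\<in>F. (cmod (coord ?r v))\<^sup>2) \<le> (decay_const * sqrt B1 * X u)\<^sup>2" .
      qed
      then show ?thesis by (auto simp: coord_inject)
    qed
    have "(\<Sum>u\<in>?S. norm (H b (delta u) - proj_op ?S (H b (delta u)))) \<le> (\<Sum>u\<in>?S. decay_const * sqrt B1 * X u)"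
      by (intro sum_mono r)
    also have "\<dots> = decay_const * sqrt B1 * (\<Sum>u\<in>?S. X u)" by (simp add: sum_distrib_left)
    also have "\<dots> \<le> decay_const * sqrt B1 * (B2 + B2)"
      using decay_const_pos B1(1) unfolding X_def sum.distrib
      by (intro mult_left_mono add_mono B2(2) finite_Lambda_sites) auto
    finally show ?thesis .
  qed
  then show thesis using decay_const_pos B1(1) B2(1) by (intro that[of "decay_const * sqrt B1 * (B2 + B2)"]) auto
qed

section \<open>Norm continuity of b \<mapsto> H(b)\<close>

lemma h_modulus:
  assumes e: "0 < e"
  obtains d where "0 < d" "\<And>x y. \<bar>x - y\<bar> < d \<Longrightarrow> \<bar>h x - h y\<bar> \<le> e * exp (- (c / 2) * \<bar>x\<bar>)"
proof -
  \<comment> \<open>The factor exp c accounts for |y| being at least |x| - 1, so that A exp (- c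
    |x|) bounds |h x| + |h y|.\<close>
  define A where "A = C * (1 + exp c)"
  have A: "0 < A" using C_pos by (simp add: A_def add_pos_pos)
  \<comment> \<open>Beyond R half of the decay already makes A exp (- c |x| / 2) at most e, while
    the other half is kept as the weight needed for summing along rows. Inside, uniform continuity
    is used with precision e exp (- c R / 2).\<close>
  define R where "R = max 0 (2 / c * ln (A / e))"
  have R: "0 \<le> R" "A * exp (- (c / 2) * R) \<le> e"
  proof -
    have "2 / c * ln (A / e) \<le> R" by (simp add: R_def)
    then have "ln (A / e) \<le> (c / 2) * R" using c_pos by (simp add: field_simps)
    then have "A / e \<le> exp ((c / 2) * R)" using A e by (metis divide_pos_pos exp_le_cancel_iff exp_ln)
    then show "A * exp (- (c / 2) * R) \<le> e" using e by (simp add: exp_minus field_simps)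
  qed (simp add: R_def)
  have "uniformly_continuous_on {- (R + 1)..R + 1} h"
    by (intro compact_uniformly_continuous) (auto intro: continuous_on_subset[OF h_cont])
  moreover have "0 < e * exp (- (c / 2) * R)" using e by simp
  ultimately obtain d where d: "0 < d" "\<And>x y. x \<in> {- (R + 1)..R + 1} \<Longrightarrow> y \<in> {- (R + 1)..R + 1} \<Longrightarrow>
      dist y x < d \<Longrightarrow> dist (h y) (h x) < e * exp (- (c / 2) * R)"
    unfolding uniformly_continuous_on_def by metis
  have "\<bar>h x - h y\<bar> \<le> e * exp (- (c / 2) * \<bar>x\<bar>)" if xy: "\<bar>x - y\<bar> < min d 1" for x y
  proof (cases "\<bar>x\<bar> \<le> R")
    case True
    then have "dist (h x) (h y) < e * exp (- (c / 2) * R)"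
      using xy by (intro d(2)) (auto simp: dist_real_def)
    also have "\<dots> \<le> e * exp (- (c / 2) * \<bar>x\<bar>)" using True e c_pos by (intro mult_left_mono) auto
    finally show ?thesis by (simp add: dist_real_def)
  next
    case False
    have "exp (- c * \<bar>y\<bar>) \<le> exp (c + - c * \<bar>x\<bar>)"
    proof -
      have "c * (\<bar>x\<bar> - 1) \<le> c * \<bar>y\<bar>" using xy c_pos by (intro mult_left_mono) auto
      then show ?thesis by (simp add: algebra_simps)
    qed
    then have "\<bar>h y\<bar> \<le> C * (exp c * exp (- c * \<bar>x\<bar>))"
      using h_decay[of y] C_pos by (intro order_trans[OF h_decay] mult_left_mono) (auto simp flip: exp_add)
    then have "\<bar>h x - h y\<bar> \<le> A * exp (- c * \<bar>x\<bar>)"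
      using h_decay[of x] by (simp add: A_def algebra_simps)
    also have "\<dots> = A * exp (- (c / 2) * \<bar>x\<bar>) * exp (- (c / 2) * \<bar>x\<bar>)"
      by (simp flip: exp_add add: mult.assoc)
    also have "\<dots> \<le> A * exp (- (c / 2) * R) * exp (- (c / 2) * \<bar>x\<bar>)"
      using False A c_pos by (intro mult_right_mono mult_left_mono) auto
    also have "\<dots> \<le> e * exp (- (c / 2) * \<bar>x\<bar>)" using R by (intro mult_right_mono) auto
    finally show ?thesis .
  qed
  then show thesis using d(1) by (intro that[of "min d 1"]) auto
qed

text \<open>Only the entries between different layers depend on b. Their increments carry an
  exponential weight that is summable along rows, so the Schur test bounds the norm of the
  difference.\<close>

lemma H_continuous: "continuous_on UNIV H"
  unfolding continuous_on_iff
proof (intro ballI allI impI)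
  fix b e :: real assume e: "0 < e"
  have c2: "0 < c / 2" using c_pos by simp
  obtain B where B: "0 < B" "\<And>b t F. finite F \<Longrightarrow> (\<Sum>v\<in>F. exp (- (c / 2) * \<bar>pos b v - t\<bar>)) \<le> B"
    using site_exp_sum_bounded[OF c2] by blast
  have "0 < e / (2 * B)" using e B by simp
  then obtain d where d: "0 < d" "\<And>x y. \<bar>x - y\<bar> < d \<Longrightarrow> \<bar>h x - h y\<bar> \<le> e / (2 * B) * exp (- (c / 2) * \<bar>x\<bar>)"
    using h_modulus by metis
  have "dist (H b') (H b) < e" if b': "dist b' b < d" for b'
  proof -
    have pt: "\<bar>K b v w - K b' v w\<bar> \<le> e / (2 * B) * exp (- (c / 2) * \<bar>pos b w - pos b v\<bar>)" for v w
    proof (cases "isl v = isl w")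
      case True
      then have "K b v w = K b' v w" by (cases v; cases w) (auto simp: chain_kernel_def)
      then show ?thesis using e B by simp
    next
      case False
      then have "K b v w = h (pos b v - pos b w)" "K b' v w = h (pos b' v - pos b' w)"
        "\<bar>(pos b v - pos b w) - (pos b' v - pos b' w)\<bar> < d"
        using b' by (cases v; cases w; auto simp: chain_kernel_def site_pos_def dist_real_def)+
      then show ?thesis using d(2)[of "pos b v - pos b w"] by (simp add: abs_minus_commute)
    qed
    have "schur_kernel (\<lambda>v w. K b v w - K b' v w) (e / 2)"
    proof (rule schur_kernelI)
      fix v and F :: "(int + int) set" assume F: "finite F"
      have "(\<Sum>w\<in>F. \<bar>K b v w - K b' v w\<bar>) \<le> e / (2 * B) * (\<Sum>w\<in>F. exp (- (c / 2) * \<bar>pos b w - pos b v\<bar>))"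
        unfolding sum_distrib_left by (intro sum_mono pt)
      also have "\<dots> \<le> e / (2 * B) * B" using e B(1) by (intro mult_left_mono B(2) F) auto
      finally show "(\<Sum>w\<in>F. \<bar>K b v w - K b' v w\<bar>) \<le> e / 2" using B(1) by simp
    qed (use e kernel_sym in auto)
    then have "norm (H b - H b') \<le> e / 2"
      by (intro has_kernel_norm_le[OF has_kernel_diff[OF H_has_kernel H_has_kernel norm_bound(2) norm_bound(2)]])
    then show ?thesis using e by (simp add: dist_norm norm_minus_commute)
  qed
  then show "\<exists>d>0. \<forall>b'\<in>UNIV. dist b' b < d \<longrightarrow> dist (H b') (H b) < e" using d(1) by blast
qed

lemma poly_op_H_continuous: "continuous_on UNIV (\<lambda>b. poly_op p (H b))"
proof -
  have "continuous_on UNIV (\<lambda>b. op_power (H b) k)" for k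
  proof (induct k)
    case (Suc k)
    then show ?case unfolding op_power_Suc
      by (intro bounded_bilinear.continuous_on[OF bounded_bilinear_blinfun_compose] H_continuous)
  qed simp
  then show ?thesis unfolding poly_op_def
    by (intro continuous_on_sum bounded_bilinear.continuous_on[OF bounded_bilinear_blinfun_compose] continuous_on_const)
qed

lemma fun_calc_H_continuous:
  assumes g: "continuous_on UNIV g" shows "continuous_on UNIV (\<lambda>b. fun_calc g (H b))"
proof -
  obtain p where p: "uniform_limit {-norm_bound..norm_bound} (\<lambda>n x. poly (p n) (complex_of_real x)) g sequentially"
    using complex_poly_seq[OF g] .
  have "uniform_limit UNIV (\<lambda>n b. poly_op (p n) (H b)) (\<lambda>b. fun_calc g (H b)) sequentially"
    unfolding uniform_limit_iff
  proof (intro allI impI)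
    fix e :: real assume e: "0 < e"
    have "\<forall>\<^sub>F n in sequentially. \<forall>x\<in>{-norm_bound..norm_bound}. dist (poly (p n) (complex_of_real x)) (g x) < e / 2"
      using uniform_limitD[OF p, of "e / 2"] e by simp
    then show "\<forall>\<^sub>F n in sequentially. \<forall>b\<in>UNIV. dist (poly_op (p n) (H b)) (fun_calc g (H b)) < e"
    proof eventually_elim
      case (elim n)
      have "norm (fun_calc g (H b) - poly_op (p n) (H b)) \<le> e / 2" for b
        by (rule fun_calc_poly_close[OF H_selfadj H_norm g])
           (use elim in \<open>auto simp: dist_norm norm_minus_commute intro: less_imp_le\<close>)
      then have "norm (poly_op (p n) (H b) - fun_calc g (H b)) < e" for b
        using e by (subst norm_minus_commute) (rule order_le_less_trans[of _ "e / 2"], auto)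
      then show ?case by (simp add: dist_norm)
    qed
  qed
  then show ?thesis
    by (rule uniform_limit_theorem[rotated]) (auto intro!: always_eventually poly_op_H_continuous)
qed

lemma diag_H_continuous:
  assumes "continuous_on UNIV g" shows "continuous_on UNIV (\<lambda>b. diag (fun_calc g (H b)) v)"
proof -
  have "bounded_linear (\<lambda>T. diag T v)"
  proof (rule bounded_linear_intro[of _ 1])
    show "cmod (diag T v) \<le> norm T * 1" for T using cmod_diag_le[of T "norm T"] by simp
  qed (simp_all add: diag_coord blinfun.add_left blinfun.scaleR_left coord_simps scaleR_conv_of_real)
  then show ?thesis by (rule bounded_linear.continuous_on[OF _ fun_calc_H_continuous[OF assms]])
qed

text \<open>Shifting the layers by \<open>a\<close> and \<open>m\<close> sites conjugates \<open>H(b)\<close> into \<open>H(b - a + (1 - \<theta>) m)\<close>.\<close>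

lemma diag_covariant:
  assumes g: "continuous_on UNIV g"
  shows "diag (fun_calc g (H b)) (map_sum (\<lambda>n. n + a) (\<lambda>n. n + m) v)
    = diag (fun_calc g (H (b - of_int a + (1 - \<theta>) * of_int m))) v"
proof -
  let ?\<pi> = "map_sum (\<lambda>n. n + a) (\<lambda>n. n + m)"
  have "bij ?\<pi>"
    by (rule o_bij[of "map_sum (\<lambda>n. n - a) (\<lambda>n. n - m)"]) (auto simp: fun_eq_iff map_sum.compositionality o_def sum.map_ident split: sum.splits)
  moreover have "K b (?\<pi> v) (?\<pi> w) = K (b - of_int a + (1 - \<theta>) * of_int m) v w" for v w
    by (cases v; cases w) (auto simp: chain_kernel_def site_pos_def laplace_kernel_def algebra_simps)
  ultimately show ?thesis
    using fun_calc_diag_reindex[OF H_has_kernel[of b] norm_bound(2), where x = v and g = g and \<pi> = ?\<pi>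
        and T' = "H (b - of_int a + (1 - \<theta>) * of_int m)"]
      H_has_kernel[of "b - of_int a + (1 - \<theta>) * of_int m"] H_selfadj g
    by (simp add: diag_coord)
qed

section \<open>Limits of the averages\<close>

lemma dos_average_sites:
  "dos_average \<theta> h b L g = (\<Sum>v\<in>sites b L. diag (fun_calc g (H_trunc \<theta> h b L)) v) / of_nat (card_Lambda \<theta> b L)"
  unfolding dos_average_def by (simp add: sum_Lambda_sites)

lemma Lambda2_length: "(L - b) / (1 - \<theta>) - (- L - b) / (1 - \<theta>) = 2 * L / (1 - \<theta>)"
  by (simp add: diff_divide_distrib[symmetric])

lemma length_at_top: "filterlim (\<lambda>L::real. L - - L) at_top at_top"
  "filterlim (\<lambda>L::real. (L - b) / (1 - \<theta>) - (- L - b) / (1 - \<theta>)) at_top at_top"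
proof -
  have a: "filterlim (\<lambda>L::real. a * L) at_top at_top" if "a > 0" for a
    by (rule filterlim_tendsto_pos_mult_at_top[OF tendsto_const that filterlim_ident])
  show "filterlim (\<lambda>L::real. L - - L) at_top at_top" using a[of 2] by simp
  show "filterlim (\<lambda>L::real. (L - b) / (1 - \<theta>) - (- L - b) / (1 - \<theta>)) at_top at_top"
    unfolding Lambda2_length using a[of "2 / (1 - \<theta>)"] theta by simp
qed

text \<open>Ratios of step and period: layer 1 is sampled with step -1 along the period 1 -
  \<theta>, layer 2 with step 1 - \<theta> along the period 1.\<close>

lemma irrational_steps: "- 1 / (1 - \<theta>) \<notin> \<rat>" "(1 - \<theta>) / 1 \<notin> \<rat>"
proof -
  show 1: "(1 - \<theta>) / 1 \<notin> \<rat>"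
  proof
    assume "(1 - \<theta>) / 1 \<in> \<rat>"
    from Rats_diff[OF Rats_1 this] show False using theta by simp
  qed
  show "- 1 / (1 - \<theta>) \<notin> \<rat>"
  proof
    assume "- 1 / (1 - \<theta>) \<in> \<rat>"
    from Rats_add[OF Rats_1 Rats_inverse[OF this]] show False using theta by simp
  qed
qed

text \<open>After division by 2 L both integrals get the same factor 1 / (1 - \<theta>), for
  different reasons: in layer 1 it is the inverse period, in layer 2 it is the density of
  sites.\<close>

lemma sum_layers_tendsto:
  fixes F1 F2 :: "real \<Rightarrow> 'a::{real_normed_vector, banach}"
  assumes F1: "continuous_on UNIV F1" "\<And>x. F1 (x + (1 - \<theta>)) = F1 x"
    and F2: "continuous_on UNIV F2" "\<And>x. F2 (x + 1) = F2 x"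
  shows "((\<lambda>L. ((\<Sum>x\<in>Lambda1 L. F1 (b - of_int x)) + (\<Sum>x\<in>Lambda2 \<theta> b L. F2 (b + (1 - \<theta>) * of_int x))) /\<^sub>R (2 * L))
    \<longlongrightarrow> (1 / (1 - \<theta>)) *\<^sub>R (integral {0..1 - \<theta>} F1 + integral {0..1} F2)) at_top"
proof -
  have th: "0 < 1 - \<theta>" using theta by simp
  have 1: "((\<lambda>L. (\<Sum>x\<in>Lambda1 L. F1 (b + - 1 * of_int x)) /\<^sub>R (L - - L))
      \<longlongrightarrow> (1 / (1 - \<theta>)) *\<^sub>R integral {0..1 - \<theta>} F1) at_top"
    unfolding Lambda1_def
    by (rule equidistribution_interval[OF F1(1) th F1(2) irrational_steps(1) length_at_top(1)])
  have 2: "((\<lambda>L. (\<Sum>x\<in>Lambda2 \<theta> b L. F2 (b + (1 - \<theta>) * of_int x)) /\<^sub>R ((L - b) / (1 - \<theta>) - (- L - b) / (1 - \<theta>)))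
      \<longlongrightarrow> (1 / 1) *\<^sub>R integral {0..1} F2) at_top"
    unfolding Lambda2_def
    by (rule equidistribution_interval[OF F2(1) zero_less_one F2(2) irrational_steps(2) length_at_top(2)])
  have "((\<lambda>L. (\<Sum>x\<in>Lambda1 L. F1 (b + - 1 * of_int x)) /\<^sub>R (L - - L)
        + (1 / (1 - \<theta>)) *\<^sub>R ((\<Sum>x\<in>Lambda2 \<theta> b L. F2 (b + (1 - \<theta>) * of_int x)) /\<^sub>R ((L - b) / (1 - \<theta>) - (- L - b) / (1 - \<theta>))))
      \<longlongrightarrow> (1 / (1 - \<theta>)) *\<^sub>R integral {0..1 - \<theta>} F1 + (1 / (1 - \<theta>)) *\<^sub>R ((1 / 1) *\<^sub>R integral {0..1} F2)) at_top"
    by (intro tendsto_add tendsto_scaleR tendsto_const 1 2)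
  then show ?thesis
    unfolding Lambda2_length using th by (simp add: scaleR_add_right inverse_eq_divide)
qed

text \<open>Counting sites is \<open>sum_layers_tendsto\<close> for the constant function 1.\<close>

lemma card_Lambda_tendsto:
  "((\<lambda>L. real (card_Lambda \<theta> b L) / (2 * L)) \<longlongrightarrow> (1 + (1 - \<theta>)) / (1 - \<theta>)) at_top"
proof -
  have "((\<lambda>L. ((\<Sum>x\<in>Lambda1 L. 1) + (\<Sum>x\<in>Lambda2 \<theta> b L. 1 :: real)) /\<^sub>R (2 * L))
      \<longlongrightarrow> (1 / (1 - \<theta>)) *\<^sub>R (integral {0..1 - \<theta>} (\<lambda>_. 1) + integral {0..1::real} (\<lambda>_. 1))) at_top"
    by (rule sum_layers_tendsto) auto
  moreover have "(1 / (1 - \<theta>)) *\<^sub>R (integral {0..1 - \<theta>} (\<lambda>_. 1) + integral {0..1::real} (\<lambda>_. 1)) = (1 + (1 - \<theta>)) / (1 - \<theta>)"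
    using theta by simp
  moreover have "((\<Sum>x\<in>Lambda1 L. 1) + (\<Sum>x\<in>Lambda2 \<theta> b L. 1 :: real)) /\<^sub>R (2 * L) = real (card_Lambda \<theta> b L) / (2 * L)" for L
    by (simp only: card_Lambda_def real_of_card of_nat_add real_scaleR_def divide_inverse mult.commute)
  ultimately show ?thesis by (simp only:)
qed

lemma inverse_card_Lambda_tendsto: "((\<lambda>L. 1 / real (card_Lambda \<theta> b L)) \<longlongrightarrow> 0) at_top"
proof -
  have "((\<lambda>L. (1 / (2 * L)) / (real (card_Lambda \<theta> b L) / (2 * L))) \<longlongrightarrow> 0 / ((1 + (1 - \<theta>)) / (1 - \<theta>))) at_top"
  proof (rule tendsto_divide[OF _ card_Lambda_tendsto])
    show "((\<lambda>L::real. 1 / (2 * L)) \<longlongrightarrow> 0) at_top" by real_asymp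
  qed (use theta in auto)
  moreover have "\<forall>\<^sub>F L in at_top. (1 / (2 * L)) / (real (card_Lambda \<theta> b L) / (2 * L)) = 1 / real (card_Lambda \<theta> b L)"
    using eventually_gt_at_top[of 0] by eventually_elim simp
  ultimately have "((\<lambda>L. 1 / real (card_Lambda \<theta> b L)) \<longlongrightarrow> 0 / ((1 + (1 - \<theta>)) / (1 - \<theta>))) at_top"
    by (rule Lim_transform_eventually)
  then show ?thesis by simp
qed

lemma full_average_tendsto:
  assumes g: "continuous_on UNIV g"
  shows "((\<lambda>L. (\<Sum>v\<in>sites b L. diag (fun_calc g (H b)) v) / of_nat (card_Lambda \<theta> b L)) \<longlongrightarrow> dos_limit \<theta> h g) at_top"
proof -
  have th: "0 < 1 - \<theta>" using theta by simp
  define F1 where "F1 b = diag (fun_calc g (H b)) (Inl 0)" for b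
  define F2 where "F2 b = diag (fun_calc g (H b)) (Inr 0)" for b
  \<comment> \<open>Shifting layer 2 by one site yields the period 1 - \<theta> of
    \<open>F1\<close>, and shifting layer 1 yields the period 1 of \<open>F2\<close>. General shifts
    express the diagonal entry at site x through \<open>F1\<close> at b - x and \<open>F2\<close> at
    b + (1 - \<theta>) x.\<close>
  have F1: "continuous_on UNIV F1" "F1 (x + (1 - \<theta>)) = F1 x" for x
    unfolding F1_def using diag_H_continuous[OF g] diag_covariant[OF g, of x 0 1 "Inl 0"] by auto
  have F2: "continuous_on UNIV F2" "F2 (x + 1) = F2 x" for x
    unfolding F2_def using diag_H_continuous[OF g] diag_covariant[OF g, of x "-1" 0 "Inr 0"] by auto
  have sum: "(\<Sum>v\<in>sites b L. diag (fun_calc g (H b)) v)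
      = (\<Sum>x\<in>Lambda1 L. F1 (b - of_int x)) + (\<Sum>x\<in>Lambda2 \<theta> b L. F2 (b + (1 - \<theta>) * of_int x))" for L
    using diag_covariant[OF g, of b _ 0 "Inl 0"] diag_covariant[OF g, of b 0 _ "Inr 0"]
    by (simp add: sum_Lambda_sites F1_def F2_def)
  have conv: "(z /\<^sub>R a) /\<^sub>R (real n / a) = z / of_nat n" if "a \<noteq> 0" for z :: complex and a n
  proof -
    have "inverse (real n / a) * inverse a = inverse (real n)" using that by (simp add: divide_inverse)
    then have "(z /\<^sub>R a) /\<^sub>R (real n / a) = inverse (real n) *\<^sub>R z" by (simp only: scaleR_scaleR)
    then show ?thesis by (simp add: scaleR_conv_of_real divide_inverse)
  qed
  \<comment> \<open>Dividing by the limiting site density cancels 1 / (1 - \<theta>) and leaves the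
    weight 1 / (1 + (1 - \<theta>)) for both integrals. In \<open>dos_limit\<close> the first weight
    has the additional numerator 1 - \<theta>, which compensates the normalization of the uniform
    measure on the first period.\<close>
  have lim: "dos_limit \<theta> h g
    = ((1 / (1 - \<theta>)) *\<^sub>R (integral {0..1 - \<theta>} F1 + integral {0..1} F2)) /\<^sub>R ((1 + (1 - \<theta>)) / (1 - \<theta>))"
  proof -
    have "dos_limit \<theta> h g = ((1 - \<theta>) / (1 + (1 - \<theta>))) *\<^sub>R ((1 / (1 - \<theta>)) *\<^sub>R integral {0..1 - \<theta>} F1)
        + (1 / (1 + (1 - \<theta>))) *\<^sub>R ((1 / 1) *\<^sub>R integral {0..1} F2)"
      using uniform_measure_integral[OF F1(1) th] uniform_measure_integral[OF F2(1) zero_less_one]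
      unfolding dos_limit_def F1_def F2_def by (simp only: scaleR_conv_of_real)
    then show ?thesis using th by (simp add: scaleR_add_right)
  qed
  have "((\<lambda>L. ((\<Sum>v\<in>sites b L. diag (fun_calc g (H b)) v) /\<^sub>R (2 * L)) /\<^sub>R (real (card_Lambda \<theta> b L) / (2 * L)))
    \<longlongrightarrow> dos_limit \<theta> h g) at_top"
    unfolding lim sum
    by (rule tendsto_scaleR[OF tendsto_inverse[OF card_Lambda_tendsto] sum_layers_tendsto[OF F1 F2]])
       (use theta in auto)
  moreover have "\<forall>\<^sub>F L in at_top. ((\<Sum>v\<in>sites b L. diag (fun_calc g (H b)) v) /\<^sub>R (2 * L)) /\<^sub>R (real (card_Lambda \<theta> b L) / (2 * L))
     = (\<Sum>v\<in>sites b L. diag (fun_calc g (H b)) v) / of_nat (card_Lambda \<theta> b L)"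
    using eventually_gt_at_top[of 0]
    by eventually_elim (rule conv, simp)
  ultimately show ?thesis by (rule Lim_transform_eventually)
qed

text \<open>Replacing g by p costs e/4 per site for each of the two operators, hence e/2 after
  averaging. The remaining sum of polynomial differences is at most the constant D B, which the
  growing number of sites makes negligible.\<close>

lemma truncation_error_tendsto:
  assumes g: "continuous_on UNIV g"
  shows "((\<lambda>L. dos_average \<theta> h b L g - (\<Sum>v\<in>sites b L. diag (fun_calc g (H b)) v) / of_nat (card_Lambda \<theta> b L))
     \<longlongrightarrow> 0) at_top"
proof (rule tendstoI)
  fix e :: real assume e: "0 < e"
  obtain p where p: "\<And>x. x \<in> {-norm_bound..norm_bound} \<Longrightarrow> cmod (g x - poly p (complex_of_real x)) \<le> e / 4"
    using complex_poly_approx[of norm_bound g "e / 4"] g e continuous_on_subset by fastforce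
  obtain B where B: "0 \<le> B" "\<And>b L. (\<Sum>u\<in>sites b L. norm (H b (delta u) - proj_op (sites b L) (H b (delta u)))) \<le> B"
    using boundary_bounded by blast
  obtain D where D: "0 \<le> D" "\<And>(T :: chain_op) S. selfadj T \<Longrightarrow> norm T \<le> norm_bound \<Longrightarrow> finite S \<Longrightarrow>
    (\<Sum>x\<in>S. cmod (coord (poly_op p (proj_op S o\<^sub>L T o\<^sub>L proj_op S) (delta x)) x - coord (poly_op p T (delta x)) x))
     \<le> D * (\<Sum>u\<in>S. norm (T (delta u) - proj_op S (T (delta u))))"
    using compress_poly_diag[OF less_imp_le[OF norm_bound(1)], of p] by blast
  have "((\<lambda>L. D * B * (1 / real (card_Lambda \<theta> b L))) \<longlongrightarrow> D * B * 0) at_top"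
    by (intro tendsto_mult tendsto_const inverse_card_Lambda_tendsto)
  then have "\<forall>\<^sub>F L in at_top. D * B * (1 / real (card_Lambda \<theta> b L)) < e / 2"
    using e by (intro order_tendstoD(2)) auto
  then show "\<forall>\<^sub>F L in at_top. dist (dos_average \<theta> h b L g
      - (\<Sum>v\<in>sites b L. diag (fun_calc g (H b)) v) / of_nat (card_Lambda \<theta> b L)) 0 < e"
    using eventually_gt_at_top[of 0]
  proof eventually_elim
    case (elim L)
    let ?S = "sites b L" and ?A = "H_trunc \<theta> h b L" and ?n = "card_Lambda \<theta> b L"
    have n: "real ?n > 0" using card_Lambda_pos[OF elim(2)] by simp
    have "cmod (diag (fun_calc g ?A) v - diag (fun_calc g (H b)) v)
       \<le> e / 2 + cmod (diag (poly_op p ?A) v - diag (poly_op p (H b)) v)" for v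
    proof -
      have 1: "cmod (diag (fun_calc g ?A - poly_op p ?A) v) \<le> e / 4"
        by (intro cmod_diag_le fun_calc_poly_close[OF H_trunc_selfadj H_trunc_norm g] p)
      have 2: "cmod (diag (fun_calc g (H b) - poly_op p (H b)) v) \<le> e / 4"
        by (intro cmod_diag_le fun_calc_poly_close[OF H_selfadj H_norm g] p)
      have "diag (fun_calc g ?A) v - diag (fun_calc g (H b)) v
        = diag (fun_calc g ?A - poly_op p ?A) v - diag (fun_calc g (H b) - poly_op p (H b)) v
          + (diag (poly_op p ?A) v - diag (poly_op p (H b)) v)"
        by (simp add: diag_coord blinfun.diff_left coord_diff)
      also have "cmod \<dots> \<le> (e / 4 + e / 4) + cmod (diag (poly_op p ?A) v - diag (poly_op p (H b)) v)"
        by (intro order_trans[OF norm_triangle_ineq] add_right_mono order_trans[OF norm_triangle_ineq4] add_mono 1 2)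
      finally show ?thesis by simp
    qed
    then have "(\<Sum>v\<in>?S. cmod (diag (fun_calc g ?A) v - diag (fun_calc g (H b)) v))
        \<le> (\<Sum>v\<in>?S. e / 2 + cmod (diag (poly_op p ?A) v - diag (poly_op p (H b)) v))" by (intro sum_mono)
    also have "\<dots> = real ?n * (e / 2) + (\<Sum>v\<in>?S. cmod (diag (poly_op p ?A) v - diag (poly_op p (H b)) v))"
      by (simp add: sum.distrib card_Lambda_eq)
    also have "(\<Sum>v\<in>?S. cmod (diag (poly_op p ?A) v - diag (poly_op p (H b)) v)) \<le> D * B"
      unfolding diag_coord H_trunc_eq
      by (rule order_trans[OF D(2)[OF H_selfadj H_norm finite_Lambda_sites] mult_left_mono[OF B(2) D(1)]])
    finally have s: "(\<Sum>v\<in>?S. cmod (diag (fun_calc g ?A) v - diag (fun_calc g (H b)) v)) \<le> real ?n * (e / 2) + D * B"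
      by simp
    have "cmod (dos_average \<theta> h b L g - (\<Sum>v\<in>?S. diag (fun_calc g (H b)) v) / of_nat ?n)
        = cmod (\<Sum>v\<in>?S. diag (fun_calc g ?A) v - diag (fun_calc g (H b)) v) / real ?n"
      by (simp add: dos_average_sites sum_subtractf norm_divide flip: diff_divide_distrib)
    also have "\<dots> \<le> (real ?n * (e / 2) + D * B) / real ?n"
      by (intro divide_right_mono order_trans[OF norm_sum s]) simp
    also have "\<dots> = e / 2 + D * B * (1 / real ?n)" using n by (simp add: field_simps)
    also have "\<dots> < e" using elim(1) by linarith
    finally show ?case by simp
  qed
qed

lemma dos_average_tendsto:
  assumes "continuous_on UNIV g" shows "((\<lambda>L. dos_average \<theta> h b L g) \<longlongrightarrow> dos_limit \<theta> h g) at_top"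
  using tendsto_add[OF truncation_error_tendsto[OF assms] full_average_tendsto[OF assms], of b b] by simp

section \<open>The averages and their limit as states\<close>

lemma dos_average_add:
  assumes "continuous_on UNIV f" "continuous_on UNIV g"
  shows "dos_average \<theta> h b L (\<lambda>x. f x + g x) = dos_average \<theta> h b L f + dos_average \<theta> h b L g"
  by (simp add: dos_average_sites diag_coord fun_calc_add[OF H_trunc_selfadj assms] coord_add sum.distrib add_divide_distrib)

lemma dos_average_mult:
  assumes "continuous_on UNIV f"
  shows "dos_average \<theta> h b L (\<lambda>x. a * f x) = a * dos_average \<theta> h b L f"
  by (simp add: dos_average_sites diag_coord fun_calc_cmult[OF H_trunc_selfadj assms] scaleC.rep_eq flip: sum_distrib_left)

lemma dos_average_one: "0 < L \<Longrightarrow> dos_average \<theta> h b L (\<lambda>_. 1) = 1"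
  using card_Lambda_pos[of L \<theta> b]
  by (simp add: dos_average_sites diag_coord fun_calc_one[OF H_trunc_selfadj] delta.rep_eq flip: card_Lambda_eq)

lemma dos_average_bound:
  assumes "0 < L" "continuous_on UNIV f" "\<And>x. x \<in> {-norm_bound..norm_bound} \<Longrightarrow> cmod (f x) \<le> e"
  shows "cmod (dos_average \<theta> h b L f) \<le> e"
proof -
  have n: "real (card_Lambda \<theta> b L) > 0" using card_Lambda_pos[OF assms(1)] by simp
  have "cmod (\<Sum>v\<in>sites b L. diag (fun_calc f (H_trunc \<theta> h b L)) v) \<le> (\<Sum>v\<in>sites b L. e)"
    by (intro sum_norm_le cmod_diag_le fun_calc_norm_le[OF H_trunc_selfadj H_trunc_norm assms(2,3)])
  then have "cmod (dos_average \<theta> h b L f) \<le> (real (card_Lambda \<theta> b L) * e) / real (card_Lambda \<theta> b L)"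
    unfolding dos_average_sites norm_divide norm_of_nat by (intro divide_right_mono) (auto simp: card_Lambda_eq)
  then show ?thesis using n by simp
qed

lemma integral_dos_measure_trunc:
  assumes "0 < L" "g \<in> Cc" shows "(LINT x|dos_measure_trunc \<theta> h b L. g x) = dos_average \<theta> h b L g"
  unfolding dos_measure_trunc_def
  by (rule integral_state_measure[of "dos_average \<theta> h b L" norm_bound, OF dos_average_add dos_average_mult
        dos_average_one[OF assms(1)] norm_bound(1) dos_average_bound[OF assms(1)] assms(2)])

text \<open>\<open>dos_limit\<close> inherits the state properties from the averages, of which it is
  the limit as L grows; b = 0 serves as a representative value.\<close>

lemma integral_dos_measure:
  assumes "g \<in> Cc" shows "(LINT x|dos_measure \<theta> h. g x) = dos_limit \<theta> h g"
  unfolding dos_measure_def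
proof (rule integral_state_measure[of "dos_limit \<theta> h" norm_bound, OF _ _ _ norm_bound(1) _ assms])
  note lim = dos_average_tendsto[where b = 0]
  note uniq = tendsto_unique[OF trivial_limit_at_top_linorder]
  fix f g :: "real \<Rightarrow> complex" and a :: complex assume f: "continuous_on UNIV f"
  show "dos_limit \<theta> h (\<lambda>x. f x + g x) = dos_limit \<theta> h f + dos_limit \<theta> h g" if g: "continuous_on UNIV g"
    using uniq[OF lim[OF continuous_on_add[OF f g]]] tendsto_add[OF lim[OF f] lim[OF g]]
    by (simp add: dos_average_add[OF f g])
  show "dos_limit \<theta> h (\<lambda>x. a * f x) = a * dos_limit \<theta> h f"
    using uniq[OF lim[OF continuous_on_mult[OF continuous_on_const f]]] tendsto_mult[OF tendsto_const lim[OF f]]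
    by (simp add: dos_average_mult[OF f])
  show "cmod (dos_limit \<theta> h f) \<le> e" if e: "\<And>x. x \<in> {-norm_bound..norm_bound} \<Longrightarrow> cmod (f x) \<le> e" for e
  proof (rule tendsto_upperbound[OF tendsto_norm[OF lim[OF f]]])
    show "\<forall>\<^sub>F L in at_top. cmod (dos_average \<theta> h 0 L f) \<le> e"
      using eventually_gt_at_top[of 0] by eventually_elim (rule dos_average_bound[OF _ f e])
  qed simp
next
  show "dos_limit \<theta> h (\<lambda>_. 1) = 1"
  proof (rule tendsto_unique[OF trivial_limit_at_top_linorder dos_average_tendsto[where b = 0]])
    have "\<forall>\<^sub>F L in at_top. dos_average \<theta> h 0 L (\<lambda>_. 1) = 1"
      using eventually_gt_at_top[of 0] by eventually_elim (rule dos_average_one)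
    then show "((\<lambda>L. dos_average \<theta> h 0 L (\<lambda>_. 1)) \<longlongrightarrow> 1) at_top" by (rule tendsto_eventually)
  qed simp
qed

end

theorem theorem3p14:
  fixes \<theta> :: real and h :: "real \<Rightarrow> real" and \<epsilon> :: "real \<Rightarrow> real"
  assumes "0 < \<theta>" and "\<theta> < 1" and "\<theta> \<notin> \<rat>"
    and "\<forall>x. h (- x) = h x" and "smooth h" and "exp_decaying h"
    and "\<forall>b. \<forall>L>0. trace_class (H_trunc \<theta> h b L - (P_Lambda \<theta> b L o\<^sub>L H_op \<theta> h b)) \<and>
           trace_norm (H_trunc \<theta> h b L - (P_Lambda \<theta> b L o\<^sub>L H_op \<theta> h b))
             \<le> \<epsilon> L * real (card_Lambda \<theta> b L)"
    and "(\<epsilon> \<longlongrightarrow> 0) at_top"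
  shows "AE b in lebesgue.
           (\<forall>g\<in>Cc. ((\<lambda>L. dos_average \<theta> h b L g) \<longlongrightarrow> dos_limit \<theta> h g) at_top) \<and>
           (\<forall>g\<in>Cc. ((\<lambda>L. LINT x|dos_measure_trunc \<theta> h b L. g x)
                       \<longlongrightarrow> (LINT x|dos_measure \<theta> h. g x)) at_top)"
proof -
  obtain C c where Cc: "C > 0" "c > 0" "\<And>x. \<bar>h x\<bar> \<le> C * exp (- c * \<bar>x\<bar>)"
    using \<open>exp_decaying h\<close> unfolding exp_decaying_def by blast
  have "h differentiable_on UNIV"
    using \<open>smooth h\<close> unfolding smooth_def by (metis funpow_0)
  then have "continuous_on UNIV h" by (rule differentiable_imp_continuous_on)
  then interpret incommensurate_chain \<theta> h C c
    using assms Cc by unfold_locales auto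
  have "((\<lambda>L. dos_average \<theta> h b L g) \<longlongrightarrow> dos_limit \<theta> h g) at_top"
    "((\<lambda>L. LINT x|dos_measure_trunc \<theta> h b L. g x) \<longlongrightarrow> (LINT x|dos_measure \<theta> h. g x)) at_top"
    if g: "g \<in> Cc" for b g
  proof -
    show *: "((\<lambda>L. dos_average \<theta> h b L g) \<longlongrightarrow> dos_limit \<theta> h g) at_top"
      using g by (intro dos_average_tendsto) (simp add: Cc_def)
    \<comment> \<open>The average is a state for L > 0, and there the truncated measure represents
      it; this is all that the limit sees.\<close>
    have "\<forall>\<^sub>F L in at_top. dos_average \<theta> h b L g = (LINT x|dos_measure_trunc \<theta> h b L. g x)"
      using eventually_gt_at_top[of 0] by eventually_elim (simp add: integral_dos_measure_trunc[OF _ g])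
    with * show "((\<lambda>L. LINT x|dos_measure_trunc \<theta> h b L. g x) \<longlongrightarrow> (LINT x|dos_measure \<theta> h. g x)) at_top"
      unfolding integral_dos_measure[OF g] by (rule Lim_transform_eventually)
  qed
  then show ?thesis by (intro AE_I2) blast
qed

end
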